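(* Let $O$ be a $2^n\times2^n$ Hermitian matrix, let $\rho$ be an $n$-qubit state, and let $\gamma,\delta\in(0,1)$. Suppose the auxiliary states $\zeta$ in the state-based classical shadow procedure are sampled from an additive $\epsilon$-approximate state $3$-design. Then a collection of $LK$ independent classical shadows, with $$K=2\log(2/\delta),\qquad L=\frac{34}{\gamma^2}\left(3\mathrm{Tr}(O_0^2)+3\epsilon\|O\|_\infty^2(2^n+1)^2\right),$$ yields the median-of-means estimate $\hat o(L,K)$ satisfying $$\Pr\left[\,|\hat o(L,K)-\mathrm{Tr}(O\rho)|\le\gamma+(2^n+1)\epsilon\|O\|_\infty\right]\ge1-\delta.$$
   Context: State-based classical shadow procedure: registers $R_1,R_2$ of $n$ qubits each; $R_1$ holds the unknown input state $\rho$, $R_2$ holds a pure state $|\zeta\rangle$ sampled from a distribution $\mathcal S$ over pure states. Apply $n$ CNOT gates qubit by qubit with the qubits of $R_1$ as controls and those of $R_2$ as targets, then $H^{\otimes n}$ on $R_1$, then measure $R_1$ and $R_2$ in the computational basis obtaining $z$ and $x$ in $\{0,1\}^n$. Let $|\zeta_{x,z}\rangle=X^xZ^z|\zeta\rangle$ and $|\zeta^*_{x,z}\rangle$ its entrywise complex conjugate. The classical shadow is $\hat\rho=(2^n+1)|\zeta^*_{x,z}\rangle\langle\zeta^*_{x,z}|-I$, giving estimate $\mathrm{Tr}(O\hat\rho)$. $\hat o(L,K)$ is the median of $K$ means, each over $L$ estimates from independent shadows. $O_0=O-\frac{\mathrm{Tr}(O)}{2^n}I$. With $\mu$ the Haar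 measure on $n$-qubit pure states, an ensemble $\{|\psi_k\rangle\}_{k\sim\mathcal K}$ is an additive $\epsilon$-approximate state $t$-design if $\left\|\int|\phi\rangle\langle\phi|^{\otimes t}d\mu(\phi)-\mathbb E_{k\leftarrow\mathcal K}[|\psi_k\rangle\langle\psi_k|^{\otimes t}]\right\|_1\le\epsilon$ (trace norm). *)

theory Defs
  imports "HOL-Probability.Probability"
begin

text \<open>
  Conventions.  The n qubits of a register are indexed by a finite type 'q (so n = CARD('q)),
  and computational basis states of a register are bit strings b :: 'q \<Rightarrow> bool.
  A state vector of a register is an element of complex ^ ('q \<Rightarrow> bool) (Euclidean / l2 norm),
  an operator is a complex ^ ('q \<Rightarrow> bool) ^ ('q \<Rightarrow> bool) with A $ i $ j the (i,j) entry.
  Two-register objects are indexed by pairs (register R1, register R2).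
\<close>

definition cadj :: "complex ^ 'n ^ 'm \<Rightarrow> complex ^ 'm ^ 'n" where
  "cadj A = (\<chi> i j. cnj (A $ j $ i))"

definition hermitian :: "complex ^ 'n ^ 'n \<Rightarrow> bool" where
  "hermitian A \<longleftrightarrow> cadj A = A"

definition vinner :: "complex ^ 'n \<Rightarrow> complex ^ 'n \<Rightarrow> complex" where
  "vinner u v = (\<Sum>i\<in>UNIV. cnj (u $ i) * v $ i)"

definition psd :: "complex ^ 'n ^ 'n \<Rightarrow> bool" where
  "psd A \<longleftrightarrow> hermitian A \<and> (\<forall>v. vinner v (A *v v) \<in> \<real> \<and> 0 \<le> Re (vinner v (A *v v)))"

definition density_matrix :: "complex ^ 'n ^ 'n \<Rightarrow> bool" where
  "density_matrix \<rho> \<longleftrightarrow> psd \<rho> \<and> trace \<rho> = 1"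

definition outer :: "complex ^ 'n \<Rightarrow> complex ^ 'm \<Rightarrow> complex ^ 'm ^ 'n" where
  "outer u v = (\<chi> i j. u $ i * cnj (v $ j))"

definition kron :: "complex ^ 'a ^ 'a \<Rightarrow> complex ^ 'b ^ 'b \<Rightarrow> complex ^ ('a \<times> 'b) ^ ('a \<times> 'b)" where
  "kron A B = (\<chi> p q. A $ fst p $ fst q * B $ snd p $ snd q)"

definition mscale :: "complex \<Rightarrow> complex ^ 'n ^ 'm \<Rightarrow> complex ^ 'n ^ 'm" where
  "mscale c A = (\<chi> i j. c * A $ i $ j)"

definition vconj :: "complex ^ 'n \<Rightarrow> complex ^ 'n" where
  "vconj v = (\<chi> i. cnj (v $ i))"

definition op_norm :: "complex ^ 'n ^ 'n \<Rightarrow> real" where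
  "op_norm A = onorm (\<lambda>v. A *v v)"

definition trace_norm :: "complex ^ 'n ^ 'n \<Rightarrow> real" where
  "trace_norm A = Re (trace (THE B. psd B \<and> B ** B = cadj A ** A))"

text \<open>Haar (unitarily invariant) probability measure on pure states, realised as the uniform
  distribution on the unit sphere: push-forward of the uniform distribution on the unit ball
  under v \<mapsto> v / \<parallel>v\<parallel>.\<close>
definition haar_state :: "(complex ^ 'n) measure" where
  "haar_state = distr (uniform_measure lborel (ball 0 1)) borel sgn"

definition tpow3 :: "complex ^ 'n \<Rightarrow> complex ^ ('n \<times> 'n \<times> 'n) ^ ('n \<times> 'n \<times> 'n)" where
  "tpow3 \<phi> = kron (outer \<phi> \<phi>) (kron (outer \<phi> \<phi>) (outer \<phi> \<phi>))"

definition approx_state_3design :: "real \<Rightarrow> (complex ^ 'n) measure \<Rightarrow> bool" where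
  "approx_state_3design \<epsilon> S \<longleftrightarrow>
     trace_norm ((\<integral>\<phi>. tpow3 \<phi> \<partial>haar_state) - (\<integral>\<phi>. tpow3 \<phi> \<partial>S)) \<le> \<epsilon>"

definition bxor :: "('q \<Rightarrow> bool) \<Rightarrow> ('q \<Rightarrow> bool) \<Rightarrow> ('q \<Rightarrow> bool)" where
  "bxor a b = (\<lambda>i. a i \<noteq> b i)"

definition bdot :: "('q \<Rightarrow> bool) \<Rightarrow> ('q \<Rightarrow> bool) \<Rightarrow> nat" where
  "bdot a b = card {i. a i \<and> b i}"

text \<open>n CNOTs, qubit i of R1 controlling qubit i of R2: |a,b> \<mapsto> |a, a xor b>.\<close>
definition cnot_layer :: "complex ^ (('q::finite \<Rightarrow> bool) \<times> ('q \<Rightarrow> bool)) ^ (('q \<Rightarrow> bool) \<times> ('q \<Rightarrow> bool))" where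
  "cnot_layer = (\<chi> p q. if fst p = fst q \<and> snd p = bxor (fst q) (snd q) then 1 else 0)"

definition hadamard_n :: "complex ^ ('q::finite \<Rightarrow> bool) ^ ('q \<Rightarrow> bool)" where
  "hadamard_n = (\<chi> z a. (-1) ^ bdot z a / complex_of_real (sqrt (2 ^ CARD('q))))"

definition pauli_X :: "('q::finite \<Rightarrow> bool) \<Rightarrow> complex ^ ('q \<Rightarrow> bool) ^ ('q \<Rightarrow> bool)" where
  "pauli_X x = (\<chi> b c. if c = bxor b x then 1 else 0)"

definition pauli_Z :: "('q::finite \<Rightarrow> bool) \<Rightarrow> complex ^ ('q \<Rightarrow> bool) ^ ('q \<Rightarrow> bool)" where
  "pauli_Z z = (\<chi> b c. if b = c then (-1) ^ bdot z b else 0)"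

definition shadow_circuit :: "complex ^ (('q::finite \<Rightarrow> bool) \<times> ('q \<Rightarrow> bool)) ^ (('q \<Rightarrow> bool) \<times> ('q \<Rightarrow> bool))" where
  "shadow_circuit = kron hadamard_n (mat 1) ** cnot_layer"

definition born_prob :: "complex ^ ('q::finite \<Rightarrow> bool) ^ ('q \<Rightarrow> bool) \<Rightarrow> complex ^ ('q \<Rightarrow> bool)
    \<Rightarrow> ('q \<Rightarrow> bool) \<Rightarrow> ('q \<Rightarrow> bool) \<Rightarrow> real" where
  "born_prob \<rho> \<zeta> z x =
     Re ((shadow_circuit ** kron \<rho> (outer \<zeta> \<zeta>) ** cadj shadow_circuit) $ (z, x) $ (z, x))"

definition zeta_xz :: "complex ^ ('q::finite \<Rightarrow> bool) \<Rightarrow> ('q \<Rightarrow> bool) \<Rightarrow> ('q \<Rightarrow> bool) \<Rightarrow> complex ^ ('q \<Rightarrow> bool)" where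
  "zeta_xz \<zeta> x z = pauli_X x *v (pauli_Z z *v \<zeta>)"

definition classical_shadow :: "complex ^ ('q::finite \<Rightarrow> bool) \<Rightarrow> ('q \<Rightarrow> bool) \<Rightarrow> ('q \<Rightarrow> bool)
    \<Rightarrow> complex ^ ('q \<Rightarrow> bool) ^ ('q \<Rightarrow> bool)" where
  "classical_shadow \<zeta> x z =
     mscale (of_nat (2 ^ CARD('q) + 1)) (outer (vconj (zeta_xz \<zeta> x z)) (vconj (zeta_xz \<zeta> x z))) - mat 1"

text \<open>The single-shadow estimate Tr(Obs \<rho>hat) (real for Hermitian Obs).\<close>
definition shadow_estimate :: "complex ^ ('q::finite \<Rightarrow> bool) ^ ('q \<Rightarrow> bool) \<Rightarrow> complex ^ ('q \<Rightarrow> bool)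
    \<Rightarrow> ('q \<Rightarrow> bool) \<Rightarrow> ('q \<Rightarrow> bool) \<Rightarrow> real" where
  "shadow_estimate Obs \<zeta> x z = Re (trace (Obs ** classical_shadow \<zeta> x z))"

definition estimate_distr :: "complex ^ ('q::finite \<Rightarrow> bool) ^ ('q \<Rightarrow> bool) \<Rightarrow> complex ^ ('q \<Rightarrow> bool) ^ ('q \<Rightarrow> bool)
    \<Rightarrow> (complex ^ ('q \<Rightarrow> bool)) measure \<Rightarrow> real measure" where
  "estimate_distr Obs \<rho> S =
     S \<bind> (\<lambda>\<zeta>. distr (density (count_space UNIV) (\<lambda>(z, x). ennreal (born_prob \<rho> \<zeta> z x)))
                     borel (\<lambda>(z, x). shadow_estimate Obs \<zeta> x z))"

definition median :: "real list \<Rightarrow> real" where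
  "median xs = (let s = sort xs; k = length xs in
     if odd k then s ! (k div 2) else (s ! (k div 2 - 1) + s ! (k div 2)) / 2)"

definition median_of_means :: "nat \<Rightarrow> nat \<Rightarrow> (nat \<times> nat \<Rightarrow> real) \<Rightarrow> real" where
  "median_of_means L K \<omega> = median (map (\<lambda>k. (\<Sum>l<L. \<omega> (k, l)) / real L) [0..<K])"

definition traceless_part :: "complex ^ 'n ^ 'n \<Rightarrow> complex ^ 'n ^ 'n" where
  "traceless_part Obs = Obs - mscale (trace Obs / of_nat CARD('n)) (mat 1)"

end

theory Submission
  imports Defs "HOL-Library.Numeral_Type" "HOL-Combinatorics.Transposition"
begin

text \<open>
  Measuring yields \<open>(z, x)\<close> with probability \<open>\<langle>w|\<rho>|w\<rangle> / d\<close>, where \<open>d = 2\<^sup>n\<close> and \<open>w\<close> is the conjugate of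
  \<open>\<zeta>\<^bsub>x,z\<^esub>\<close>, and the estimate is \<open>(d + 1) \<langle>w|O|w\<rangle> - Tr O\<close>. For Haar random \<open>\<zeta>\<close> its mean is \<open>Tr (O \<rho>)\<close> and its variance
  at most \<open>3 Tr (O\<^sub>0\<^sup>2)\<close>, by the second and third moments of the Haar measure.
  For a design the moments \<open>E[f]\<close> and \<open>E[f\<^sup>2]\<close> of \<open>f = (d + 1) \<langle>w|O|w\<rangle>\<close> move by at most \<open>\<epsilon> (d + 1) \<parallel>O\<parallel>\<close> and
  \<open>\<epsilon> (d + 1)\<^sup>2 \<parallel>O\<parallel>\<^sup>2\<close>: both are expectations of \<open>Tr (\<zeta>\<^sup>\<otimes>\<^sup>3 M)\<close>, the trace norm is dual to the operator norm, and
  the Pauli twirl \<open>\<Sum> P\<^sup>* \<rho>\<^sup>T P = d I\<close> bounds \<open>M\<close>. Since \<open>|E[f]| \<le> (d + 1) \<parallel>O\<parallel>\<close> in the Haar case, the variance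
  \<open>E[f\<^sup>2] - E[f]\<^sup>2\<close> grows by at most \<open>3 \<epsilon> (d + 1)\<^sup>2 \<parallel>O\<parallel>\<^sup>2\<close>. By Chebyshev each of the \<open>K\<close> means then misses its
  expectation by more than \<open>\<gamma>\<close> with probability at most \<open>1/34\<close>, and the median misses it only if half of them do,
  which has probability at most \<open>2\<^sup>K 34\<^bsup>-K/2\<^esup> \<le> \<delta>\<close>.
\<close>

section \<open>Spectral theorem\<close>

text \<open>The trace norm is defined by a definite description, so already its duality bound rests
  on the spectral theorem: existence and uniqueness of the positive square root both come from
  diagonalisation. The Haar measure is a uniform measure on a ball pushed to the sphere, hence
  invariant under all real-orthogonal maps and not only under unitaries. This matters because the
  passage from \<open>\<zeta>\<close> to the vector \<open>w\<close> is antilinear. The moments then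
  follow from symmetry alone: sign and phase changes, transpositions of coordinates and one Hadamard
  rotation, with \<open>norm w = 1\<close> fixing the normalisation. The Pauli twirl is what saves a
  power of \<open>d\<close>: estimating the \<open>d^2\<close> outcomes one by one can cost
  \<open>d^2\<close>, whereas the twirl leaves a single \<open>d\<close>, which cancels against the
  \<open>1/d\<close> of the outcome probability. The constant 34 leaves room: the union over sets of
  failing means only asks for \<open>2 / sqrt 34 <= exp (-1/2)\<close>. A last obstacle is
  measure-theoretic: the outcome kernel has total mass \<open>norm \<zeta> ^ 2\<close>, so it is a
  probability measure only on the sphere, while the monadic bind is formed over all vectors.\<close>

lemma vinner_add_left: "vinner (u + v) w = vinner u w + vinner v w"
  by (simp add: vinner_def algebra_simps sum.distrib)

lemma vinner_add_right: "vinner u (v + w) = vinner u v + vinner u w"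
  by (simp add: vinner_def algebra_simps sum.distrib)

lemma vinner_diff_left: "vinner (u - v) w = vinner u w - vinner v w"
  by (simp add: vinner_def algebra_simps sum_subtractf)

lemma vinner_diff_right: "vinner u (v - w) = vinner u v - vinner u w"
  by (simp add: vinner_def algebra_simps sum_subtractf)

lemma vinner_scale_left: "vinner (c *s u) v = cnj c * vinner u v"
  by (simp add: vinner_def sum_distrib_left algebra_simps)

lemma vinner_scale_right: "vinner u (c *s v) = c * vinner u v"
  by (simp add: vinner_def sum_distrib_left algebra_simps)

lemma vinner_zero [simp]: "vinner 0 v = 0" "vinner v 0 = 0"
  by (simp_all add: vinner_def)

lemma vinner_sum_right: "vinner v (\<Sum>i\<in>I. f i) = (\<Sum>i\<in>I. vinner v (f i))"
  by (induction I rule: infinite_finite_induct) (auto simp: vinner_add_right)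

lemmas vinner_simps = vinner_add_left vinner_add_right vinner_diff_left vinner_diff_right
  vinner_scale_left vinner_scale_right

lemma cnj_vinner: "cnj (vinner u v) = vinner v u"
  by (simp add: vinner_def mult.commute)

lemma vinner_self: "vinner v v = complex_of_real ((norm v)\<^sup>2)"
proof -
  have "(norm v)\<^sup>2 = (\<Sum>i\<in>UNIV. (norm (v $ i))\<^sup>2)"
    by (simp add: norm_vec_def L2_set_def sum_nonneg)
  then show ?thesis
    by (simp add: vinner_def complex_norm_square mult.commute flip: of_real_power)
qed

lemma Re_vinner: "Re (vinner u v) = u \<bullet> v"
  by (simp add: vinner_def inner_vec_def inner_complex_def)

lemma norm_cscale: "norm (c *s v) = cmod c * norm (v :: complex^'n)"
proof -
  have "complex_of_real ((norm (c *s v))\<^sup>2) = complex_of_real ((cmod c * norm v)\<^sup>2)"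
    unfolding vinner_self[symmetric] vinner_scale_left vinner_scale_right
    by (simp add: vinner_self power_mult_distrib complex_norm_square flip: of_real_power)
  then have "(norm (c *s v))\<^sup>2 = (cmod c * norm v)\<^sup>2" by (simp only: of_real_eq_iff)
  then show ?thesis by (rule power2_eq_imp_eq) auto
qed

lemma vinner_Cauchy_Schwarz: "cmod (vinner u v) \<le> norm u * norm v"
proof (cases "vinner u v = 0")
  case False
  \<comment> \<open>A phase that turns \<open>vinner u v\<close> into its modulus, so that the real
    Cauchy-Schwarz inequality applies to \<open>u\<close> and \<open>c *s v\<close>.\<close>
  define c where "c = vinner v u / cmod (vinner u v)"
  have "cmod c = 1" using False cnj_vinner[of u v] 
    by (simp add: c_def norm_divide) (metis complex_mod_cnj)
  have "c * vinner u v = cmod (vinner u v)"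
    using False unfolding c_def cnj_vinner[of u v, symmetric]
    by (simp add: field_simps complex_norm_square[symmetric] power2_eq_square)
  then have "cmod (vinner u v) = Re (vinner u (c *s v))"
    by (simp add: vinner_scale_right)
  also have "\<dots> \<le> norm u * norm (c *s v)"
    unfolding Re_vinner by (rule norm_cauchy_schwarz)
  finally show ?thesis using \<open>cmod c = 1\<close> by (simp add: norm_cscale)
qed simp

lemma vinner_cadj: "vinner u (A *v v) = vinner (cadj A *v u) v"
proof -
  have "vinner u (A *v v) = (\<Sum>i\<in>UNIV. \<Sum>j\<in>UNIV. cnj (u $ i) * A $ i $ j * v $ j)"
    by (simp add: vinner_def matrix_vector_mult_def sum_distrib_left mult.assoc)
  also have "\<dots> = (\<Sum>j\<in>UNIV. \<Sum>i\<in>UNIV. cnj (u $ i) * A $ i $ j * v $ j)"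
    by (rule sum.swap)
  also have "\<dots> = vinner (cadj A *v u) v"
    by (simp add: vinner_def matrix_vector_mult_def cadj_def sum_distrib_right sum_distrib_left mult.commute mult.left_commute)
  finally show ?thesis .
qed

lemma hermitian_vinner: "hermitian A \<Longrightarrow> vinner u (A *v v) = vinner (A *v u) v"
  by (simp add: vinner_cadj hermitian_def)

lemma hermitian_Reals:
  assumes "hermitian A"
  shows "vinner v (A *v v) = complex_of_real (Re (vinner v (A *v v)))"
  using hermitian_vinner[OF assms, of v v] cnj_vinner[of v "A *v v"]
  by (metis Reals_cnj_iff of_real_Re)

lemma matrix_vector_cscale: "(A :: complex^'n^'m) *v (c *s v) = c *s (A *v v)"
  by (simp add: vec_eq_iff matrix_vector_mult_def sum_distrib_left mult.left_commute)

lemma matrix_vector_sum: "A *v (\<Sum>i\<in>I. f i) = (\<Sum>i\<in>I. A *v (f i :: complex^'n))"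
  by (induction I rule: infinite_finite_induct) (auto simp: matrix_vector_right_distrib)

lemma sum_matrix_vector: "(\<Sum>i\<in>I. A i) *v v = (\<Sum>i\<in>I. A i *v (v :: complex^'n))"
  by (induction I rule: infinite_finite_induct) (auto simp: matrix_vector_mult_add_rdistrib)

lemma continuous_on_matrix_vector [continuous_intros]:
  "continuous_on S f \<Longrightarrow> continuous_on S (\<lambda>x. (A :: complex^'n^'m) *v f x)"
  by (rule bounded_linear.continuous_on[OF matrix_vector_mul_bounded_linear])

lemma continuous_on_vinner [continuous_intros]:
  "continuous_on S f \<Longrightarrow> continuous_on S g \<Longrightarrow> continuous_on S (\<lambda>x. vinner (f x) (g x))"
  unfolding vinner_def by (intro continuous_intros)

lemma of_real_cscale: "complex_of_real r *s v = r *\<^sub>R v"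
  by (simp add: vec_eq_iff scaleR_conv_of_real[where 'a=complex])

text \<open>Rayleigh quotient: maximise the quadratic form of \<open>A\<close> on the unit sphere of
  the complement \<open>W\<close>. Since the elements of \<open>E\<close> are eigenvectors,
  \<open>A\<close> maps \<open>W\<close> to itself, so the residual \<open>u\<close> at a maximiser
  lies in \<open>W\<close>. A step from \<open>v\<close> against \<open>u\<close> would raise the
  quotient to first order unless \<open>u = 0\<close>.\<close>

lemma hermitian_eigenvector_in_complement:
  fixes A :: "complex^'n^'n"
  assumes A: "hermitian A" and E: "\<And>e. e \<in> E \<Longrightarrow> \<exists>c. A *v e = c *s e"
    and v0: "\<And>e. e \<in> E \<Longrightarrow> vinner e v0 = 0" "v0 \<noteq> 0"
  obtains v c where "\<And>e. e \<in> E \<Longrightarrow> vinner e v = 0" "norm v = 1" "A *v v = complex_of_real c *s v"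
proof -
  define W where "W = {v. \<forall>e\<in>E. vinner e v = 0}"
  define q where "q v = Re (vinner v (A *v v))" for v
  have "W = (\<Inter>e\<in>E. {v. vinner e v = 0})" by (auto simp: W_def)
  then have "closed W"
    by (auto intro!: closed_INT closed_Collect_eq continuous_intros)
  then have "compact (sphere 0 1 \<inter> W)"
    by (intro compact_Int_closed) auto
  moreover have "(1 / norm v0) *\<^sub>R v0 \<in> sphere 0 1 \<inter> W"
    using v0 by (auto simp: W_def of_real_cscale[symmetric] vinner_scale_right norm_cscale norm_divide)
  moreover have "continuous_on (sphere 0 1 \<inter> W) q"
    unfolding q_def by (intro continuous_intros)
  ultimately obtain v where v: "norm v = 1" "v \<in> W" and max: "\<And>w. norm w = 1 \<Longrightarrow> w \<in> W \<Longrightarrow> q w \<le> q v"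
    using continuous_attains_sup[of "sphere 0 1 \<inter> W" q] by force
  define M where "M = q v"
  have bound: "q w \<le> M * (norm w)\<^sup>2" if "w \<in> W" for w
  proof (cases "w = 0")
    case False
    have "q (complex_of_real (1 / norm w) *s w) \<le> M"
      unfolding M_def using that False
      by (intro max) (auto simp: W_def vinner_scale_right norm_cscale norm_divide)
    also have "q (complex_of_real (1 / norm w) *s w) = q w / (norm w)\<^sup>2"
      by (simp add: q_def matrix_vector_cscale vinner_scale_left vinner_scale_right power2_eq_square
          flip: of_real_divide)
    finally show ?thesis using False by (simp add: field_simps)
  qed (simp add: q_def)
  define u where "u = complex_of_real M *s v - A *v v"
  have "u \<in> W"
  proof -
    have "vinner e (A *v v) = 0" if e: "e \<in> E" for e
    proof -
      obtain c where "A *v e = c *s e" using E[OF e] by blast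
      then show ?thesis using v e by (simp add: hermitian_vinner[OF A] vinner_scale_left W_def)
    qed
    then show ?thesis using v by (simp add: W_def u_def vinner_simps)
  qed
  have "u = 0"
  proof (rule ccontr)
    assume "u \<noteq> 0"
    define d where "d = M * (norm u)\<^sup>2 - q u"
    have key: "2 * (norm u)\<^sup>2 \<le> t * d" if "t > 0" for t :: real
    proof -
      define w where "w = v - complex_of_real t *s u"
      have "w \<in> W" using v \<open>u \<in> W\<close> by (simp add: w_def W_def vinner_simps)
      have "(norm w)\<^sup>2 = Re (vinner w w)" by (simp add: vinner_self)
      also have "\<dots> = (norm v)\<^sup>2 - t * Re (vinner v u) - t * Re (vinner u v) + t\<^sup>2 * (norm u)\<^sup>2"
        unfolding w_def vinner_simps by (simp add: vinner_self power2_eq_square algebra_simps)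
      also have "Re (vinner v u) = Re (vinner u v)"
        using arg_cong[OF cnj_vinner[of u v], of Re] by simp
      finally have 1: "(norm w)\<^sup>2 = 1 - 2 * t * Re (vinner u v) + t\<^sup>2 * (norm u)\<^sup>2"
        using v by simp
      have "q w = q v - t * Re (vinner v (A *v u)) - t * Re (vinner u (A *v v)) + t\<^sup>2 * q u"
        unfolding w_def q_def
        by (simp add: vinner_simps matrix_vector_mult_diff_distrib matrix_vector_cscale power2_eq_square algebra_simps)
      also have "Re (vinner v (A *v u)) = Re (vinner u (A *v v))"
        using arg_cong[OF cnj_vinner[of u "A *v v"], of Re] by (simp add: hermitian_vinner[OF A])
      finally have 2: "q w = M - 2 * t * Re (vinner u (A *v v)) + t\<^sup>2 * q u"
        by (simp add: M_def)
      have 3: "(norm u)\<^sup>2 = M * Re (vinner u v) - Re (vinner u (A *v v))"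
      proof -
        have "(norm u)\<^sup>2 = Re (vinner u u)" by (simp add: vinner_self)
        also have "vinner u u = vinner u (complex_of_real M *s v - A *v v)" by (simp add: u_def)
        finally show ?thesis by (simp add: vinner_simps)
      qed
      have "0 \<le> M * (norm w)\<^sup>2 - q w" using bound[OF \<open>w \<in> W\<close>] by simp
      also have "\<dots> = t\<^sup>2 * d - 2 * t * (norm u)\<^sup>2"
        unfolding 1 2 d_def 3 by (simp add: algebra_simps)
      finally have "t * (2 * (norm u)\<^sup>2) \<le> t * (t * d)" by (simp add: power2_eq_square algebra_simps)
      then show ?thesis using that by simp
    qed
    have "d > 0" using key[of 1] \<open>u \<noteq> 0\<close> by (smt (verit) zero_less_norm_iff zero_less_power)
    \<comment> \<open>This step size makes the right side of \<open>key\<close> equal to the square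
      of \<open>norm u\<close>, half of the left side.\<close>
    then show False using key[of "(norm u)\<^sup>2 / d"] \<open>u \<noteq> 0\<close> by simp
  qed
  then have "A *v v = complex_of_real M *s v" by (simp add: u_def)
  then show ?thesis using that[of v M] v by (auto simp: W_def)
qed

text \<open>Indexing by the coordinate type itself lets all later sums over the basis run over
  \<open>UNIV\<close>. The price is that a basis found as a set has to be counted once.\<close>

definition orthonormal_basis :: "('n \<Rightarrow> complex^'n) \<Rightarrow> bool" where
  "orthonormal_basis e \<longleftrightarrow> (\<forall>i j. vinner (e i) (e j) = (if i = j then 1 else 0)) \<and>
     (\<forall>v. (\<Sum>i\<in>UNIV. vinner (e i) v *s e i) = v)"

text \<open>An orthonormal set of eigenvectors of largest size has trivial complement, since
  otherwise it could be extended. The real dimension, twice the complex one, is used only to bound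
  the size so that a largest set exists.\<close>

theorem hermitian_diagonalizable:
  fixes A :: "complex^'n^'n"
  assumes A: "hermitian A"
  obtains e l where "orthonormal_basis e" "\<And>i. A *v e i = complex_of_real (l i) *s e i"
proof -
  define P where "P E \<longleftrightarrow> finite E \<and> (\<forall>e\<in>E. norm e = 1 \<and> (\<exists>c::real. A *v e = complex_of_real c *s e)) \<and>
     (\<forall>e\<in>E. \<forall>f\<in>E. e \<noteq> f \<longrightarrow> vinner e f = 0)" for E
  have "card E \<le> DIM(complex^'n)" if "P E" for E
  proof -
    have "pairwise orthogonal E"
      using that by (auto simp: P_def pairwise_def orthogonal_def Re_vinner[symmetric])
    moreover have "0 \<notin> E" using that by (auto simp: P_def)
    ultimately show ?thesis using pairwise_orthogonal_independent independent_bound by blast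
  qed
  then have "\<forall>E. P E \<longrightarrow> card E < Suc DIM(complex^'n)" by (simp add: less_Suc_eq_le)
  moreover have "P {}" by (simp add: P_def)
  ultimately have "\<exists>E. P E \<and> (\<forall>F. P F \<longrightarrow> card F \<le> card E)"
    by (intro ex_has_greatest_nat[where b="Suc DIM(complex^'n)"])
  then obtain E where "P E" and E_max: "\<And>F. P F \<Longrightarrow> card F \<le> card E"
    by auto
  have fin: "finite E" using \<open>P E\<close> by (simp add: P_def)
  have ortho: "vinner e f = (if e = f then 1 else 0)" if "e \<in> E" "f \<in> E" for e f
    using \<open>P E\<close> that by (auto simp: P_def vinner_self)
  have complement: "v = 0" if v: "\<And>e. e \<in> E \<Longrightarrow> vinner e v = 0" for v
  proof (rule ccontr)
    assume "v \<noteq> 0"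
    have "\<exists>c. A *v e = c *s e" if "e \<in> E" for e using \<open>P E\<close> that by (auto simp: P_def)
    then obtain w c where w: "\<And>e. e \<in> E \<Longrightarrow> vinner e w = 0" "norm w = 1" "A *v w = complex_of_real c *s w"
      using hermitian_eigenvector_in_complement[OF A _ v \<open>v \<noteq> 0\<close>] by blast
    have "w \<notin> E" using w(1)[of w] w(2) by (auto simp: vinner_self)
    have "vinner w e = 0" if "e \<in> E" for e using w(1)[OF that] cnj_vinner[of e w] by simp
    then have "P (insert w E)" using \<open>P E\<close> w by (auto simp: P_def)
    then have "card (insert w E) \<le> card E" by (rule E_max)
    then show False using \<open>w \<notin> E\<close> fin by simp
  qed
  have expand: "(\<Sum>e\<in>E. vinner e v *s e) = v" for v
  proof -
    have "vinner f (v - (\<Sum>e\<in>E. vinner e v *s e)) = 0" if "f \<in> E" for f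
      using that fin
      by (simp add: vinner_diff_right vinner_sum_right vinner_scale_right ortho if_distrib cong: if_cong)
    then have "v - (\<Sum>e\<in>E. vinner e v *s e) = 0" by (rule complement)
    then show ?thesis by simp
  qed
  \<comment> \<open>The trace of the identity, computed once as the sum of the rank-one projections
    of \<open>E\<close> and once in coordinates, gives the exact size.\<close>
  have "of_nat (card E) = (\<Sum>e\<in>E. vinner e e)"
    by (simp add: ortho)
  also have "\<dots> = (\<Sum>i\<in>UNIV. (\<Sum>e\<in>E. vinner e (axis i 1) *s e) $ i)"
    unfolding vinner_def by (subst sum.swap) (simp add: axis_def if_distrib cong: if_cong)
  also have "\<dots> = of_nat CARD('n)"
    by (simp add: expand)
  finally have "card E = card (UNIV :: 'n set)" using of_nat_eq_iff by blast
  then obtain b where b: "bij_betw b (UNIV :: 'n set) E"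
    using finite_same_card_bij[OF _ fin, of "UNIV :: 'n set"] by auto
  have bE: "b i \<in> E" for i using b by (auto simp: bij_betw_def)
  have "orthonormal_basis b"
    unfolding orthonormal_basis_def
    using sum.reindex_bij_betw[OF b, of "\<lambda>e. vinner e v *s e" for v] expand ortho bE b
    by (auto simp: bij_betw_def inj_eq)
  moreover have "\<forall>i. \<exists>c::real. A *v b i = complex_of_real c *s b i"
    using bE \<open>P E\<close> by (auto simp: P_def)
  then obtain l where "\<And>i. A *v b i = complex_of_real (l i) *s b i" by metis
  ultimately show ?thesis using that by blast
qed

section \<open>Trace norm duality and Kronecker products\<close>

lemma onb_inner: "orthonormal_basis e \<Longrightarrow> vinner (e i) (e j) = (if i = j then 1 else 0)"
  by (simp add: orthonormal_basis_def)

lemma onb_norm: "orthonormal_basis e \<Longrightarrow> norm (e i) = 1"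
  using onb_inner[of e i i] norm_ge_zero[of "e i"] by (simp add: vinner_self power2_eq_1_iff flip: of_real_power)

lemma onb_expand: "orthonormal_basis e \<Longrightarrow> (\<Sum>i\<in>UNIV. vinner (e i) v *s e i) = v"
  by (simp add: orthonormal_basis_def)

lemma onb_parseval:
  assumes "orthonormal_basis e"
  shows "vinner u v = (\<Sum>i\<in>UNIV. vinner u (e i) * vinner (e i) v)"
proof -
  have "vinner u v = vinner u (\<Sum>i\<in>UNIV. vinner (e i) v *s e i)"
    by (simp only: onb_expand[OF assms])
  then show ?thesis by (simp add: vinner_sum_right vinner_scale_right mult.commute)
qed

lemma onb_norm_square:
  assumes "orthonormal_basis e"
  shows "(norm v)\<^sup>2 = (\<Sum>i\<in>UNIV. (cmod (vinner (e i) v))\<^sup>2)"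
proof -
  have "complex_of_real ((norm v)\<^sup>2) = (\<Sum>i\<in>UNIV. vinner v (e i) * vinner (e i) v)"
    by (simp only: vinner_self[symmetric] onb_parseval[OF assms, of v v])
  also have "\<dots> = (\<Sum>i\<in>UNIV. complex_of_real ((cmod (vinner (e i) v))\<^sup>2))"
    by (intro sum.cong refl) (metis cnj_vinner complex_norm_square mult.commute)
  finally show ?thesis by (simp only: of_real_sum[symmetric] of_real_eq_iff)
qed

lemma onb_matrix_eqI:
  fixes A B :: "complex^'n^'m"
  assumes "orthonormal_basis e" "\<And>i. A *v e i = B *v e i"
  shows "A = B"
  unfolding matrix_eq
proof
  fix v
  have "A *v (\<Sum>i\<in>UNIV. vinner (e i) v *s e i) = B *v (\<Sum>i\<in>UNIV. vinner (e i) v *s e i)"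
    by (simp add: matrix_vector_sum matrix_vector_cscale assms(2))
  then show "A *v v = B *v v" by (simp only: onb_expand[OF assms(1)])
qed

lemma vinner_axis: "vinner (axis i 1) v = v $ i" "vinner v (axis i 1) = cnj (v $ i)"
proof -
  show "vinner (axis i 1) v = v $ i"
    by (simp add: vinner_def axis_def if_distrib if_distribR cong: if_cong)
  then show "vinner v (axis i 1) = cnj (v $ i)" by (metis cnj_vinner)
qed

lemma onb_trace:
  assumes e: "orthonormal_basis e"
  shows "trace M = (\<Sum>i\<in>UNIV. vinner (e i) (M *v e i))"
proof -
  have "trace M = (\<Sum>k\<in>UNIV. vinner (axis k 1) (M *v axis k 1))"
    unfolding trace_def vinner_axis by (simp add: matrix_vector_mult_def axis_def if_distrib cong: if_cong)
  also have "\<dots> = (\<Sum>k\<in>UNIV. \<Sum>i\<in>UNIV. vinner (e i) (axis k 1) * vinner (axis k 1) (M *v e i))"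
  proof (intro sum.cong refl)
    fix k :: 'a
    have "vinner (axis k 1) (M *v axis k 1) = vinner (axis k 1) (M *v (\<Sum>i\<in>UNIV. vinner (e i) (axis k 1) *s e i))"
      by (simp only: onb_expand[OF e])
    then show "vinner (axis k 1) (M *v axis k 1) = (\<Sum>i\<in>UNIV. vinner (e i) (axis k 1) * vinner (axis k 1) (M *v e i))"
      by (simp add: matrix_vector_sum matrix_vector_cscale vinner_sum_right vinner_scale_right)
  qed
  also have "\<dots> = (\<Sum>i\<in>UNIV. \<Sum>k\<in>UNIV. vinner (e i) (axis k 1) * vinner (axis k 1) (M *v e i))"
    by (rule sum.swap)
  also have "\<dots> = (\<Sum>i\<in>UNIV. vinner (e i) (M *v e i))"
    unfolding vinner_axis by (simp add: vinner_def)
  finally show ?thesis .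
qed

lemma outer_mult_vector: "outer u v *v w = vinner v w *s u"
  by (simp add: vec_eq_iff outer_def vinner_def matrix_vector_mult_def sum_distrib_right sum_distrib_left mult.assoc mult.commute mult.left_commute)

lemma mscale_mult_vector: "mscale c A *v v = c *s (A *v v)"
  by (simp add: vec_eq_iff mscale_def matrix_vector_mult_def sum_distrib_left mult.assoc)

text \<open>Functional calculus in the basis \<open>e\<close>: eigenvalues replaced by their square
  roots give the positive root, replaced by their absolute values they give the modulus of a
  matrix.\<close>

definition spectral_matrix :: "('n \<Rightarrow> complex^'n) \<Rightarrow> ('n \<Rightarrow> real) \<Rightarrow> complex^'n^'n" where
  "spectral_matrix e f = (\<Sum>i\<in>UNIV. mscale (complex_of_real (f i)) (outer (e i) (e i)))"

lemma spectral_matrix_mult_vector: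
  "spectral_matrix e f *v v = (\<Sum>i\<in>UNIV. (complex_of_real (f i) * vinner (e i) v) *s e i)"
  by (simp add: spectral_matrix_def sum_matrix_vector mscale_mult_vector outer_mult_vector vector_smult_assoc)

lemma spectral_matrix_eigen:
  assumes "orthonormal_basis e"
  shows "spectral_matrix e f *v e i = complex_of_real (f i) *s e i"
  by (simp add: spectral_matrix_mult_vector onb_inner[OF assms] if_distrib if_distribR cong: if_cong)

lemma hermitian_spectral_matrix: "hermitian (spectral_matrix e f)"
  by (simp add: hermitian_def cadj_def spectral_matrix_def mscale_def outer_def vec_eq_iff mult.assoc mult.commute)

lemma psd_spectral_matrix:
  assumes "\<And>i. f i \<ge> 0"
  shows "psd (spectral_matrix e f)"
proof -
  have "vinner v (spectral_matrix e f *v v) = complex_of_real (\<Sum>i\<in>UNIV. f i * (cmod (vinner (e i) v))\<^sup>2)" for v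
    unfolding spectral_matrix_mult_vector vinner_sum_right vinner_scale_right of_real_sum of_real_mult
    by (intro sum.cong refl) (metis cnj_vinner complex_norm_square mult.commute mult.left_commute)
  then show ?thesis
    using assms by (auto simp: psd_def hermitian_spectral_matrix intro!: sum_nonneg)
qed

text \<open>Let \<open>v\<close> be a unit eigenvector of \<open>B - C\<close> with eigenvalue
  \<open>l\<close>. The equality of the squares gives \<open>l\<close> times the sum of the forms of
  \<open>B\<close> and \<open>C\<close> at \<open>v\<close> equal to 0. If \<open>l\<close> were
  nonzero, both nonnegative forms would vanish, yet their difference is \<open>l\<close>.\<close>

lemma psd_sqrt_unique:
  assumes B: "psd B" and C: "psd C" and eq: "B ** B = C ** C"
  shows "B = C"
proof -
  have hB: "hermitian B" and hC: "hermitian C" using B C by (auto simp: psd_def)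
  then have "hermitian (B - C)" by (simp add: hermitian_def cadj_def vec_eq_iff)
  then obtain e l where e: "orthonormal_basis e" and l: "\<And>i. (B - C) *v e i = complex_of_real (l i) *s e i"
    using hermitian_diagonalizable by blast
  have "l i = 0" for i
  proof (rule ccontr)
    assume "l i \<noteq> 0"
    define v where "v = e i"
    have v: "B *v v - C *v v = complex_of_real (l i) *s v" 
      using l[of i] by (simp add: v_def matrix_vector_mult_diff_rdistrib)
    have "complex_of_real (l i) * (vinner v (B *v v) + vinner v (C *v v))
      = vinner (B *v v) (B *v v - C *v v) + vinner (B *v v - C *v v) (C *v v)"
      using hB by (simp add: v vinner_simps hermitian_vinner algebra_simps)
    also have "\<dots> = vinner v (B *v (B *v v)) - vinner v (C *v (C *v v))"
      using hB hC by (simp add: vinner_simps hermitian_vinner)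
    also have "\<dots> = 0" by (simp add: matrix_vector_mul_assoc eq)
    finally have "vinner v (B *v v) + vinner v (C *v v) = 0" using \<open>l i \<noteq> 0\<close> by simp
    then have "Re (vinner v (B *v v)) + Re (vinner v (C *v v)) = 0" by (metis plus_complex.sel(1) zero_complex.sel(1))
    then have "Re (vinner v (B *v v)) = 0" "Re (vinner v (C *v v)) = 0"
      using B C unfolding psd_def by (smt (verit))+
    moreover have "Re (vinner v (B *v v)) - Re (vinner v (C *v v)) = l i"
      using arg_cong[OF v, of "\<lambda>x. Re (vinner v x)"] onb_inner[OF e, of i i] by (simp add: vinner_simps v_def)
    ultimately show False using \<open>l i \<noteq> 0\<close> by simp
  qed
  then have "(B - C) *v e i = 0 *v e i" for i using l[of i] by simp
  then have "B - C = 0" by (rule onb_matrix_eqI[OF e])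
  then show ?thesis by simp
qed

lemma psd_sqrt_exists:
  assumes "psd R"
  obtains Q where "psd Q" "Q ** Q = R"
proof -
  obtain e l where e: "orthonormal_basis e" and l: "\<And>i. R *v e i = complex_of_real (l i) *s e i"
    using hermitian_diagonalizable assms unfolding psd_def by blast
  have "l i \<ge> 0" for i
  proof -
    have "vinner (e i) (R *v e i) = complex_of_real (l i)" by (simp add: l vinner_scale_right onb_inner[OF e])
    then show ?thesis using assms unfolding psd_def by (metis Re_complex_of_real)
  qed
  define Q where "Q = spectral_matrix e (\<lambda>i. sqrt (l i))"
  have "psd Q" unfolding Q_def using \<open>\<And>i. l i \<ge> 0\<close> by (intro psd_spectral_matrix) simp
  moreover have "(Q ** Q) *v e i = R *v e i" for i
    using \<open>\<And>i. l i \<ge> 0\<close> 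
    by (simp add: Q_def l spectral_matrix_eigen[OF e] matrix_vector_cscale vector_smult_assoc flip: matrix_vector_mul_assoc of_real_mult)
  then have "Q ** Q = R" by (rule onb_matrix_eqI[OF e])
  ultimately show ?thesis using that by blast
qed

text \<open>The matrix with eigenvalues \<open>\<bar>l i\<bar>\<close> meets the description in
  \<open>trace_norm\<close>, and uniqueness of the positive root makes it the one described.\<close>

lemma trace_norm_eigen:
  assumes A: "hermitian A" and e: "orthonormal_basis e" and l: "\<And>i. A *v e i = complex_of_real (l i) *s e i"
  shows "trace_norm A = (\<Sum>i\<in>UNIV. \<bar>l i\<bar>)"
proof -
  define B where "B = spectral_matrix e (\<lambda>i. \<bar>l i\<bar>)"
  have B: "psd B" unfolding B_def by (intro psd_spectral_matrix) simp
  have "(B ** B) *v e i = (cadj A ** A) *v e i" for i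
    using A by (simp add: B_def l hermitian_def spectral_matrix_eigen[OF e] matrix_vector_cscale vector_smult_assoc
      flip: matrix_vector_mul_assoc of_real_mult)
  then have BB: "B ** B = cadj A ** A" by (rule onb_matrix_eqI[OF e])
  have "(THE B. psd B \<and> B ** B = cadj A ** A) = B"
    using B BB by (intro the_equality) (auto intro: psd_sqrt_unique)
  then show ?thesis
    by (simp add: trace_norm_def onb_trace[OF e] B_def spectral_matrix_eigen[OF e] vinner_scale_right onb_inner[OF e])
qed

text \<open>Evaluating the trace in an eigenbasis of \<open>A\<close> meets only the diagonal of
  \<open>M\<close>, so a bound on the quadratic form of \<open>M\<close> at unit vectors takes the
  place of its operator norm.\<close>

lemma trace_norm_duality:
  assumes A: "hermitian A" and c: "\<And>v. norm v = 1 \<Longrightarrow> cmod (vinner v (M *v v)) \<le> c"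
  shows "cmod (trace (A ** M)) \<le> trace_norm A * c"
proof -
  obtain e l where e: "orthonormal_basis e" and l: "\<And>i. A *v e i = complex_of_real (l i) *s e i"
    using hermitian_diagonalizable[OF A] by blast
  have "trace (A ** M) = (\<Sum>i\<in>UNIV. vinner (A *v e i) (M *v e i))"
    by (simp add: onb_trace[OF e] hermitian_vinner[OF A] flip: matrix_vector_mul_assoc)
  also have "\<dots> = (\<Sum>i\<in>UNIV. complex_of_real (l i) * vinner (e i) (M *v e i))"
    by (simp add: l vinner_scale_left)
  also have "cmod \<dots> \<le> (\<Sum>i\<in>UNIV. \<bar>l i\<bar> * c)"
    using c onb_norm[OF e] by (intro order.trans[OF norm_sum] sum_mono) (auto simp: norm_mult intro!: mult_left_mono)
  finally show ?thesis by (simp add: trace_norm_eigen[OF A e l] sum_distrib_right)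
qed

lemma norm_mult_vector_le_op_norm: "norm (A *v v) \<le> op_norm A * norm v"
  unfolding op_norm_def by (intro onorm matrix_vector_mul_bounded_linear)

lemma op_norm_nonneg: "0 \<le> op_norm A"
  unfolding op_norm_def by (intro onorm_pos_le matrix_vector_mul_bounded_linear)

section \<open>Kronecker products\<close>

lemma sum_prod_UNIV: "(\<Sum>p\<in>UNIV. f p) = (\<Sum>a\<in>UNIV. \<Sum>b\<in>UNIV. f (a, b))"
  by (simp add: sum.cartesian_product flip: UNIV_Times_UNIV)

lemma kron_mult: "kron A B ** kron C D = kron (A ** C) (B ** D)"
  by (simp add: kron_def matrix_matrix_mult_def vec_eq_iff sum_prod_UNIV sum_product mult.assoc mult.left_commute)

lemma cadj_kron: "cadj (kron A B) = kron (cadj A) (cadj B)"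
  by (simp add: cadj_def kron_def)

lemma cadj_mat_1 [simp]: "cadj (mat 1) = mat 1"
  by (simp add: cadj_def mat_def vec_eq_iff)

lemma trace_kron: "trace (kron A B) = trace A * trace B"
  by (simp add: trace_def kron_def sum_prod_UNIV sum_product)

lemma kron_mat_1: "kron (mat 1) (mat 1) = mat 1"
  by (auto simp: kron_def mat_def vec_eq_iff prod_eq_iff)

lemma kron_sum_left: "kron (\<Sum>i\<in>I. A i) B = (\<Sum>i\<in>I. kron (A i) B)"
  by (simp add: kron_def vec_eq_iff sum_distrib_right)

lemma norm_prod_square:
  fixes v :: "complex^('a::finite \<times> 'b::finite)"
  shows "(norm v)\<^sup>2 = (\<Sum>a\<in>UNIV. (norm (\<chi> b. v $ (a, b)))\<^sup>2)"
    and "(norm v)\<^sup>2 = (\<Sum>b\<in>UNIV. (norm (\<chi> a. v $ (a, b)))\<^sup>2)"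
proof -
  show "(norm v)\<^sup>2 = (\<Sum>a\<in>UNIV. (norm (\<chi> b. v $ (a, b)))\<^sup>2)"
    by (simp add: norm_vec_def L2_set_def sum_nonneg sum_prod_UNIV)
  show "(norm v)\<^sup>2 = (\<Sum>b\<in>UNIV. (norm (\<chi> a. v $ (a, b)))\<^sup>2)"
    by (simp add: norm_vec_def L2_set_def sum_nonneg sum_prod_UNIV sum.swap[of _ "UNIV::'a set"])
qed

text \<open>With the first index fixed, the product acts as \<open>Q\<close> on each slice of
  \<open>v\<close>, and squared norms add up over the slices.\<close>

lemma norm_kron_id_left:
  assumes "\<And>v. norm (Q *v v) \<le> c * norm v" "c \<ge> 0"
  shows "norm (kron (mat 1) Q *v v) \<le> c * norm v"
proof (rule power2_le_imp_le)
  have *: "(\<chi> b. (kron (mat 1) Q *v v) $ (a, b)) = Q *v (\<chi> b. v $ (a, b))" for a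
    by (simp add: vec_eq_iff kron_def matrix_vector_mult_def mat_def sum_prod_UNIV if_distrib if_distribR cong: if_cong)
       (subst sum.swap, simp)
  have "(norm (kron (mat 1) Q *v v))\<^sup>2 = (\<Sum>a\<in>UNIV. (norm (Q *v (\<chi> b. v $ (a, b))))\<^sup>2)"
    by (simp add: norm_prod_square(1) * )
  also have "\<dots> \<le> (\<Sum>a\<in>UNIV. (c * norm (\<chi> b. v $ (a, b)))\<^sup>2)"
    by (intro sum_mono power_mono assms) auto
  also have "\<dots> = (c * norm v)\<^sup>2"
    by (simp add: power_mult_distrib norm_prod_square(1)[of v] sum_distrib_left)
  finally show "(norm (kron (mat 1) Q *v v))\<^sup>2 \<le> (c * norm v)\<^sup>2" .
qed (use assms in auto)

lemma norm_kron_id_right: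
  assumes "\<And>v. norm (Q *v v) \<le> c * norm v" "c \<ge> 0"
  shows "norm (kron Q (mat 1) *v v) \<le> c * norm v"
proof (rule power2_le_imp_le)
  have *: "(\<chi> a. (kron Q (mat 1) *v v) $ (a, b)) = Q *v (\<chi> a. v $ (a, b))" for b
    by (simp add: vec_eq_iff kron_def matrix_vector_mult_def mat_def sum_prod_UNIV if_distrib if_distribR cong: if_cong)
  have "(norm (kron Q (mat 1) *v v))\<^sup>2 = (\<Sum>b\<in>UNIV. (norm (Q *v (\<chi> a. v $ (a, b))))\<^sup>2)"
    by (simp add: norm_prod_square(2) * )
  also have "\<dots> \<le> (\<Sum>b\<in>UNIV. (c * norm (\<chi> a. v $ (a, b)))\<^sup>2)"
    by (intro sum_mono power_mono assms) auto
  also have "\<dots> = (c * norm v)\<^sup>2"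
    by (simp add: power_mult_distrib norm_prod_square(2)[of v] sum_distrib_left)
  finally show "(norm (kron Q (mat 1) *v v))\<^sup>2 \<le> (c * norm v)\<^sup>2" .
qed (use assms in auto)

lemma norm_kron_le:
  assumes "\<And>v. norm (Q *v v) \<le> c * norm v" "c \<ge> 0" "\<And>v. norm (Q' *v v) \<le> c' * norm v" "c' \<ge> 0"
  shows "norm (kron Q Q' *v v) \<le> c * c' * norm v"
proof -
  have "kron Q Q' *v v = kron Q (mat 1) *v (kron (mat 1) Q' *v v)"
    by (simp add: matrix_vector_mul_assoc kron_mult)
  also have "norm \<dots> \<le> c * norm (kron (mat 1) Q' *v v)"
    by (rule norm_kron_id_right[OF assms(1,2)])
  also have "\<dots> \<le> c * (c' * norm v)"
    by (intro mult_left_mono norm_kron_id_left assms)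
  finally show ?thesis by (simp add: mult.assoc)
qed

text \<open>Writing \<open>R = Q\<^sup>2\<close> moves the positive factors to the outside, where they add up to \<open>c I\<close>;
  only the factor \<open>T i\<close> is estimated in norm.\<close>

lemma vinner_sum_kron_le:
  fixes R :: "'i \<Rightarrow> complex^'a^'a" and T :: "'i \<Rightarrow> complex^'b^'b"
  assumes I: "finite I" and R: "\<And>i. i \<in> I \<Longrightarrow> psd (R i)" and sum_R: "(\<Sum>i\<in>I. R i) = mscale (complex_of_real r) (mat 1)"
    and T: "\<And>i v. i \<in> I \<Longrightarrow> norm (T i *v v) \<le> c * norm v" "c \<ge> 0"
  shows "cmod (vinner v ((\<Sum>i\<in>I. kron (R i) (T i)) *v v)) \<le> r * c * (norm v)\<^sup>2"
proof -
  have each: "cmod (vinner v (kron (R i) (T i) *v v)) \<le> c * Re (vinner v (kron (R i) (mat 1) *v v))" if iI: "i \<in> I" for i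
  proof -
    obtain Q where Q: "psd Q" "Q ** Q = R i" using psd_sqrt_exists[OF R[OF iI]] by blast
    then have hQ: "cadj (kron Q (mat 1 :: complex^'b^'b)) = kron Q (mat 1)"
      by (simp add: cadj_kron psd_def hermitian_def)
    define w where "w = kron Q (mat 1 :: complex^'b^'b) *v v"
    have "kron (R i) (T i) = kron Q (mat 1) ** (kron (mat 1) (T i) ** kron Q (mat 1))"
      by (simp add: kron_mult Q)
    then have "vinner v (kron (R i) (T i) *v v) = vinner w (kron (mat 1) (T i) *v w)"
      by (simp add: w_def vinner_cadj hQ flip: matrix_vector_mul_assoc)
    also have "cmod \<dots> \<le> norm w * (c * norm w)"
      by (intro order.trans[OF vinner_Cauchy_Schwarz] mult_left_mono norm_kron_id_left T iI) auto
    also have "\<dots> = c * Re (vinner w w)" by (simp add: vinner_self power2_eq_square)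
    also have "vinner w w = vinner v (kron Q (mat 1) *v w)"
      by (simp add: vinner_cadj hQ w_def)
    also have "kron Q (mat 1) *v w = kron (R i) (mat 1) *v v"
      by (simp add: w_def matrix_vector_mul_assoc kron_mult Q)
    finally show ?thesis .
  qed
  have "cmod (vinner v ((\<Sum>i\<in>I. kron (R i) (T i)) *v v)) \<le> (\<Sum>i\<in>I. cmod (vinner v (kron (R i) (T i) *v v)))"
    unfolding sum_matrix_vector vinner_sum_right by (rule norm_sum)
  also have "\<dots> \<le> (\<Sum>i\<in>I. c * Re (vinner v (kron (R i) (mat 1) *v v)))"
    by (intro sum_mono each)
  also have "\<dots> = c * Re (vinner v (kron (\<Sum>i\<in>I. R i) (mat 1) *v v))"
    by (simp add: kron_sum_left sum_matrix_vector vinner_sum_right sum_distrib_left)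
  also have "kron (\<Sum>i\<in>I. R i) (mat 1 :: complex^'b^'b) = mscale (complex_of_real r) (mat 1)"
    unfolding sum_R kron_mat_1[symmetric] by (simp add: kron_def mscale_def vec_eq_iff)
  also have "c * Re (vinner v (mscale (complex_of_real r) (mat 1) *v v)) = r * c * (norm v)\<^sup>2"
    by (simp add: mscale_mult_vector vinner_scale_right vinner_self)
  finally show ?thesis .
qed

lemma trace_outer_mult: "trace (outer u v ** M) = vinner v (M *v u)"
  by (simp add: trace_def outer_def vinner_def matrix_matrix_mult_def matrix_vector_mult_def sum_distrib_left)
     (subst sum.swap, simp add: mult.assoc mult.commute mult.left_commute)

text \<open>Products of three quadratic forms thus become linear functionals of
  \<open>tpow3 \<phi>\<close>, the shape to which the design hypothesis applies.\<close>

lemma trace_tpow3_mult: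
  "trace (tpow3 \<phi> ** kron A (kron B C)) = vinner \<phi> (A *v \<phi>) * vinner \<phi> (B *v \<phi>) * vinner \<phi> (C *v \<phi>)"
  by (simp add: tpow3_def kron_mult trace_kron trace_outer_mult)

lemma hermitian_tpow3: "hermitian (tpow3 \<phi>)"
  by (simp add: tpow3_def hermitian_def cadj_kron) (simp add: cadj_def outer_def vec_eq_iff mult.commute)

section \<open>Unitary invariance and moments of the Haar measure\<close>

lemma lborel_distr_basis_isometry:
  fixes b :: "'a::euclidean_space \<Rightarrow> 'b::euclidean_space"
  assumes b: "bij_betw b Basis Basis"
  shows "distr lborel borel (\<lambda>x. \<Sum>i\<in>Basis. (x \<bullet> i) *\<^sub>R b i) = lborel"
proof (rule lborel_eqI[symmetric])
  let ?f = "\<lambda>x. \<Sum>i\<in>Basis. (x \<bullet> i) *\<^sub>R b i"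
  have [measurable]: "?f \<in> borel \<rightarrow>\<^sub>M borel"
    by simp
  have inn: "?f x \<bullet> b j = x \<bullet> j" if "j \<in> Basis" for x j
  proof -
    have "?f x \<bullet> b j = (\<Sum>i\<in>Basis. (x \<bullet> i) * (b i \<bullet> b j))"
      by (simp add: inner_sum_left)
    also have "\<dots> = (\<Sum>i\<in>Basis. (x \<bullet> i) * (if i = j then 1 else 0))"
    proof (rule sum.cong[OF refl])
      fix i :: 'a assume "i \<in> Basis"
      then have "b i \<in> Basis" "b j \<in> Basis" "b i = b j \<longleftrightarrow> i = j"
        using b that by (auto simp: bij_betw_def inj_on_eq_iff)
      then show "(x \<bullet> i) * (b i \<bullet> b j) = (x \<bullet> i) * (if i = j then 1 else 0)"
        by (simp add: inner_Basis)
    qed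
    finally show ?thesis using that by (simp add: if_distrib cong: if_cong)
  qed
  have BB: "Basis = b ` Basis" using b by (simp add: bij_betw_def)
  fix l u :: 'b assume le: "\<And>c. c \<in> Basis \<Longrightarrow> l \<bullet> c \<le> u \<bullet> c"
  let ?l = "\<Sum>i\<in>Basis. (l \<bullet> b i) *\<^sub>R i" and ?u = "\<Sum>i\<in>Basis. (u \<bullet> b i) *\<^sub>R i"
  have *: "?f -` box l u = box ?l ?u"
    by (auto simp: box_def BB inn)
  have "emeasure (distr lborel borel ?f) (box l u) = emeasure lborel (box ?l ?u)"
    by (simp add: emeasure_distr *)
  also have "\<dots> = (\<Prod>i\<in>Basis. (u - l) \<bullet> b i)"
    using le BB by (subst emeasure_lborel_box) (auto simp: inner_diff_left)
  also have "(\<Prod>i\<in>Basis. (u - l) \<bullet> b i) = (\<Prod>c\<in>Basis. (u - l) \<bullet> c)"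
    using prod.reindex_bij_betw[OF b, of "\<lambda>c. (u - l) \<bullet> c"] by simp
  finally show "emeasure (distr lborel borel ?f) (box l u) = (\<Prod>c\<in>Basis. (u - l) \<bullet> c)" .
qed simp

text \<open>The inverse of \<open>T\<close> is orthogonal too, so the preimage of a box is an
  orthogonal image of that box and keeps its volume; boxes determine the measure.\<close>

lemma lborel_distr_orthogonal_cart:
  fixes T :: "real^'n::{finite,wellorder} \<Rightarrow> real^'n::_"
  assumes T: "orthogonal_transformation T"
  shows "distr lborel borel T = lborel"
proof (rule lborel_eqI[symmetric])
  have lin: "linear T" using T by (simp add: orthogonal_transformation_linear)
  then have [measurable]: "T \<in> borel \<rightarrow>\<^sub>M borel"
    by (intro borel_measurable_continuous_onI linear_continuous_on) (simp add: linear_conv_bounded_linear)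
  fix l u :: "real^'n::_" assume le: "\<And>c. c \<in> Basis \<Longrightarrow> l \<bullet> c \<le> u \<bullet> c"
  have bij: "bij T" and T': "orthogonal_transformation (inv T)"
    using T by (auto simp: orthogonal_transformation_bij orthogonal_transformation_inv)
  have *: "T -` box l u = inv T ` box l u"
    using bij by (simp add: bij_vimage_eq_inv_image)
  have m: "T -` box l u \<in> sets borel" using measurable_sets[of T borel borel "box l u"] by simp
  have "emeasure (distr lborel borel T) (box l u) = emeasure lebesgue (inv T ` box l u)"
    using m by (simp add: emeasure_distr * )
  also have "\<dots> = ennreal (measure lebesgue (inv T ` box l u))"
    using measurable_orthogonal_image[OF T' lmeasurable_box]
    by (simp add: emeasure_eq_measure2)
  also have "\<dots> = ennreal (measure lebesgue (box l u))"
    using measure_orthogonal_image[OF T' lmeasurable_box] by simp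
  also have "\<dots> = ennreal (\<Prod>c\<in>Basis. (u - l) \<bullet> c)"
    using le by simp
  finally show "emeasure (distr lborel borel T) (box l u) = (\<Prod>c\<in>Basis. (u - l) \<bullet> c)" .
qed simp

text \<open>The index type \<open>'n bit0\<close> is well-ordered and has twice as many elements as \<open>'n\<close>, so that
  the change-of-variables library applies to \<open>real^'n bit0\<close>, a real form of \<open>complex^'n\<close>.\<close>

lemma lborel_distr_orthogonal:
  fixes T :: "complex^'n \<Rightarrow> complex^'n"
  assumes T: "orthogonal_transformation T"
  shows "distr lborel borel T = lborel"
proof -
  have "card (Basis :: (real^'n bit0) set) = card (Basis :: (complex^'n) set)"
    by simp
  then obtain b :: "real^'n bit0 \<Rightarrow> complex^'n" where b: "bij_betw b Basis Basis"
    using finite_same_card_bij[OF finite_Basis finite_Basis] by blast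
  define c where "c = the_inv_into Basis b"
  have c: "bij_betw c Basis Basis" unfolding c_def using b by (rule bij_betw_the_inv_into)
  define f where "f x = (\<Sum>i\<in>Basis. (x \<bullet> i) *\<^sub>R b i)" for x
  define g where "g x = (\<Sum>i\<in>Basis. (x \<bullet> i) *\<^sub>R c i)" for x
  have cb: "c (b i) = i" if "i \<in> Basis" for i
    using b that by (simp add: c_def bij_betw_def the_inv_into_f_f)
  have bc: "b (c i) = i" if "i \<in> Basis" for i
    using b that by (simp add: c_def bij_betw_def f_the_inv_into_f)
  have linf: "linear f" and ling: "linear g"
    unfolding f_def g_def by (auto intro!: linearI simp: inner_add_left scaleR_left_distrib sum.distrib scaleR_sum_right)
  have [measurable]: "f \<in> borel \<rightarrow>\<^sub>M borel" "g \<in> borel \<rightarrow>\<^sub>M borel"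
    unfolding f_def g_def by auto
  have linT: "linear T" using T by (simp add: orthogonal_transformation_linear)
  then have [measurable]: "T \<in> borel \<rightarrow>\<^sub>M borel"
    by (intro borel_measurable_continuous_onI linear_continuous_on) (simp add: linear_conv_bounded_linear)
  have g_alt: "g x = (\<Sum>j\<in>Basis. (x \<bullet> b j) *\<^sub>R j)" for x
    unfolding g_def using sum.reindex_bij_betw[OF b, of "\<lambda>i. (x \<bullet> i) *\<^sub>R c i"] by (simp add: cb)
  have f_alt: "f x = (\<Sum>j\<in>Basis. (x \<bullet> c j) *\<^sub>R j)" for x
    unfolding f_def using sum.reindex_bij_betw[OF c, of "\<lambda>i. (x \<bullet> i) *\<^sub>R b i"] by (simp add: bc)
  have cB: "c j \<in> Basis" if "j \<in> Basis" for j using c that by (auto simp: bij_betw_def)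
  have bB: "b j \<in> Basis" if "j \<in> Basis" for j using b that by (auto simp: bij_betw_def)
  have fg: "f (g x) = x" for x
    unfolding f_alt using euclidean_representation[of x] by (simp add: g_alt cB bc inner_sum_left_Basis)
  have gf: "g (f x) = x" for x
    unfolding g_alt using euclidean_representation[of x] by (simp add: f_alt bB cb inner_sum_left_Basis)
  have f_inner: "f x \<bullet> f y = x \<bullet> y" for x y
    unfolding euclidean_inner[of "f x" "f y"] euclidean_inner[of x y]
    using sum.reindex_bij_betw[OF c, of "\<lambda>i. (x \<bullet> i) * (y \<bullet> i)"] by (simp add: f_alt)
  have g_inner: "g x \<bullet> g y = x \<bullet> y" for x y
    using f_inner[of "g x" "g y"] by (simp add: fg)
  have "orthogonal_transformation (g \<circ> T \<circ> f)"
    using linf ling linT T unfolding orthogonal_transformation_def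
    by (auto simp: linear_compose g_inner f_inner)
  then have *: "distr lborel borel (g \<circ> T \<circ> f) = lborel"
    by (rule lborel_distr_orthogonal_cart)
  have f_lborel: "distr lborel borel f = lborel"
    unfolding f_def by (rule lborel_distr_basis_isometry[OF b])
  have "distr lborel borel T = distr (distr lborel borel f) borel T"
    by (simp add: f_lborel)
  also have "\<dots> = distr lborel borel (T \<circ> f)"
    by (subst distr_distr) auto
  also have "T \<circ> f = f \<circ> (g \<circ> T \<circ> f)"
    by (auto simp: fg)
  also have "distr lborel borel \<dots> = distr (distr lborel borel (g \<circ> T \<circ> f)) borel f"
    by (subst distr_distr) (auto simp: comp_def)
  finally show ?thesis using * f_lborel by simp
qed

section \<open>The Haar measure on pure states\<close>

lemma sgn_borel_measurable: "(sgn :: 'a::euclidean_space \<Rightarrow> 'a) \<in> borel_measurable borel"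
  unfolding sgn_div_norm by measurable

lemma uniform_measure_ball_prob_space:
  "prob_space (uniform_measure lborel (ball 0 1 :: 'a::euclidean_space set))"
proof (rule prob_space_uniform_measure)
  show "emeasure lborel (ball 0 1 :: 'a set) \<noteq> 0"
    using open_not_negligible[of "ball 0 1 :: 'a set"] by (auto simp: negligible_iff_null_sets null_sets_def)
  show "emeasure lborel (ball 0 1 :: 'a set) \<noteq> \<infinity>"
    using emeasure_lborel_ball_finite[of "0 :: 'a" 1] by auto
qed

lemma prob_space_haar_state: "prob_space haar_state"
  unfolding haar_state_def
  by (intro prob_space.prob_space_distr[OF uniform_measure_ball_prob_space]) (simp add: sgn_borel_measurable)

lemma sets_haar_state [measurable_cong, simp]: "sets haar_state = sets borel"
  by (simp add: haar_state_def)

lemma space_haar_state [simp]: "space haar_state = UNIV"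
  by (simp add: haar_state_def)

lemma AE_haar_state_norm: "AE w in haar_state. norm w = 1"
proof -
  have "AE v in lborel. v \<noteq> (0 :: complex^'n)"
    by (rule AE_lborel_singleton)
  then have "AE v in uniform_measure lborel (ball 0 1). norm (sgn v :: complex^'n) = 1"
    by (intro AE_uniform_measureI) (auto simp: norm_sgn)
  then show ?thesis
    unfolding haar_state_def by (subst AE_distr_iff) (auto simp: sgn_borel_measurable)
qed

lemma orthogonal_transformation_measurable:
  fixes T :: "complex^'n \<Rightarrow> complex^'n"
  assumes "orthogonal_transformation T"
  shows "T \<in> borel_measurable borel"
  using assms
  by (intro borel_measurable_continuous_onI linear_continuous_on)
     (simp add: orthogonal_transformation_linear flip: linear_conv_bounded_linear)

text \<open>An orthogonal map preserves Lebesgue measure and the ball and commutes with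
  \<open>sgn\<close>. Only real linearity enters, so antilinear isometries such as complex
  conjugation are covered.\<close>

lemma haar_state_invariant:
  fixes T :: "complex^'n \<Rightarrow> complex^'n"
  assumes T: "orthogonal_transformation T"
  shows "distr haar_state borel T = haar_state"
proof -
  let ?U = "uniform_measure lborel (ball 0 1) :: (complex^'n) measure"
  note [measurable] = orthogonal_transformation_measurable[OF T] sgn_borel_measurable
  have norm_T: "norm (T v) = norm v" for v using T by (simp add: orthogonal_transformation_norm)
  have "distr ?U borel T = ?U"
  proof (rule measure_eqI)
    fix A assume "A \<in> sets (distr ?U borel T)"
    then have [measurable]: "A \<in> sets borel" by simp
    have "emeasure (distr ?U borel T) A = emeasure lborel (ball 0 1 \<inter> T -` A) / emeasure lborel (ball 0 1 :: (complex^'n) set)"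
      using measurable_sets[of T borel borel A] by (simp add: emeasure_distr)
    also have "ball 0 1 \<inter> T -` A = T -` (ball 0 1 \<inter> A)"
      by (auto simp: norm_T)
    also have "emeasure lborel (T -` (ball 0 1 \<inter> A)) = emeasure (distr lborel borel T) (ball 0 1 \<inter> A)"
      by (simp add: emeasure_distr)
    also have "\<dots> = emeasure lborel (ball 0 1 \<inter> A)"
      by (simp add: lborel_distr_orthogonal[OF T])
    finally show "emeasure (distr ?U borel T) A = emeasure ?U A" by simp
  qed simp
  then have "haar_state = distr (distr ?U borel T) borel sgn"
    by (simp add: haar_state_def)
  also have "\<dots> = distr ?U borel (\<lambda>v. sgn (T v))"
    by (subst distr_distr) (auto simp: comp_def)
  also have "(\<lambda>v. sgn (T v)) = (\<lambda>v. T (sgn v))"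
    using T by (simp add: sgn_div_norm norm_T orthogonal_transformation_scaleR)
  also have "distr ?U borel \<dots> = distr haar_state borel T"
    unfolding haar_state_def by (subst distr_distr) (auto simp: comp_def)
  finally show ?thesis ..
qed

lemma haar_integral_invariant:
  fixes f :: "complex^'n \<Rightarrow> real" and T :: "complex^'n \<Rightarrow> complex^'n"
  assumes "orthogonal_transformation T" "continuous_on UNIV f"
  shows "(\<integral>w. f (T w) \<partial>haar_state) = (\<integral>w. f w \<partial>haar_state)"
proof -
  have "(\<integral>w. f w \<partial>haar_state) = (\<integral>w. f w \<partial>distr haar_state borel T)"
    by (simp add: haar_state_invariant[OF assms(1)])
  also have "\<dots> = (\<integral>w. f (T w) \<partial>haar_state)"
    using orthogonal_transformation_measurable[OF assms(1)] borel_measurable_continuous_onI[OF assms(2)]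
    by (intro integral_distr) auto
  finally show ?thesis ..
qed

text \<open>A continuous function is bounded on the compact sphere, which carries the measure. This
  settles integrability for the Haar measure and for the design alike.\<close>

lemma integrable_on_sphere:
  fixes f :: "'a::euclidean_space \<Rightarrow> 'b::{banach, second_countable_topology}" and M :: "'a measure"
  assumes M: "prob_space M" "sets M = sets borel" "AE v in M. norm v = 1" and f: "continuous_on UNIV f"
  shows "integrable M f"
proof -
  interpret prob_space M by fact
  have "compact (f ` sphere 0 1)"
    by (intro compact_continuous_image continuous_on_subset[OF f]) auto
  then obtain B where B: "\<And>v. norm v = 1 \<Longrightarrow> norm (f v) \<le> B"
    using compact_imp_bounded bounded_iff by (metis imageI mem_sphere_0)
  have "AE v in M. norm (f v) \<le> B"
    using M(3) by (rule eventually_mono) (rule B)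
  moreover have "f \<in> borel_measurable M"
    using borel_measurable_continuous_onI[OF f] by (simp add: measurable_cong_sets[OF M(2) refl])
  ultimately show ?thesis by (intro integrable_const_bound)
qed

lemmas integrable_haar_state = integrable_on_sphere[OF prob_space_haar_state sets_haar_state AE_haar_state_norm]

section \<open>Coordinate moments from symmetry\<close>

lemma norm_square_vec: "(norm v)\<^sup>2 = (\<Sum>i\<in>UNIV. (cmod (v $ i))\<^sup>2)" for v :: "complex^'n"
  by (simp add: norm_vec_def L2_set_def sum_nonneg)

lemma orthogonal_transformationI:
  fixes T :: "complex^'n \<Rightarrow> complex^'n"
  assumes "linear T" "\<And>v. (\<Sum>i\<in>UNIV. (cmod (T v $ i))\<^sup>2) = (\<Sum>i\<in>UNIV. (cmod (v $ i))\<^sup>2)"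
  shows "orthogonal_transformation T"
proof -
  have "norm (T v) = norm v" for v
    by (rule power2_eq_imp_eq) (simp_all only: norm_square_vec assms(2) norm_ge_zero)
  then show ?thesis using assms(1) by (simp add: orthogonal_transformation)
qed

text \<open>Together with \<open>swap_map\<close> and \<open>rotation_map\<close>, the Hadamard
  matrix on two coordinates, these symmetries determine every moment below: phases remove mixed
  terms, swaps leave only the pattern of equal indices, and the Hadamard map relates different
  patterns.\<close>

definition phase_map :: "'n \<Rightarrow> complex \<Rightarrow> complex^'n \<Rightarrow> complex^'n" where
  "phase_map k c v = (\<chi> i. if i = k then c * v $ i else v $ i)"

definition swap_map :: "'n \<Rightarrow> 'n \<Rightarrow> complex^'n \<Rightarrow> complex^'n" where
  "swap_map a b v = (\<chi> i. v $ Transposition.transpose a b i)"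

definition rotation_map :: "'n \<Rightarrow> 'n \<Rightarrow> complex^'n \<Rightarrow> complex^'n" where
  "rotation_map a b v = (\<chi> i. if i = a then (v $ a + v $ b) / sqrt 2
     else if i = b then (v $ a - v $ b) / sqrt 2 else v $ i)"

lemma orthogonal_phase_map: "cmod c = 1 \<Longrightarrow> orthogonal_transformation (phase_map k c)"
  by (intro orthogonal_transformationI linearI)
     (auto simp: phase_map_def vec_eq_iff algebra_simps norm_mult intro!: sum.cong)

lemma orthogonal_swap_map: "orthogonal_transformation (swap_map a b)"
proof (intro orthogonal_transformationI linearI)
  show "(\<Sum>i\<in>UNIV. (cmod (swap_map a b v $ i))\<^sup>2) = (\<Sum>i\<in>UNIV. (cmod (v $ i))\<^sup>2)" for v
    using sum.reindex_bij_betw[OF bij_transpose[of a b], of "\<lambda>i. (cmod (v $ i))\<^sup>2"] by (simp add: swap_map_def)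
qed (auto simp: swap_map_def vec_eq_iff)

lemma cmod_parallelogram:
  fixes x y :: complex
  shows
  "(cmod ((x + y) / sqrt 2))\<^sup>2 + (cmod ((x - y) / sqrt 2))\<^sup>2 = (cmod x)\<^sup>2 + (cmod y)\<^sup>2"
  unfolding norm_divide power_divide cmod_power2 by (simp add: power2_eq_square field_simps)

lemma orthogonal_rotation_map:
  assumes "a \<noteq> b"
  shows "orthogonal_transformation (rotation_map a b)"
proof (intro orthogonal_transformationI linearI)
  fix v :: "complex^'a"
  have *: "(\<Sum>i\<in>UNIV. f i) = f a + f b + (\<Sum>i\<in>UNIV - {a, b}. f i)" for f :: "'a \<Rightarrow> real"
    using assms by (subst sum.subset_diff[of "{a, b}"]) auto
  have "(\<Sum>i\<in>UNIV - {a, b}. (cmod (rotation_map a b v $ i))\<^sup>2) = (\<Sum>i\<in>UNIV - {a, b}. (cmod (v $ i))\<^sup>2)"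
    by (intro sum.cong) (auto simp: rotation_map_def)
  moreover have "(cmod (rotation_map a b v $ a))\<^sup>2 + (cmod (rotation_map a b v $ b))\<^sup>2 = (cmod (v $ a))\<^sup>2 + (cmod (v $ b))\<^sup>2"
    using assms cmod_parallelogram[of "v $ a" "v $ b"] by (simp add: rotation_map_def)
  ultimately show "(\<Sum>i\<in>UNIV. (cmod (rotation_map a b v $ i))\<^sup>2) = (\<Sum>i\<in>UNIV. (cmod (v $ i))\<^sup>2)"
    by (simp only: *[of "\<lambda>i. (cmod (rotation_map a b v $ i))\<^sup>2"] *[of "\<lambda>i. (cmod (v $ i))\<^sup>2"])
qed (use assms in \<open>auto simp: rotation_map_def vec_eq_iff field_simps scaleR_conv_of_real[where 'a=complex]\<close>)

text \<open>The left side is the squared modulus of \<open>x^2 - y^2\<close>, divided by 4; the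
  right side expands it.\<close>

lemma cmod_product_identity:
  fixes x y :: complex
  shows
  "(cmod ((x + y) / sqrt 2))\<^sup>2 * (cmod ((x - y) / sqrt 2))\<^sup>2
    = ((cmod x)\<^sup>2)\<^sup>2 / 4 + ((cmod y)\<^sup>2)\<^sup>2 / 4 - Re (x\<^sup>2 * (cnj y)\<^sup>2) / 2"
  unfolding norm_divide power_divide cmod_power2 by (simp add: power2_eq_square field_simps)

text \<open>Apply the rotation to the mixed moment and expand. The cross term integrates to 0 by a
  phase, the two fourth powers agree by the swap, and one half of a fourth-power moment remains. The
  weight \<open>g\<close> carries the third index of a degree-three moment.\<close>

lemma haar_pair_moment:
  fixes g :: "complex^'n \<Rightarrow> real"
  assumes ij: "i \<noteq> j" and g: "continuous_on UNIV g"
    and inv: "\<And>w. g (phase_map i \<i> w) = g w" "\<And>w. g (swap_map i j w) = g w" "\<And>w. g (rotation_map i j w) = g w"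
  shows "(\<integral>w. (cmod (w $ i))\<^sup>2 * (cmod (w $ j))\<^sup>2 * g w \<partial>haar_state)
    = (\<integral>w. ((cmod (w $ i))\<^sup>2)\<^sup>2 * g w \<partial>haar_state) / 2"
proof -
  let ?c = "\<lambda>w :: complex^'n. Re ((w $ i)\<^sup>2 * (cnj (w $ j))\<^sup>2) * g w"
  have cont: "continuous_on UNIV ?c" "continuous_on UNIV (\<lambda>w. ((cmod (w $ k))\<^sup>2)\<^sup>2 * g w)"
    "continuous_on UNIV (\<lambda>w. (cmod (w $ i))\<^sup>2 * (cmod (w $ j))\<^sup>2 * g w)" for k
    using g by (auto intro!: continuous_intros)
  \<comment> \<open>The coordinate enters \<open>?c\<close> squared, so the phase
    \<open>\<i>\<close> reverses the sign where \<open>-1\<close> would leave it unchanged.\<close>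
  have "(\<integral>w. ?c w \<partial>haar_state) = (\<integral>w. ?c (phase_map i \<i> w) \<partial>haar_state)"
    by (intro haar_integral_invariant[symmetric] orthogonal_phase_map cont) simp
  also have "(\<lambda>w. ?c (phase_map i \<i> w)) = (\<lambda>w. - ?c w)"
    using ij by (simp add: inv(1)) (simp add: phase_map_def power_mult_distrib algebra_simps)
  finally have c0: "(\<integral>w. ?c w \<partial>haar_state) = 0" by simp
  have "(\<integral>w. ((cmod (w $ j))\<^sup>2)\<^sup>2 * g w \<partial>haar_state) = (\<integral>w. ((cmod (swap_map i j w $ j))\<^sup>2)\<^sup>2 * g (swap_map i j w) \<partial>haar_state)"
    by (intro haar_integral_invariant[symmetric, of _ "\<lambda>w. ((cmod (w $ j))\<^sup>2)\<^sup>2 * g w"] orthogonal_swap_map cont)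
  also have "\<dots> = (\<integral>w. ((cmod (w $ i))\<^sup>2)\<^sup>2 * g w \<partial>haar_state)"
    using inv(2) by (simp add: swap_map_def)
  finally have sw: "(\<integral>w. ((cmod (w $ j))\<^sup>2)\<^sup>2 * g w \<partial>haar_state) = (\<integral>w. ((cmod (w $ i))\<^sup>2)\<^sup>2 * g w \<partial>haar_state)" .
  have "(\<integral>w. (cmod (w $ i))\<^sup>2 * (cmod (w $ j))\<^sup>2 * g w \<partial>haar_state)
    = (\<integral>w. (cmod (rotation_map i j w $ i))\<^sup>2 * (cmod (rotation_map i j w $ j))\<^sup>2 * g (rotation_map i j w) \<partial>haar_state)"
    by (intro haar_integral_invariant[symmetric, of _ "\<lambda>w. (cmod (w $ i))\<^sup>2 * (cmod (w $ j))\<^sup>2 * g w"] orthogonal_rotation_map ij cont)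
  also have "\<dots> = (\<integral>w. (((cmod (w $ i))\<^sup>2)\<^sup>2 * g w) / 4 + (((cmod (w $ j))\<^sup>2)\<^sup>2 * g w) / 4 - ?c w / 2 \<partial>haar_state)"
  proof (intro Bochner_Integration.integral_cong refl)
    fix w :: "complex^'n"
    have "(cmod (rotation_map i j w $ i))\<^sup>2 * (cmod (rotation_map i j w $ j))\<^sup>2
       = ((cmod (w $ i))\<^sup>2)\<^sup>2 / 4 + ((cmod (w $ j))\<^sup>2)\<^sup>2 / 4 - Re ((w $ i)\<^sup>2 * (cnj (w $ j))\<^sup>2) / 2"
      using ij cmod_product_identity[of "w $ i" "w $ j"] by (simp add: rotation_map_def)
    then show "(cmod (rotation_map i j w $ i))\<^sup>2 * (cmod (rotation_map i j w $ j))\<^sup>2 * g (rotation_map i j w)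
      = (((cmod (w $ i))\<^sup>2)\<^sup>2 * g w) / 4 + (((cmod (w $ j))\<^sup>2)\<^sup>2 * g w) / 4 - ?c w / 2"
      by (simp only: inv(3)) (simp add: algebra_simps)
  qed
  also have "\<dots> = (\<integral>w. ((cmod (w $ i))\<^sup>2)\<^sup>2 * g w \<partial>haar_state) / 4 + (\<integral>w. ((cmod (w $ j))\<^sup>2)\<^sup>2 * g w \<partial>haar_state) / 4
      - (\<integral>w. ?c w \<partial>haar_state) / 2"
    using integrable_haar_state[OF cont(1)] integrable_haar_state[OF cont(2)]
    by simp
  finally show ?thesis unfolding c0 sw by simp
qed

definition haar_moment :: "'n::finite \<Rightarrow> 'n \<Rightarrow> 'n \<Rightarrow> real" where
  "haar_moment i j k = (\<integral>w. (cmod (w $ i))\<^sup>2 * (cmod (w $ j))\<^sup>2 * (cmod (w $ k))\<^sup>2 \<partial>(haar_state :: (complex^'n) measure))"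

lemma haar_moment_commute:
  "haar_moment i j k = haar_moment j i k" "haar_moment i j k = haar_moment i k j"
  by (simp_all add: haar_moment_def mult_ac)

lemma haar_moment_transpose:
  "haar_moment (Transposition.transpose a b i) (Transposition.transpose a b j) (Transposition.transpose a b k) = haar_moment i j k"
  unfolding haar_moment_def
  using haar_integral_invariant[OF orthogonal_swap_map[of a b],
      of "\<lambda>w. (cmod (w $ i))\<^sup>2 * (cmod (w $ j))\<^sup>2 * (cmod (w $ k))\<^sup>2"]
  by (simp add: swap_map_def continuous_intros)

lemma haar_moment_distinct:
  assumes "i \<noteq> j" "k \<noteq> i" "k \<noteq> j"
  shows "haar_moment i j k = haar_moment i i k / 2"
  unfolding haar_moment_def using assms
  by (subst haar_pair_moment[where g="\<lambda>w. (cmod (w $ k))\<^sup>2"])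
     (auto simp: phase_map_def swap_map_def rotation_map_def power2_eq_square intro!: continuous_intros)

text \<open>The weight \<open>(cmod (w $ i))^2 + (cmod (w $ j))^2\<close> is invariant under the
  rotation. The pair relation with this weight reads \<open>4 b = a + b\<close>, where
  \<open>a\<close> and \<open>b\<close> are the moments of type \<open>i i i\<close> and
  \<open>i i j\<close>.\<close>

lemma haar_moment_cube:
  assumes "i \<noteq> j"
  shows "haar_moment i i i = 3 * haar_moment i i j"
proof -
  let ?p = "\<lambda>i w. (cmod (w $ i))\<^sup>2"
  let ?H = "haar_state :: (complex^'a) measure"
  have int: "integrable ?H (\<lambda>w. ?p i w * ?p j w * ?p k w)" for i j k
    by (intro integrable_haar_state continuous_intros)
  have "(\<integral>w. ?p i w * ?p j w * (?p i w + ?p j w) \<partial>?H) = (\<integral>w. (?p i w)\<^sup>2 * (?p i w + ?p j w) \<partial>?H) / 2"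
  proof (rule haar_pair_moment[OF assms])
    show "?p i (rotation_map i j w) + ?p j (rotation_map i j w) = ?p i w + ?p j w" for w
      using assms cmod_parallelogram[of "w $ i" "w $ j"] by (simp add: rotation_map_def)
  qed (use assms in \<open>auto simp: phase_map_def swap_map_def norm_mult intro!: continuous_intros\<close>)
  also have "(\<lambda>w. ?p i w * ?p j w * (?p i w + ?p j w)) = (\<lambda>w. ?p i w * ?p j w * ?p i w + ?p i w * ?p j w * ?p j w)"
    by (simp add: distrib_left)
  also have "(\<lambda>w. (?p i w)\<^sup>2 * (?p i w + ?p j w)) = (\<lambda>w. ?p i w * ?p i w * ?p i w + ?p i w * ?p i w * ?p j w)"
    by (simp only: distrib_left power2_eq_square[of "?p i _"])
  finally have "haar_moment i j i + haar_moment i j j = (haar_moment i i i + haar_moment i i j) / 2"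
    unfolding haar_moment_def Bochner_Integration.integral_add[OF int int] .
  then have "2 * (haar_moment i j i + haar_moment i j j) = haar_moment i i i + haar_moment i i j" by simp
  moreover have "haar_moment i j i = haar_moment i i j" by (rule haar_moment_commute)
  moreover have "haar_moment i j j = haar_moment i i j"
    using haar_moment_transpose[of i j i i j] haar_moment_commute[of j i] haar_moment_commute(1)[of j j i]
    by (simp add: haar_moment_commute(2)[of j j i])
  ultimately show ?thesis by simp
qed

abbreviation kdelta :: "'n \<Rightarrow> 'n \<Rightarrow> real" where
  "kdelta i j \<equiv> if i = j then 1 else 0"

lemma sum_kdelta: "(\<Sum>k\<in>UNIV. kdelta i k * f k) = f (i :: 'n::finite)"
proof -
  have "(\<Sum>k\<in>UNIV. kdelta i k * f k) = (\<Sum>k\<in>UNIV. if i = k then f k else 0)"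
    by (intro sum.cong) auto
  then show ?thesis by simp
qed

lemma integral_haar_one: "(\<integral>w. 1 \<partial>(haar_state :: (complex^'n) measure)) = (1 :: real)"
  using prob_space.prob_space[OF prob_space_haar_state] by simp

text \<open>As \<open>norm w = 1\<close> almost everywhere, summing over one index lowers the
  degree; this yields both the normalisation and the second moments from the third.\<close>

lemma haar_moment_sum: "(\<Sum>k\<in>UNIV. (\<integral>w. f w * (cmod (w $ k))\<^sup>2 \<partial>haar_state)) = (\<integral>w. f w \<partial>haar_state)"
  if f: "continuous_on UNIV f" for f :: "complex^'n \<Rightarrow> real"
proof -
  have "(\<Sum>k\<in>UNIV. (\<integral>w. f w * (cmod (w $ k))\<^sup>2 \<partial>haar_state)) = (\<integral>w. (\<Sum>k\<in>UNIV. f w * (cmod (w $ k))\<^sup>2) \<partial>haar_state)"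
    using f by (intro Bochner_Integration.integral_sum[symmetric] integrable_haar_state continuous_intros)
  also have "\<dots> = (\<integral>w. f w * (norm w)\<^sup>2 \<partial>haar_state)"
    by (simp add: norm_square_vec sum_distrib_left)
  also have "\<dots> = (\<integral>w. f w \<partial>haar_state)"
    using AE_haar_state_norm
      borel_measurable_integrable[OF integrable_haar_state[OF f]]
      borel_measurable_integrable[OF integrable_haar_state[of "\<lambda>w. f w * (norm w)\<^sup>2"]] f
    by (intro integral_cong_AE) (auto intro!: continuous_intros)
  finally show ?thesis .
qed

text \<open>The numerator counts the permutations of three positions that fix the triple
  \<open>(i, j, k)\<close>: 6, 2 or 1. The ratios 3 and 2 between the patterns leave one free
  constant, which the total mass 1 determines.\<close>

lemma haar_moment_formula:
  fixes i j k :: "'n::finite"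
  defines "d \<equiv> real CARD('n)"
  shows "haar_moment i j k = (1 + kdelta i j + kdelta j k + kdelta i k + 2 * (kdelta i j * kdelta j k)) / (d * (d + 1) * (d + 2))"
proof -
  \<comment> \<open>\<open>undefined\<close> is a mere reference index, which transpositions carry
    to any other; 6 is the value of the numerator at three equal indices.\<close>
  define c where "c = haar_moment undefined undefined (undefined :: 'n) / 6"
  have cube: "haar_moment i i i = 6 * c" for i :: 'n
    using haar_moment_transpose[of undefined i undefined undefined undefined] by (simp add: c_def)
  have square: "haar_moment i i j = 2 * c" if "i \<noteq> j" for i j :: 'n
    using haar_moment_cube[OF that] cube[of i] by simp
  have moment: "haar_moment i j k = c * (1 + kdelta i j + kdelta j k + kdelta i k + 2 * (kdelta i j * kdelta j k))" for i j k :: 'n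
  proof (cases "i = j \<or> j = k \<or> i = k")
    case True
    then show ?thesis
      using cube[of i] square[of i k] square[of j i] square[of i j]
        haar_moment_commute(1)[of i j j] haar_moment_commute(2)[of j i j] haar_moment_commute(2)[of i j i]
      by auto
  next
    case False
    then show ?thesis
      using haar_moment_distinct[of i j k] square[of i k] by auto
  qed
  have "1 = (\<Sum>i\<in>UNIV. \<Sum>j\<in>UNIV. \<Sum>k\<in>UNIV. haar_moment i j (k :: 'n))"
    unfolding haar_moment_def
    by (subst haar_moment_sum, intro continuous_intros)+
       (use haar_moment_sum[of "\<lambda>_ :: complex^'n. 1"] integral_haar_one in simp)
  also have "\<dots> = c * (d * (d + 1) * (d + 2))"
    unfolding moment d_def sum_distrib_left[symmetric]
    by (simp add: sum.distrib algebra_simps flip: sum_distrib_left)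
  finally have "c = 1 / (d * (d + 1) * (d + 2))"
    by (metis div_by_0 eq_divide_eq mult_zero_right zero_neq_one)
  then show ?thesis by (simp add: moment)
qed

lemma haar_moment2_formula:
  fixes i j :: "'n::finite"
  defines "d \<equiv> real CARD('n)"
  shows "(\<integral>w. (cmod (w $ i))\<^sup>2 * (cmod (w $ j))\<^sup>2 \<partial>haar_state) = (1 + kdelta i j) / (d * (d + 1))"
proof -
  have d: "d > 0" by (simp add: d_def)
  have "(\<integral>w. (cmod (w $ i))\<^sup>2 * (cmod (w $ j))\<^sup>2 \<partial>haar_state) = (\<Sum>k\<in>UNIV. haar_moment i j k)"
    unfolding haar_moment_def by (intro haar_moment_sum[symmetric] continuous_intros)
  also have "\<dots> = (\<Sum>k\<in>UNIV. 1 + kdelta i j + kdelta j k + kdelta i k + 2 * (kdelta i j * kdelta j k)) / (d * (d + 1) * (d + 2))"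
    unfolding haar_moment_formula d_def by (simp add: sum_divide_distrib)
  also have "(\<Sum>k\<in>UNIV. 1 + kdelta i j + kdelta j k + kdelta i k + 2 * (kdelta i j * kdelta j k)) = (1 + kdelta i j) * (d + 2)"
    by (simp add: sum.distrib d_def algebra_simps flip: sum_distrib_left)
  finally show ?thesis
    using d nonzero_mult_divide_mult_cancel_right[of "d + 2" "1 + kdelta i j" "d * (d + 1)"] by simp
qed

section \<open>Haar moments of quadratic forms\<close>

lemma orthogonal_basis_change:
  assumes e: "orthonormal_basis e"
  shows "orthogonal_transformation (\<lambda>w. \<chi> i. vinner (e i) w)"
proof (intro orthogonal_transformationI linearI)
  show "(\<Sum>i\<in>UNIV. (cmod ((\<chi> i. vinner (e i) v) $ i))\<^sup>2) = (\<Sum>i\<in>UNIV. (cmod (v $ i))\<^sup>2)" for v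
    by (simp add: onb_norm_square[OF e, symmetric] norm_square_vec)
qed (simp_all add: vec_eq_iff vinner_add_right vinner_scale_right scaleR_conv_of_real[where 'a=complex] flip: of_real_cscale)

text \<open>The integrand is odd under the sign flip of coordinate \<open>i\<close>.\<close>

lemma haar_offdiagonal:
  fixes g :: "complex^'n \<Rightarrow> real"
  assumes "i \<noteq> j" "continuous_on UNIV g" "\<And>w. g (phase_map i (-1) w) = g w"
  shows "(\<integral>w. Re (cnj (w $ i) * z * w $ j) * g w \<partial>haar_state) = 0"
proof -
  let ?f = "\<lambda>w. Re (cnj (w $ i) * z * w $ j) * g w"
  have "(\<integral>w. ?f w \<partial>haar_state) = (\<integral>w. ?f (phase_map i (-1) w) \<partial>haar_state)"
    using assms(2) by (intro haar_integral_invariant[symmetric] orthogonal_phase_map continuous_intros) auto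
  also have "(\<lambda>w. ?f (phase_map i (-1) w)) = (\<lambda>w. - ?f w)"
    using assms(1) by (simp add: assms(3)) (simp add: phase_map_def algebra_simps)
  finally show ?thesis by simp
qed

text \<open>In coordinates with respect to \<open>e\<close>, the sign flips remove all off-diagonal
  entries of \<open>\<rho>\<close>. Hence only its diagonal in the eigenbasis of the observable
  matters, even where the two do not commute.\<close>

lemma haar_quadratic_form:
  fixes e :: "'n \<Rightarrow> complex^'n" and h :: "complex^'n \<Rightarrow> real"
  assumes e: "orthonormal_basis e" and h: "continuous_on UNIV h"
    and inv: "\<And>i w. h (phase_map i (-1) w) = h w"
  shows "(\<integral>w. Re (vinner w (\<rho> *v w)) * h (\<chi> i. vinner (e i) w) \<partial>haar_state)
    = (\<Sum>i\<in>UNIV. Re (vinner (e i) (\<rho> *v e i)) * (\<integral>w. (cmod (w $ i))\<^sup>2 * h w \<partial>haar_state))"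
proof -
  let ?T = "\<lambda>w. \<chi> i. vinner (e i) w"
  let ?r = "\<lambda>i j. vinner (e i) (\<rho> *v e j)"
  have form: "vinner w (\<rho> *v w) = (\<Sum>i\<in>UNIV. \<Sum>j\<in>UNIV. cnj (?T w $ i) * ?r i j * ?T w $ j)" for w
  proof -
    have "vinner w (\<rho> *v w) = (\<Sum>i\<in>UNIV. vinner w (e i) * vinner (e i) (\<rho> *v w))"
      by (rule onb_parseval[OF e])
    moreover have "vinner (e i) (\<rho> *v w) = (\<Sum>j\<in>UNIV. ?r i j * vinner (e j) w)" for i
      unfolding vinner_cadj by (rule onb_parseval[OF e])
    ultimately show ?thesis by (simp add: cnj_vinner sum_distrib_left mult.assoc)
  qed
  let ?F = "\<lambda>w. \<Sum>i\<in>UNIV. \<Sum>j\<in>UNIV. Re (cnj (w $ i) * ?r i j * w $ j) * h w"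
  have cont: "continuous_on UNIV (\<lambda>w. Re (cnj (w $ i) * z * w $ j) * h w)" for i j z
    using h by (intro continuous_intros)
  have "(\<integral>w. Re (vinner w (\<rho> *v w)) * h (?T w) \<partial>haar_state) = (\<integral>w. ?F (?T w) \<partial>haar_state)"
    by (simp only: form Re_sum sum_distrib_right)
  also have "\<dots> = (\<integral>w. ?F w \<partial>haar_state)"
    by (intro haar_integral_invariant orthogonal_basis_change[OF e] continuous_on_sum cont)
  also have "\<dots> = (\<Sum>i\<in>UNIV. \<Sum>j\<in>UNIV. \<integral>w. Re (cnj (w $ i) * ?r i j * w $ j) * h w \<partial>haar_state)"
    by (subst Bochner_Integration.integral_sum; (intro Bochner_Integration.integrable_sum integrable_haar_state cont)?)+ auto
  also have "\<dots> = (\<Sum>i\<in>UNIV. \<Sum>j\<in>UNIV. if j = i then \<integral>w. Re (cnj (w $ i) * ?r i i * w $ i) * h w \<partial>haar_state else 0)"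
    using haar_offdiagonal[OF _ h inv] by (intro sum.cong refl) auto
  also have "\<dots> = (\<Sum>i\<in>UNIV. \<integral>w. Re (cnj (w $ i) * ?r i i * w $ i) * h w \<partial>haar_state)"
    by simp
  also have "\<dots> = (\<Sum>i\<in>UNIV. Re (?r i i) * (\<integral>w. (cmod (w $ i))\<^sup>2 * h w \<partial>haar_state))"
  proof (intro sum.cong refl)
    fix i
    have "Re (cnj (w $ i) * ?r i i * w $ i) = Re (?r i i) * (cmod (w $ i))\<^sup>2" for w
      by (simp add: cmod_power2) (simp add: algebra_simps power2_eq_square)
    then show "(\<integral>w. Re (cnj (w $ i) * ?r i i * w $ i) * h w \<partial>haar_state) = Re (?r i i) * (\<integral>w. (cmod (w $ i))\<^sup>2 * h w \<partial>haar_state)"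
      by (simp add: mult.assoc)
  qed
  finally show ?thesis .
qed

lemma vinner_eigenbasis:
  assumes e: "orthonormal_basis e" and l: "\<And>i. A *v e i = complex_of_real (l i) *s e i" and A: "hermitian A"
  shows "vinner w (A *v w) = complex_of_real (\<Sum>i\<in>UNIV. l i * (cmod (vinner (e i) w))\<^sup>2)"
proof -
  have "vinner w (A *v w) = (\<Sum>i\<in>UNIV. vinner w (e i) * vinner (e i) (A *v w))"
    by (rule onb_parseval[OF e])
  also have "\<dots> = (\<Sum>i\<in>UNIV. complex_of_real (l i * (cmod (vinner (e i) w))\<^sup>2))"
  proof (intro sum.cong refl)
    fix i
    have "vinner w (e i) * vinner (e i) w = complex_of_real ((cmod (vinner (e i) w))\<^sup>2)"
      unfolding complex_norm_square cnj_vinner by (rule mult.commute)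
    then show "vinner w (e i) * vinner (e i) (A *v w) = complex_of_real (l i * (cmod (vinner (e i) w))\<^sup>2)"
      by (simp add: hermitian_vinner[OF A] l vinner_scale_left mult.left_commute)
  qed
  finally show ?thesis by simp
qed

context
  fixes A \<rho> :: "complex^'n^'n" and e :: "'n \<Rightarrow> complex^'n" and l r :: "'n \<Rightarrow> real"
  assumes A: "hermitian A" and e: "orthonormal_basis e" and l: "\<And>i. A *v e i = complex_of_real (l i) *s e i"
  defines "r i \<equiv> Re (vinner (e i) (\<rho> *v e i))"
begin

text \<open>One term for each permutation of the two slots: the identity gives the product of the
  traces of \<open>\<rho>\<close> and \<open>A\<close>, the swap gives the trace of their
  product.\<close>

lemma haar_second_moment:
  defines "d \<equiv> real CARD('n)"
  shows "(\<integral>w. Re (vinner w (\<rho> *v w)) * Re (vinner w (A *v w)) \<partial>haar_state)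
    = ((\<Sum>i\<in>UNIV. r i) * (\<Sum>i\<in>UNIV. l i) + (\<Sum>i\<in>UNIV. r i * l i)) / (d * (d + 1))"
proof -
  let ?h = "\<lambda>w. \<Sum>j\<in>UNIV. l j * (cmod (w $ j))\<^sup>2"
  have inner: "(\<integral>w. (cmod (w $ i))\<^sup>2 * ?h w \<partial>haar_state) = ((\<Sum>j\<in>UNIV. l j) + l i) / (d * (d + 1))" for i
  proof -
    have "(\<integral>w. (cmod (w $ i))\<^sup>2 * ?h w \<partial>haar_state) = (\<integral>w. (\<Sum>j\<in>UNIV. l j * ((cmod (w $ i))\<^sup>2 * (cmod (w $ j))\<^sup>2)) \<partial>haar_state)"
      by (simp add: sum_distrib_left mult_ac)
    also have "\<dots> = (\<Sum>j\<in>UNIV. \<integral>w. l j * ((cmod (w $ i))\<^sup>2 * (cmod (w $ j))\<^sup>2) \<partial>haar_state)"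
      by (intro Bochner_Integration.integral_sum integrable_haar_state continuous_intros)
    also have "\<dots> = (\<Sum>j\<in>UNIV. l j * (1 + kdelta i j)) / (d * (d + 1))"
      by (simp only: Bochner_Integration.integral_mult_right_zero haar_moment2_formula d_def
          times_divide_eq_right sum_divide_distrib)
    also have "(\<Sum>j\<in>UNIV. l j * (1 + kdelta i j)) = (\<Sum>j\<in>UNIV. l j) + l i"
      by (simp only: distrib_left sum.distrib mult.commute[of _ "kdelta _ _"] sum_kdelta mult_1_right)
    finally show ?thesis .
  qed
  have "(\<integral>w. Re (vinner w (\<rho> *v w)) * Re (vinner w (A *v w)) \<partial>haar_state)
    = (\<integral>w. Re (vinner w (\<rho> *v w)) * ?h (\<chi> i. vinner (e i) w) \<partial>haar_state)"
    by (simp add: vinner_eigenbasis[OF e l A])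
  also have "\<dots> = (\<Sum>i\<in>UNIV. r i * (\<integral>w. (cmod (w $ i))\<^sup>2 * ?h w \<partial>haar_state))"
    unfolding r_def
    by (rule haar_quadratic_form[OF e]) (auto intro!: continuous_intros sum.cong simp: phase_map_def)
  also have "\<dots> = (\<Sum>i\<in>UNIV. r i * (\<Sum>j\<in>UNIV. l j) + r i * l i) / (d * (d + 1))"
    unfolding inner by (simp add: sum_divide_distrib distrib_left)
  finally show ?thesis by (simp add: sum.distrib sum_distrib_right)
qed

text \<open>The six permutations of one \<open>\<rho>\<close> slot and two \<open>A\<close> slots,
  in the order of the numerator: the identity, the two transpositions that move the
  \<open>\<rho>\<close> slot, the transposition of the two \<open>A\<close> slots, and the two
  3-cycles.\<close>

lemma haar_third_moment:
  defines "d \<equiv> real CARD('n)"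
  shows "(\<integral>w. Re (vinner w (\<rho> *v w)) * (Re (vinner w (A *v w)))\<^sup>2 \<partial>haar_state)
    = ((\<Sum>i\<in>UNIV. r i) * (\<Sum>i\<in>UNIV. l i)\<^sup>2 + 2 * (\<Sum>i\<in>UNIV. r i * l i) * (\<Sum>i\<in>UNIV. l i)
       + (\<Sum>i\<in>UNIV. r i) * (\<Sum>i\<in>UNIV. (l i)\<^sup>2) + 2 * (\<Sum>i\<in>UNIV. r i * (l i)\<^sup>2)) / (d * (d + 1) * (d + 2))"
proof -
  let ?D = "d * (d + 1) * (d + 2)"
  let ?h = "\<lambda>w. (\<Sum>j\<in>UNIV. l j * (cmod (w $ j))\<^sup>2)\<^sup>2"
  have phase: "(\<Sum>j\<in>UNIV. l j * (cmod (phase_map i (-1) w $ j))\<^sup>2) = (\<Sum>j\<in>UNIV. l j * (cmod (w $ j))\<^sup>2)" for i w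
    by (intro sum.cong) (auto simp: phase_map_def)
  have inner: "(\<integral>w. (cmod (w $ i))\<^sup>2 * ?h w \<partial>haar_state)
     = (\<Sum>j\<in>UNIV. \<Sum>k\<in>UNIV. l j * l k * (1 + kdelta i j + kdelta j k + kdelta i k + 2 * (kdelta i j * kdelta j k))) / ?D" for i
  proof -
    have "(\<integral>w. (cmod (w $ i))\<^sup>2 * ?h w \<partial>haar_state)
       = (\<integral>w. (\<Sum>j\<in>UNIV. \<Sum>k\<in>UNIV. l j * l k * ((cmod (w $ i))\<^sup>2 * (cmod (w $ j))\<^sup>2 * (cmod (w $ k))\<^sup>2)) \<partial>haar_state)"
      unfolding power2_eq_square[of "sum _ _"] sum_product
      by (simp add: sum_distrib_left mult_ac)
    also have "\<dots> = (\<Sum>j\<in>UNIV. \<integral>w. (\<Sum>k\<in>UNIV. l j * l k * ((cmod (w $ i))\<^sup>2 * (cmod (w $ j))\<^sup>2 * (cmod (w $ k))\<^sup>2)) \<partial>haar_state)"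
      by (intro Bochner_Integration.integral_sum integrable_haar_state continuous_intros)
    also have "\<dots> = (\<Sum>j\<in>UNIV. \<Sum>k\<in>UNIV. \<integral>w. l j * l k * ((cmod (w $ i))\<^sup>2 * (cmod (w $ j))\<^sup>2 * (cmod (w $ k))\<^sup>2) \<partial>haar_state)"
      by (intro sum.cong refl Bochner_Integration.integral_sum integrable_haar_state continuous_intros)
    also have "\<dots> = (\<Sum>j\<in>UNIV. \<Sum>k\<in>UNIV. l j * l k * haar_moment i j k)"
      by (simp only: Bochner_Integration.integral_mult_right_zero haar_moment_def)
    finally show ?thesis by (simp add: haar_moment_formula d_def sum_divide_distrib)
  qed
  have collapse: "(\<Sum>j\<in>UNIV. \<Sum>k\<in>UNIV. l j * l k * (1 + kdelta i j + kdelta j k + kdelta i k + 2 * (kdelta i j * kdelta j k)))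
    = (\<Sum>j\<in>UNIV. l j)\<^sup>2 + 2 * l i * (\<Sum>j\<in>UNIV. l j) + (\<Sum>j\<in>UNIV. (l j)\<^sup>2) + 2 * (l i)\<^sup>2" for i
  proof -
    have expand: "x * (1 + a + b + c + 2 * (a * b)) = x + a * x + b * x + c * x + b * (2 * a * x)" for x a b c :: real
      by (simp add: algebra_simps)
    have "(\<Sum>k\<in>UNIV. l j * l k * (1 + kdelta i j + kdelta j k + kdelta i k + 2 * (kdelta i j * kdelta j k)))
      = l j * (\<Sum>k\<in>UNIV. l k) + kdelta i j * (l j * (\<Sum>k\<in>UNIV. l k)) + l j * l j + l j * l i + kdelta i j * (2 * (l j * l j))" for j
      by (simp only: expand sum.distrib sum_kdelta sum_distrib_left)
    then show ?thesis
      by (simp only: sum.distrib sum_kdelta sum_distrib_right[symmetric] power2_eq_square) (simp add: algebra_simps)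
  qed
  have "(\<integral>w. Re (vinner w (\<rho> *v w)) * (Re (vinner w (A *v w)))\<^sup>2 \<partial>haar_state)
    = (\<integral>w. Re (vinner w (\<rho> *v w)) * ?h (\<chi> i. vinner (e i) w) \<partial>haar_state)"
    by (simp add: vinner_eigenbasis[OF e l A])
  also have "\<dots> = (\<Sum>i\<in>UNIV. r i * (\<integral>w. (cmod (w $ i))\<^sup>2 * ?h w \<partial>haar_state))"
    unfolding r_def by (rule haar_quadratic_form[OF e]) (auto intro!: continuous_intros simp: phase)
  also have "\<dots> = (\<Sum>i\<in>UNIV. r i * (\<Sum>j\<in>UNIV. l j)\<^sup>2 + 2 * (r i * l i) * (\<Sum>j\<in>UNIV. l j) + r i * (\<Sum>j\<in>UNIV. (l j)\<^sup>2) + 2 * (r i * (l i)\<^sup>2)) / ?D"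
    unfolding inner collapse by (subst sum_divide_distrib, intro sum.cong refl) (simp add: algebra_simps)
  also have "(\<Sum>i\<in>UNIV. r i * (\<Sum>j\<in>UNIV. l j)\<^sup>2 + 2 * (r i * l i) * (\<Sum>j\<in>UNIV. l j) + r i * (\<Sum>j\<in>UNIV. (l j)\<^sup>2) + 2 * (r i * (l i)\<^sup>2))
    = (\<Sum>i\<in>UNIV. r i) * (\<Sum>i\<in>UNIV. l i)\<^sup>2 + 2 * (\<Sum>i\<in>UNIV. r i * l i) * (\<Sum>i\<in>UNIV. l i)
       + (\<Sum>i\<in>UNIV. r i) * (\<Sum>i\<in>UNIV. (l i)\<^sup>2) + 2 * (\<Sum>i\<in>UNIV. r i * (l i)\<^sup>2)"
    by (simp only: sum.distrib flip: sum_distrib_left sum_distrib_right)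
  finally show ?thesis .
qed

end

section \<open>The shadow circuit\<close>

lemma bxor_involutive [simp]: "bxor (bxor a x) x = a"
  by (auto simp: bxor_def)

lemma bxor_eq_iff: "a = bxor b c \<longleftrightarrow> c = bxor a b"
  by (auto simp: bxor_def fun_eq_iff)

lemma bxor_commute: "bxor a b = bxor b a"
  by (auto simp: bxor_def)

lemma bij_bxor: "bij (\<lambda>b. bxor b x)"
  by (intro o_bij[where g="\<lambda>b. bxor b x"]) auto

lemma sum_bxor: "(\<Sum>b\<in>UNIV. f (bxor b x)) = (\<Sum>b\<in>UNIV. f (b :: 'q::finite \<Rightarrow> bool))"
  using sum.reindex_bij_betw[OF bij_bxor] by blast

lemma sum_bxor': "(\<Sum>b\<in>UNIV. f (bxor x b)) = (\<Sum>b\<in>UNIV. f (b :: 'q::finite \<Rightarrow> bool))"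
  using sum_bxor[of f x] by (simp add: bxor_commute)

lemma sign_bdot:
  fixes z b :: "'q::finite \<Rightarrow> bool"
  shows "(-1 :: 'a::comm_ring_1) ^ bdot z b = (\<Prod>i\<in>UNIV. if z i \<and> b i then -1 else 1)"
  by (simp add: bdot_def prod.If_cases)

lemma sign_bdot_bxor:
  fixes z a b :: "'q::finite \<Rightarrow> bool"
  shows "(-1 :: 'a::comm_ring_1) ^ bdot z (bxor a b) = (-1) ^ bdot z a * (-1) ^ bdot z b"
  unfolding sign_bdot prod.distrib[symmetric] by (intro prod.cong) (auto simp: bxor_def)

lemma card_bits: "CARD('q::finite \<Rightarrow> bool) = 2 ^ CARD('q)"
  by (simp add: card_fun)

text \<open>The sum over \<open>z\<close> factors into one sum over a single bit for each position;
  a position where \<open>a\<close> and \<open>b\<close> differ contributes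
  \<open>1 - 1 = 0\<close>.\<close>

lemma character_orthogonality:
  fixes a b :: "'q::finite \<Rightarrow> bool"
  shows "(\<Sum>z\<in>UNIV. (-1) ^ bdot z a * (-1) ^ bdot z b) = (if a = b then 2 ^ CARD('q) else (0 :: complex))"
proof -
  define f :: "'q \<Rightarrow> bool \<Rightarrow> complex" where "f i t = (if t \<and> a i \<noteq> b i then -1 else 1)" for i t
  have "(\<Sum>z\<in>UNIV. (-1) ^ bdot z a * (-1) ^ bdot z b) = (\<Sum>z\<in>UNIV. \<Prod>i\<in>UNIV. f i (z i))"
    unfolding sign_bdot prod.distrib[symmetric] f_def by (intro sum.cong prod.cong) auto
  also have "\<dots> = (\<Prod>i\<in>UNIV. \<Sum>t\<in>UNIV. f i t)"
    using prod_sum_PiE[of "UNIV :: 'q set" "\<lambda>_. UNIV :: bool set" f] by (simp add: PiE_UNIV_domain)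
  also have "\<dots> = (\<Prod>i\<in>UNIV. if a i = b i then 2 else 0)"
    by (intro prod.cong) (auto simp: f_def UNIV_bool)
  also have "\<dots> = (if a = b then 2 ^ CARD('q) else 0)"
    by (auto simp: fun_eq_iff)
  finally show ?thesis .
qed

section \<open>Shadow vectors and the Pauli twirl\<close>

definition shadow_vector :: "complex ^ ('q::finite \<Rightarrow> bool) \<Rightarrow> ('q \<Rightarrow> bool) \<Rightarrow> ('q \<Rightarrow> bool) \<Rightarrow> complex ^ ('q \<Rightarrow> bool)" where
  "shadow_vector \<zeta> x z = vconj (zeta_xz \<zeta> x z)"

lemma zeta_xz_nth: "zeta_xz \<zeta> x z $ b = (-1) ^ bdot z (bxor b x) * \<zeta> $ bxor b x"
proof -
  have Z: "(pauli_Z z *v \<zeta>) $ c = (-1) ^ bdot z c * \<zeta> $ c" for c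
    by (simp add: pauli_Z_def matrix_vector_mult_def if_distrib if_distribR cong: if_cong)
  show ?thesis
    unfolding zeta_xz_def pauli_X_def matrix_vector_mult_def[of "\<chi> b c. if c = bxor b x then 1 else 0"]
    by (simp add: Z if_distrib if_distribR cong: if_cong)
qed

lemma shadow_vector_nth: "shadow_vector \<zeta> x z $ b = (-1) ^ bdot z (bxor b x) * cnj (\<zeta> $ bxor b x)"
  by (simp add: shadow_vector_def vconj_def zeta_xz_nth)

text \<open>The map is antilinear, hence linear over the reals only, which suffices for
  \<open>haar_integral_invariant\<close>.\<close>

lemma orthogonal_shadow_vector: "orthogonal_transformation (\<lambda>\<zeta>. shadow_vector \<zeta> x z)"
proof (intro orthogonal_transformationI linearI)
  fix v :: "complex^('a \<Rightarrow> bool)"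
  have "(\<Sum>b\<in>UNIV. (cmod (shadow_vector v x z $ b))\<^sup>2) = (\<Sum>b\<in>UNIV. (cmod (v $ bxor b x))\<^sup>2)"
    by (simp add: shadow_vector_nth norm_mult norm_power)
  then show "(\<Sum>b\<in>UNIV. (cmod (shadow_vector v x z $ b))\<^sup>2) = (\<Sum>b\<in>UNIV. (cmod (v $ b))\<^sup>2)"
    by (simp add: sum_bxor[of "\<lambda>b. (cmod (v $ b))\<^sup>2"])
qed (simp_all add: vec_eq_iff shadow_vector_nth algebra_simps scaleR_conv_of_real[where 'a=complex])

lemma norm_shadow_vector: "norm (shadow_vector \<zeta> x z) = norm \<zeta>"
  using orthogonal_shadow_vector[of x z] orthogonal_transformation_norm by blast

text \<open>This is \<open>P\<^sup>* M\<^sup>T P\<close> with \<open>P = X\<^sup>x Z\<^sup>z\<close>; the transpose is due to the complex conjugate in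
  \<^const>\<open>shadow_vector\<close>.\<close>

definition pulled_back :: "complex ^ ('q::finite \<Rightarrow> bool) ^ ('q \<Rightarrow> bool) \<Rightarrow> ('q \<Rightarrow> bool) \<Rightarrow> ('q \<Rightarrow> bool)
    \<Rightarrow> complex ^ ('q \<Rightarrow> bool) ^ ('q \<Rightarrow> bool)" where
  "pulled_back M x z = (\<chi> c b. (-1) ^ bdot z b * (-1) ^ bdot z c * M $ bxor b x $ bxor c x)"

text \<open>The two arguments change sides because \<open>shadow_vector\<close> is
  antilinear.\<close>

lemma vinner_pulled_back:
  "vinner u (pulled_back M x z *v v) = vinner (shadow_vector v x z) (M *v shadow_vector u x z)"
proof -
  let ?f = "\<lambda>b c. (-1) ^ bdot z b * v $ b * M $ bxor b x $ bxor c x * ((-1) ^ bdot z c * cnj (u $ c))"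
  have "vinner (shadow_vector v x z) (M *v shadow_vector u x z)
      = (\<Sum>b\<in>UNIV. \<Sum>c\<in>UNIV. ?f (bxor b x) (bxor c x))"
    by (simp add: vinner_def matrix_vector_mult_def shadow_vector_nth sum_distrib_left mult.assoc)
  also have "\<dots> = (\<Sum>b\<in>UNIV. \<Sum>c\<in>UNIV. ?f (bxor b x) c)"
    by (intro sum.cong refl sum_bxor)
  also have "\<dots> = (\<Sum>b\<in>UNIV. \<Sum>c\<in>UNIV. ?f b c)"
    by (rule sum_bxor)
  also have "\<dots> = (\<Sum>c\<in>UNIV. \<Sum>b\<in>UNIV. ?f b c)"
    by (rule sum.swap)
  also have "\<dots> = vinner u (pulled_back M x z *v v)"
    by (simp add: vinner_def matrix_vector_mult_def pulled_back_def sum_distrib_left mult_ac)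
  finally show ?thesis ..
qed

lemma psd_pulled_back: 
  assumes "psd M"
  shows "psd (pulled_back M x z)"
proof -
  have "cnj (M $ i $ j) = M $ j $ i" for i j
    using assms by (simp add: psd_def hermitian_def cadj_def vec_eq_iff)
  then have "hermitian (pulled_back M x z)"
    by (simp add: hermitian_def cadj_def pulled_back_def vec_eq_iff)
  then show ?thesis using assms by (simp add: psd_def vinner_pulled_back)
qed

text \<open>Pair the image with itself, move the pairing to \<open>M\<close> by
  \<open>vinner_pulled_back\<close>, and cancel one factor \<open>norm ?y\<close>.\<close>

lemma norm_pulled_back_le: "norm (pulled_back M x z *v v) \<le> op_norm M * norm v"
proof -
  let ?y = "pulled_back M x z *v v"
  have "(norm ?y)\<^sup>2 = cmod (vinner ?y (pulled_back M x z *v v))"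
    by (simp only: vinner_self norm_of_real) simp
  also have "\<dots> \<le> norm v * norm (M *v shadow_vector ?y x z)"
    unfolding vinner_pulled_back[of ?y] using vinner_Cauchy_Schwarz[of "shadow_vector v x z"] by (simp add: norm_shadow_vector)
  also have "\<dots> \<le> norm v * (op_norm M * norm ?y)"
    using norm_mult_vector_le_op_norm[of M "shadow_vector ?y x z"] by (intro mult_left_mono) (auto simp: norm_shadow_vector)
  finally have "norm ?y * norm ?y \<le> (op_norm M * norm v) * norm ?y"
    by (simp add: power2_eq_square mult_ac)
  then show ?thesis
    using op_norm_nonneg[of M] by (cases "norm ?y = 0") (auto simp: mult_le_cancel_right)
qed

text \<open>The sum over \<open>z\<close> is a character sum that leaves only the diagonal, with the
  factor \<open>2 ^ CARD('q)\<close>; on the diagonal, \<open>x\<close> runs through all diagonal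
  entries of \<open>M\<close> and yields the trace.\<close>

lemma sum_pulled_back:
  fixes M :: "complex ^ ('q::finite \<Rightarrow> bool) ^ ('q \<Rightarrow> bool)"
  shows "(\<Sum>(z, x)\<in>UNIV. pulled_back M x z) = mscale (2 ^ CARD('q) * trace M) (mat 1)"
proof -
  have "(\<Sum>(z, x)\<in>UNIV. pulled_back M x z) $ c $ b = (\<Sum>z\<in>UNIV. \<Sum>x\<in>UNIV. pulled_back M x z $ c $ b)" for c b
    by (simp add: sum_prod_UNIV)
  also have "\<dots> c b = (\<Sum>z\<in>UNIV. (-1) ^ bdot z b * (-1) ^ bdot z c) * (\<Sum>x\<in>UNIV. M $ bxor b x $ bxor c x)" for c b
    by (simp add: pulled_back_def sum_product)
  also have "\<dots> c b = (if b = c then 2 ^ CARD('q) * trace M else 0)" for c b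
    by (simp add: character_orthogonality trace_def sum_bxor'[of "\<lambda>x. M $ x $ x"])
  finally show ?thesis
    by (simp add: vec_eq_iff mscale_def mat_def)
qed

text \<open>The CNOT layer stores \<open>a xor b\<close> in the second register, so the outcome
  \<open>x\<close> forces \<open>b = a xor x\<close>; the Hadamard layer supplies the
  character.\<close>

lemma shadow_circuit_nth:
  "(shadow_circuit :: complex ^ (('q::finite \<Rightarrow> bool) \<times> ('q \<Rightarrow> bool)) ^ (('q \<Rightarrow> bool) \<times> ('q \<Rightarrow> bool))) $ (z, x) $ (a, b)
    = (if b = bxor a x then (-1) ^ bdot z a / complex_of_real (sqrt (2 ^ CARD('q))) else 0)"
proof -
  have "(shadow_circuit :: complex ^ (('q \<Rightarrow> bool) \<times> ('q \<Rightarrow> bool)) ^ (('q \<Rightarrow> bool) \<times> ('q \<Rightarrow> bool))) $ (z, x) $ (a, b)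
    = (\<Sum>a'\<in>UNIV. \<Sum>b'\<in>UNIV. if a' = a then if b' = x then if b' = bxor a b then hadamard_n $ z $ a' else 0 else 0 else 0)"
    unfolding shadow_circuit_def kron_def cnot_layer_def matrix_matrix_mult_def
    by (simp add: sum_prod_UNIV mat_def) (intro sum.cong refl, auto)
  also have "\<dots> = (\<Sum>a'\<in>UNIV. if a' = a then (\<Sum>b'\<in>UNIV. if b' = x then if b' = bxor a b then hadamard_n $ z $ a' else 0 else 0) else 0)"
    by (intro sum.cong) auto
  also have "\<dots> = (if x = bxor a b then hadamard_n $ z $ a else 0)"
    by simp
  finally show ?thesis
    using bxor_eq_iff[of x a b] by (simp add: hadamard_n_def bxor_commute[of x])
qed

text \<open>Contracting the row \<open>(z, x)\<close> of the circuit with \<open>\<zeta>\<close>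
  leaves, on the first register, the bra of \<open>shadow_vector \<zeta> x z\<close>, up to the
  normalisation and the sign \<open>(-1) ^ bdot z x\<close>. The sign occurs twice and
  cancels.\<close>

lemma born_prob_eq:
  fixes \<rho> :: "complex ^ ('q::finite \<Rightarrow> bool) ^ ('q \<Rightarrow> bool)"
  shows "born_prob \<rho> \<zeta> z x = Re (vinner (shadow_vector \<zeta> x z) (\<rho> *v shadow_vector \<zeta> x z)) / 2 ^ CARD('q)"
proof -
  let ?C = "shadow_circuit :: complex ^ (('q \<Rightarrow> bool) \<times> ('q \<Rightarrow> bool)) ^ (('q \<Rightarrow> bool) \<times> ('q \<Rightarrow> bool))"
  let ?s = "complex_of_real (sqrt (2 ^ CARD('q)))"
  define g where "g a = (-1) ^ bdot z a * \<zeta> $ bxor a x / ?s" for a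
  have C: "(\<Sum>p\<in>UNIV. ?C $ (z, x) $ p * f p) = (\<Sum>a\<in>UNIV. (-1) ^ bdot z a / ?s * f (a, bxor a x))" for f
    by (simp add: sum_prod_UNIV shadow_circuit_nth if_distrib if_distribR cong: if_cong)
  have C': "(\<Sum>p\<in>UNIV. f p * cnj (?C $ (z, x) $ p)) = (\<Sum>a\<in>UNIV. f (a, bxor a x) * ((-1) ^ bdot z a / ?s))" for f
    by (simp add: sum_prod_UNIV shadow_circuit_nth if_distrib if_distribR cong: if_cong)
  have sq: "?s * ?s = 2 ^ CARD('q)"
    by (simp flip: of_real_mult)
  have "(?C ** kron \<rho> (outer \<zeta> \<zeta>) ** cadj ?C) $ (z, x) $ (z, x)
    = (\<Sum>q\<in>UNIV. (\<Sum>p\<in>UNIV. ?C $ (z, x) $ p * kron \<rho> (outer \<zeta> \<zeta>) $ p $ q) * cnj (?C $ (z, x) $ q))"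
    by (simp add: matrix_matrix_mult_def cadj_def)
  also have "\<dots> = (\<Sum>a'\<in>UNIV. (\<Sum>a\<in>UNIV. (-1) ^ bdot z a / ?s * kron \<rho> (outer \<zeta> \<zeta>) $ (a, bxor a x) $ (a', bxor a' x)) * ((-1) ^ bdot z a' / ?s))"
    unfolding C C' ..
  also have "\<dots> = (\<Sum>a'\<in>UNIV. \<Sum>a\<in>UNIV. (-1) ^ bdot z a * \<zeta> $ bxor a x * \<rho> $ a $ a' * ((-1) ^ bdot z a' * cnj (\<zeta> $ bxor a' x))) / (?s * ?s)"
    by (simp add: kron_def outer_def sum_distrib_right sum_distrib_left sum_divide_distrib mult_ac)
  also have "\<dots> = (\<Sum>a\<in>UNIV. \<Sum>a'\<in>UNIV. (-1) ^ bdot z a * \<zeta> $ bxor a x * \<rho> $ a $ a' * ((-1) ^ bdot z a' * cnj (\<zeta> $ bxor a' x))) / (?s * ?s)"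
    by (subst sum.swap) rule
  also have "(\<Sum>a\<in>UNIV. \<Sum>a'\<in>UNIV. (-1) ^ bdot z a * \<zeta> $ bxor a x * \<rho> $ a $ a' * ((-1) ^ bdot z a' * cnj (\<zeta> $ bxor a' x)))
    = vinner (shadow_vector \<zeta> x z) (\<rho> *v shadow_vector \<zeta> x z)"
    unfolding vinner_def matrix_vector_mult_def sum_distrib_left vec_lambda_beta
  proof (intro sum.cong refl)
    fix a a' :: "'q \<Rightarrow> bool"
    have "((-1) ^ bdot z x * (-1) ^ bdot z x :: complex) = 1" by (simp flip: power_mult_distrib)
    then show "(-1) ^ bdot z a * \<zeta> $ bxor a x * \<rho> $ a $ a' * ((-1) ^ bdot z a' * cnj (\<zeta> $ bxor a' x))
      = cnj (shadow_vector \<zeta> x z $ a) * (\<rho> $ a $ a' * shadow_vector \<zeta> x z $ a')"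
      by (simp add: shadow_vector_nth sign_bdot_bxor mult.assoc mult.left_commute[of "(-1) ^ bdot z x"])
  qed
  finally show ?thesis
    unfolding born_prob_def sq using Re_divide_of_real[of _ "2 ^ CARD('q)"] by simp
qed

lemma trace_mscale: "trace (mscale c A) = c * trace A"
  by (simp add: trace_def mscale_def sum_distrib_left)

lemma shadow_estimate_eq:
  fixes Obs :: "complex ^ ('q::finite \<Rightarrow> bool) ^ ('q \<Rightarrow> bool)"
  shows "shadow_estimate Obs \<zeta> x z
    = (2 ^ CARD('q) + 1) * Re (vinner (shadow_vector \<zeta> x z) (Obs *v shadow_vector \<zeta> x z)) - Re (trace Obs)"
proof -
  let ?w = "shadow_vector \<zeta> x z"
  have "trace (Obs ** classical_shadow \<zeta> x z) = trace (classical_shadow \<zeta> x z ** Obs)"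
    by (rule trace_mul_sym)
  also have "classical_shadow \<zeta> x z ** Obs = mscale (2 ^ CARD('q) + 1) (outer ?w ?w ** Obs) - Obs"
    by (simp add: classical_shadow_def shadow_vector_def matrix_eq mscale_mult_vector matrix_vector_mult_diff_rdistrib
        flip: matrix_vector_mul_assoc)
  also have "trace \<dots> = (2 ^ CARD('q) + 1) * vinner ?w (Obs *v ?w) - trace Obs"
    by (simp add: trace_sub trace_mscale trace_outer_mult)
  also have "(2 ^ CARD('q) + 1 :: complex) = complex_of_real (2 ^ CARD('q) + 1)"
    by simp
  finally show ?thesis
    unfolding shadow_estimate_def by (simp only: minus_complex.sel times_complex.sel Re_complex_of_real Im_complex_of_real mult_zero_left diff_zero)
qed

section \<open>Moments of the estimator under an approximate design\<close>

lemma linear_bounded: "linear f \<Longrightarrow> bounded_linear f" for f :: "'a::euclidean_space \<Rightarrow> 'b::real_normed_vector"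
  by (simp add: linear_conv_bounded_linear)

lemma trace_mult_sum: "trace (A ** (\<Sum>i\<in>I. f i)) = (\<Sum>i\<in>I. trace (A ** f i))" for A :: "complex^'n^'m"
  by (induction I rule: infinite_finite_induct) (auto simp: matrix_add_ldistrib trace_add trace_def[of 0])

lemma continuous_on_tpow3: "continuous_on UNIV (tpow3 :: complex^'n \<Rightarrow> _)"
  unfolding tpow3_def kron_def outer_def by (intro continuous_intros)

text \<open>The real part of the trace against \<open>M\<close> is a bounded real-linear functional
  and passes through both integrals, so the difference is controlled by the trace of
  \<open>\<Delta> ** M\<close>, and duality applies.\<close>

lemma design_expectation_bound:
  fixes S :: "(complex^'n) measure"
  assumes S: "prob_space S" "sets S = sets borel" "AE \<zeta> in S. norm \<zeta> = 1" and design: "approx_state_3design \<epsilon> S"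
    and c: "\<And>v. norm v = 1 \<Longrightarrow> cmod (vinner v (M *v v)) \<le> c" "c \<ge> 0"
  shows "\<bar>(\<integral>\<zeta>. Re (trace (tpow3 \<zeta> ** M)) \<partial>S) - (\<integral>\<zeta>. Re (trace (tpow3 \<zeta> ** M)) \<partial>haar_state)\<bar> \<le> \<epsilon> * c"
proof -
  let ?H = "haar_state :: (complex^'n) measure"
  let ?L = "\<lambda>X. Re (trace (X ** M))"
  have int: "integrable S tpow3" "integrable ?H tpow3"
    using integrable_on_sphere[OF S continuous_on_tpow3] integrable_haar_state[OF continuous_on_tpow3] by auto
  have L: "bounded_linear ?L"
    by (intro linear_bounded linearI)
       (simp_all add: trace_def matrix_matrix_mult_def sum.distrib distrib_right scaleR_conv_of_real[where 'a=complex] sum_distrib_left mult.assoc)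
  \<comment> \<open>The adjoint is real-linear and thus commutes with the integral; this carries
    hermiticity from \<open>tpow3\<close> to \<open>\<Delta>\<close>.\<close>
  have A: "bounded_linear (cadj :: _ \<Rightarrow> complex^('n \<times> 'n \<times> 'n)^('n \<times> 'n \<times> 'n))"
    by (intro linear_bounded linearI) (simp_all add: cadj_def vec_eq_iff)
  define \<Delta> where "\<Delta> = (\<integral>\<phi>. tpow3 \<phi> \<partial>?H) - (\<integral>\<phi>. tpow3 \<phi> \<partial>S)"
  have "cadj (tpow3 \<phi>) = tpow3 \<phi>" for \<phi> :: "complex^'n"
    using hermitian_tpow3 by (simp add: hermitian_def)
  then have "cadj (\<integral>\<phi>. tpow3 \<phi> \<partial>N) = (\<integral>\<phi>. tpow3 \<phi> \<partial>N)" if "integrable N tpow3" for N :: "(complex^'n) measure"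
    unfolding integral_bounded_linear[OF A that, symmetric] by (simp only:)
  then have "hermitian \<Delta>"
    using linear_diff[OF bounded_linear.linear[OF A]] int by (simp add: hermitian_def \<Delta>_def)
  have "(\<integral>\<zeta>. ?L (tpow3 \<zeta>) \<partial>?H) - (\<integral>\<zeta>. ?L (tpow3 \<zeta>) \<partial>S) = ?L \<Delta>"
    unfolding \<Delta>_def linear_diff[OF bounded_linear.linear[OF L]] integral_bounded_linear[OF L int(1)] integral_bounded_linear[OF L int(2)] ..
  then have "\<bar>(\<integral>\<zeta>. ?L (tpow3 \<zeta>) \<partial>S) - (\<integral>\<zeta>. ?L (tpow3 \<zeta>) \<partial>?H)\<bar> \<le> cmod (trace (\<Delta> ** M))"
    using abs_Re_le_cmod[of "trace (\<Delta> ** M)"] by linarith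
  also have "\<dots> \<le> trace_norm \<Delta> * c"
    using \<open>hermitian \<Delta>\<close> c(1) by (rule trace_norm_duality)
  also have "\<dots> \<le> \<epsilon> * c"
    using design c(2) by (intro mult_right_mono) (simp_all add: approx_state_3design_def \<Delta>_def)
  finally show ?thesis .
qed

definition qform :: "complex^'n^'n \<Rightarrow> complex^'n \<Rightarrow> real" where
  "qform M w = Re (vinner w (M *v w))"

lemma qform_complex: "hermitian M \<Longrightarrow> vinner w (M *v w) = complex_of_real (qform M w)"
  unfolding qform_def by (rule hermitian_Reals)

lemma continuous_on_shadow_vector: "continuous_on X (\<lambda>\<zeta>. shadow_vector \<zeta> x z)"
  using orthogonal_shadow_vector[of x z]
  by (intro linear_continuous_on) (simp add: orthogonal_transformation_linear flip: linear_conv_bounded_linear)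

lemma continuous_on_qform [continuous_intros]:
  "continuous_on X f \<Longrightarrow> continuous_on X (\<lambda>\<zeta>. qform M (f \<zeta>))"
  unfolding qform_def by (intro continuous_intros)

lemma density_matrix_hermitian: "density_matrix \<rho> \<Longrightarrow> hermitian \<rho>"
  by (simp add: density_matrix_def psd_def)

definition shadow_sum :: "complex ^ ('q::finite \<Rightarrow> bool) ^ ('q \<Rightarrow> bool) \<Rightarrow> complex ^ ('q \<Rightarrow> bool) ^ ('q \<Rightarrow> bool)
    \<Rightarrow> nat \<Rightarrow> complex ^ ('q \<Rightarrow> bool) \<Rightarrow> real" where
  "shadow_sum Obs \<rho> k \<zeta> = (\<Sum>(z, x)\<in>UNIV. qform \<rho> (shadow_vector \<zeta> x z) * qform Obs (shadow_vector \<zeta> x z) ^ k)"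

text \<open>The moment \<open>E[f^k]\<close> for the unshifted estimate \<open>f\<close>, which is
  \<open>d + 1\<close> times the form of \<open>Obs\<close>. Keeping the \<open>1/d\<close> of the
  outcome probability outside leaves \<open>shadow_sum\<close> a plain polynomial in
  \<open>\<zeta>\<close> and its conjugate.\<close>

definition shadow_moment :: "complex ^ ('q::finite \<Rightarrow> bool) ^ ('q \<Rightarrow> bool) \<Rightarrow> complex ^ ('q \<Rightarrow> bool) ^ ('q \<Rightarrow> bool)
    \<Rightarrow> (complex ^ ('q \<Rightarrow> bool)) measure \<Rightarrow> nat \<Rightarrow> real" where
  "shadow_moment Obs \<rho> S k = (2 ^ CARD('q) + 1) ^ k / 2 ^ CARD('q) * (\<integral>\<zeta>. shadow_sum Obs \<rho> k \<zeta> \<partial>S)"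

lemma continuous_on_shadow_sum: "continuous_on X (shadow_sum Obs \<rho> k)"
  unfolding shadow_sum_def case_prod_beta by (intro continuous_intros continuous_on_shadow_vector)

text \<open>The Pauli twirl of a matrix of trace 1; it expresses that the outcome probabilities add
  up to \<open>norm \<zeta> ^ 2\<close>.\<close>

lemma shadow_sum_0:
  fixes \<zeta> :: "complex ^ ('q::finite \<Rightarrow> bool)"
  assumes \<rho>: "density_matrix \<rho>"
  shows "shadow_sum Obs \<rho> 0 \<zeta> = 2 ^ CARD('q) * (norm \<zeta>)\<^sup>2"
proof -
  have "complex_of_real (shadow_sum Obs \<rho> 0 \<zeta>) = vinner \<zeta> ((\<Sum>(z, x)\<in>UNIV. pulled_back \<rho> x z) *v \<zeta>)"
    by (simp add: shadow_sum_def case_prod_beta sum_matrix_vector vinner_sum_right vinner_pulled_back qform_complex density_matrix_hermitian \<rho>)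
  also have "\<dots> = complex_of_real (2 ^ CARD('q) * (norm \<zeta>)\<^sup>2)"
    using \<rho> by (simp add: sum_pulled_back density_matrix_def mscale_mult_vector vinner_scale_right vinner_self)
  finally show ?thesis by (simp only: of_real_eq_iff)
qed

text \<open>Both sums are values at \<open>tpow3 \<zeta>\<close> of one linear functional, given by
  \<open>M\<close>. What is left is to bound the form of \<open>M\<close>, where the
  \<open>\<rho>\<close> factors are summed by the twirl and only the \<open>Obs\<close> factors are
  estimated in norm.\<close>

lemma design_shadow_sum_bound:
  fixes Obs \<rho> :: "complex ^ ('q::finite \<Rightarrow> bool) ^ ('q \<Rightarrow> bool)"
  assumes Obs: "hermitian Obs" and \<rho>: "density_matrix \<rho>"
    and S: "prob_space S" "sets S = sets borel" "AE \<zeta> in S. norm \<zeta> = 1" and design: "approx_state_3design \<epsilon> S"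
    and k: "k \<in> {1, 2}"
  shows "\<bar>(\<integral>\<zeta>. shadow_sum Obs \<rho> k \<zeta> \<partial>S) - (\<integral>\<zeta>. shadow_sum Obs \<rho> k \<zeta> \<partial>haar_state)\<bar> \<le> \<epsilon> * (2 ^ CARD('q) * op_norm Obs ^ k)"
proof -
  \<comment> \<open>For \<open>k = 1\<close> the polynomial has degree two only. The identity as
    third factor contributes 1 on unit vectors, so the third-moment hypothesis serves this case
    too.\<close>
  define C where "C x z = (if k = 1 then mat 1 else pulled_back Obs x z)" for x z
  define M where "M = (\<Sum>(z, x)\<in>UNIV. kron (pulled_back \<rho> x z) (kron (pulled_back Obs x z) (C x z)))"
  have trace_M: "Re (trace (tpow3 \<zeta> ** M)) = shadow_sum Obs \<rho> k \<zeta>" if "norm \<zeta> = 1" for \<zeta>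
  proof -
    have "trace (tpow3 \<zeta> ** M) = (\<Sum>(z, x)\<in>UNIV. trace (tpow3 \<zeta> ** kron (pulled_back \<rho> x z) (kron (pulled_back Obs x z) (C x z))))"
      by (simp add: M_def case_prod_beta trace_mult_sum)
    also have "\<dots> = complex_of_real (shadow_sum Obs \<rho> k \<zeta>)"
      using k that
      by (auto simp: shadow_sum_def C_def trace_tpow3_mult vinner_pulled_back qform_complex density_matrix_hermitian Obs \<rho>
          vinner_self power2_eq_square intro!: sum.cong)
    finally show ?thesis by simp
  qed
  have psd: "psd \<rho>" and tr: "trace \<rho> = 1" using \<rho> by (auto simp: density_matrix_def)
  have C_norm: "norm (C x z *v v) \<le> op_norm Obs ^ (k - 1) * norm v" for x z v
    using k norm_pulled_back_le[of Obs x z v] by (auto simp: C_def)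
  have "norm (kron (pulled_back Obs x z) (C x z) *v v) \<le> op_norm Obs ^ k * norm v" for x z v
  proof -
    have "norm (kron (pulled_back Obs x z) (C x z) *v v) \<le> op_norm Obs * op_norm Obs ^ (k - 1) * norm v"
      by (intro norm_kron_le norm_pulled_back_le C_norm) (auto simp: op_norm_nonneg)
    then show ?thesis using k by (auto simp: power2_eq_square)
  qed
  then have bound: "cmod (vinner v (M *v v)) \<le> 2 ^ CARD('q) * op_norm Obs ^ k * (norm v)\<^sup>2" for v
    unfolding M_def case_prod_beta
    using sum_pulled_back[of \<rho>] op_norm_nonneg[of Obs] psd
    by (intro vinner_sum_kron_le psd_pulled_back) (auto simp: tr case_prod_beta)
  have eq: "(\<integral>\<zeta>. Re (trace (tpow3 \<zeta> ** M)) \<partial>N) = (\<integral>\<zeta>. shadow_sum Obs \<rho> k \<zeta> \<partial>N)"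
    if N: "prob_space N" "sets N = sets borel" "AE \<zeta> in N. norm \<zeta> = 1" for N
  proof (rule integral_cong_AE)
    show "AE \<zeta> in N. Re (trace (tpow3 \<zeta> ** M)) = shadow_sum Obs \<rho> k \<zeta>"
      using N(3) by eventually_elim (rule trace_M)
    show "(\<lambda>\<zeta>. Re (trace (tpow3 \<zeta> ** M))) \<in> borel_measurable N"
      unfolding tpow3_def kron_def outer_def trace_def matrix_matrix_mult_def
      by (intro borel_measurable_integrable integrable_on_sphere[OF N] continuous_intros)
    show "(\<lambda>\<zeta>. shadow_sum Obs \<rho> k \<zeta>) \<in> borel_measurable N"
      by (intro borel_measurable_integrable integrable_on_sphere[OF N] continuous_on_shadow_sum)
  qed
  have "\<bar>(\<integral>\<zeta>. Re (trace (tpow3 \<zeta> ** M)) \<partial>S) - (\<integral>\<zeta>. Re (trace (tpow3 \<zeta> ** M)) \<partial>haar_state)\<bar>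
      \<le> \<epsilon> * (2 ^ CARD('q) * op_norm Obs ^ k)"
  proof (rule design_expectation_bound[OF S design])
    show "cmod (vinner v (M *v v)) \<le> 2 ^ CARD('q) * op_norm Obs ^ k" if "norm v = 1" for v
      using bound[of v] that by simp
  qed (simp add: op_norm_nonneg)
  then show ?thesis
    by (simp only: eq[OF S] eq[OF prob_space_haar_state sets_haar_state AE_haar_state_norm])
qed

text \<open>For Haar random \<open>\<zeta>\<close> every shadow vector is again Haar distributed, so
  all \<open>d^2\<close> outcomes contribute the same integral.\<close>

lemma haar_shadow_sum:
  fixes Obs \<rho> :: "complex ^ ('q::finite \<Rightarrow> bool) ^ ('q \<Rightarrow> bool)"
  shows "(\<integral>\<zeta>. shadow_sum Obs \<rho> k \<zeta> \<partial>haar_state) = (2 ^ CARD('q))\<^sup>2 * (\<integral>w. qform \<rho> w * qform Obs w ^ k \<partial>haar_state)"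
proof -
  have "(\<integral>\<zeta>. shadow_sum Obs \<rho> k \<zeta> \<partial>haar_state)
    = (\<Sum>(z, x)\<in>UNIV. \<integral>\<zeta>. qform \<rho> (shadow_vector \<zeta> x z) * qform Obs (shadow_vector \<zeta> x z) ^ k \<partial>haar_state)"
    unfolding shadow_sum_def case_prod_beta
    by (intro Bochner_Integration.integral_sum integrable_haar_state continuous_intros
        continuous_on_shadow_vector)
  also have "\<dots> = (\<Sum>(z, x)\<in>(UNIV :: (('q \<Rightarrow> bool) \<times> ('q \<Rightarrow> bool)) set). \<integral>w. qform \<rho> w * qform Obs w ^ k \<partial>haar_state)"
    unfolding case_prod_beta
    by (intro sum.cong refl haar_integral_invariant[OF orthogonal_shadow_vector, of "\<lambda>w. qform \<rho> w * qform Obs w ^ k"]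
        continuous_intros)
  finally show ?thesis by (simp add: card_bits power2_eq_square)
qed

text \<open>Here \<open>T\<close>, \<open>t\<close>, \<open>s\<close>, \<open>r\<close> stand for
  the traces of \<open>O\<close>, \<open>O \<rho>\<close>, \<open>O^2\<close> and
  \<open>\<rho> O^2\<close>. After the shift by \<open>a = T / d\<close>, that is, in terms of the
  traceless part, the left side becomes
  \<open>(d + 1) / (d + 2) * (s0 + 2 * r0) - (t - a)^2\<close>, and \<open>r0 <= s0\<close>
  finishes.\<close>

lemma haar_variance_algebra:
  fixes d T t s r :: real
  assumes "d > 0" "r - 2 * t * (T / d) + (T / d)\<^sup>2 \<le> s - T\<^sup>2 / d" "0 \<le> s - T\<^sup>2 / d"
  shows "(d + 1) / (d + 2) * (T\<^sup>2 + 2 * t * T + s + 2 * r) - (T + t)\<^sup>2 \<le> 3 * (s - T\<^sup>2 / d)"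
proof -
  define a where "a = T / d"
  define s0 where "s0 = s - T\<^sup>2 / d"
  define r0 where "r0 = r - 2 * t * a + a\<^sup>2"
  have T: "T = a * d" using assms by (simp add: a_def)
  have s: "s = s0 + a\<^sup>2 * d" using assms by (simp add: s0_def T power2_eq_square)
  have r: "r = r0 + 2 * t * a - a\<^sup>2" by (simp add: r0_def)
  have "T\<^sup>2 + 2 * t * T + s + 2 * r = (d + 2) * (a\<^sup>2 * (d - 1) + 2 * t * a) + (s0 + 2 * r0)"
    unfolding s r T by (simp add: power2_eq_square algebra_simps)
  then have "(d + 1) / (d + 2) * (T\<^sup>2 + 2 * t * T + s + 2 * r)
    = (d + 1) / (d + 2) * (d + 2) * (a\<^sup>2 * (d - 1) + 2 * t * a) + (d + 1) / (d + 2) * (s0 + 2 * r0)"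
    by (simp only: distrib_left[of "(d + 1) / (d + 2)" "_ * _"] mult.assoc)
  also have "(d + 1) / (d + 2) * (d + 2) = d + 1" using assms by simp
  finally have "(d + 1) / (d + 2) * (T\<^sup>2 + 2 * t * T + s + 2 * r) - (T + t)\<^sup>2
    = (d + 1) / (d + 2) * (s0 + 2 * r0) - (t - a)\<^sup>2"
    unfolding T by (simp add: power2_eq_square algebra_simps)
  also have "\<dots> \<le> (d + 1) / (d + 2) * (s0 + 2 * r0)" by simp
  also have "\<dots> \<le> (d + 1) / (d + 2) * (3 * s0)"
    using assms by (intro mult_left_mono) (auto simp: s0_def r0_def a_def)
  also have "\<dots> \<le> 1 * (3 * s0)"
    using assms by (intro mult_right_mono) (auto simp: s0_def field_simps)
  finally show ?thesis by (simp add: s0_def)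
qed


context
  fixes Obs \<rho> :: "complex ^ ('q::finite \<Rightarrow> bool) ^ ('q \<Rightarrow> bool)" and S :: "(complex ^ ('q \<Rightarrow> bool)) measure" and \<epsilon> :: real
  assumes Obs: "hermitian Obs" and \<rho>: "density_matrix \<rho>"
    and S: "prob_space S" "sets S = sets borel" "AE \<zeta> in S. norm \<zeta> = 1" and design: "approx_state_3design \<epsilon> S"
begin

lemma shadow_moment_bounds:
  defines "d \<equiv> 2 ^ CARD('q)"
  shows "Im (trace (Obs ** \<rho>)) = 0"
    and "\<bar>shadow_moment Obs \<rho> S 1 - Re (trace Obs) - Re (trace (Obs ** \<rho>))\<bar> \<le> (d + 1) * \<epsilon> * op_norm Obs"
    and "shadow_moment Obs \<rho> S 2 - (shadow_moment Obs \<rho> S 1)\<^sup>2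
      \<le> 3 * Re (trace (traceless_part Obs ** traceless_part Obs)) + 3 * \<epsilon> * (op_norm Obs)\<^sup>2 * (d + 1)\<^sup>2"
proof -
  have d: "d > 0" "real CARD('q \<Rightarrow> bool) = d" by (simp_all add: d_def card_bits)
  have psd: "psd \<rho>" and tr: "trace \<rho> = 1" using \<rho> by (auto simp: density_matrix_def)
  obtain e l where e: "orthonormal_basis e" and l: "\<And>i. Obs *v e i = complex_of_real (l i) *s e i"
    using hermitian_diagonalizable[OF Obs] by blast
  define r where "r i = Re (vinner (e i) (\<rho> *v e i))" for i
  have r_complex: "vinner (e i) (\<rho> *v e i) = complex_of_real (r i)" for i
    using psd hermitian_Reals unfolding r_def psd_def by blast
  have r_nonneg: "0 \<le> r i" for i using psd by (simp add: psd_def r_def)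
  have "complex_of_real (\<Sum>i\<in>UNIV. r i) = 1"
    using onb_trace[OF e, of \<rho>] tr by (simp add: r_complex)
  then have r_sum: "(\<Sum>i\<in>UNIV. r i) = 1" by (metis of_real_eq_1_iff)
  have r_le: "r i \<le> 1" for i
    using member_le_sum[of i UNIV r] r_nonneg r_sum by simp
  define T where "T = (\<Sum>i\<in>UNIV. l i)"
  define t where "t = (\<Sum>i\<in>UNIV. r i * l i)"
  define s where "s = (\<Sum>i\<in>UNIV. (l i)\<^sup>2)"
  define u where "u = (\<Sum>i\<in>UNIV. r i * (l i)\<^sup>2)"
  have trace_Obs: "trace Obs = complex_of_real T"
    by (simp add: onb_trace[OF e] l vinner_scale_right onb_inner[OF e] T_def)
  have trace_Obs_\<rho>: "trace (Obs ** \<rho>) = complex_of_real t"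
    by (simp add: onb_trace[OF e] hermitian_vinner[OF Obs] l vinner_scale_left r_complex t_def mult.commute
        flip: matrix_vector_mul_assoc)
  then show "Im (trace (Obs ** \<rho>)) = 0" by simp
  have "traceless_part Obs *v e i = complex_of_real (l i - T / d) *s e i" for i
    using d by (simp add: traceless_part_def trace_Obs matrix_vector_mult_diff_rdistrib mscale_mult_vector l
        vec_eq_iff algebra_simps card_bits d_def)
  then have trace_sq': "Re (trace (traceless_part Obs ** traceless_part Obs)) = (\<Sum>i\<in>UNIV. (l i - T / d)\<^sup>2)"
    by (simp add: onb_trace[OF e] matrix_vector_cscale vinner_scale_right onb_inner[OF e] power2_eq_square
        flip: matrix_vector_mul_assoc of_real_diff of_real_divide)
  have sum_sq: "(\<Sum>i\<in>UNIV. (l i - T / d)\<^sup>2) = s - T\<^sup>2 / d"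
  proof -
    have "(\<Sum>i\<in>UNIV. (l i - a)\<^sup>2) = s + d * a\<^sup>2 - 2 * T * a" for a
      by (simp add: power2_diff sum_subtractf sum.distrib s_def T_def d(2) flip: sum_distrib_left sum_distrib_right)
    from this[of "T / d"] show ?thesis using d by (simp add: power2_eq_square)
  qed
  have trace_sq: "Re (trace (traceless_part Obs ** traceless_part Obs)) = s - T\<^sup>2 / d"
    using trace_sq' sum_sq by (rule trans)
  have s0_nonneg: "0 \<le> s - T\<^sup>2 / d"
    unfolding sum_sq[symmetric] by (simp add: sum_nonneg)
  have "(\<Sum>i\<in>UNIV. r i * (l i - a)\<^sup>2) = u - 2 * t * a + a\<^sup>2" for a
  proof -
    have "r i * (l i - a)\<^sup>2 = r i * (l i)\<^sup>2 - 2 * (r i * l i) * a + r i * a\<^sup>2" for i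
      by (simp add: power2_diff algebra_simps)
    then have "(\<Sum>i\<in>UNIV. r i * (l i - a)\<^sup>2) = u - 2 * t * a + (\<Sum>i\<in>UNIV. r i) * a\<^sup>2"
      by (simp only: sum_subtractf sum.distrib u_def t_def flip: sum_distrib_left sum_distrib_right)
    then show ?thesis by (simp add: r_sum)
  qed
  note this[of "T / d"]
  \<comment> \<open>The weights \<open>r i\<close> form a probability vector, so each is at most 1:
    the trace of \<open>\<rho>\<close> times the squared traceless part is at most the trace of that
    square.\<close>
  moreover have "(\<Sum>i\<in>UNIV. r i * (l i - T / d)\<^sup>2) \<le> (\<Sum>i\<in>UNIV. (l i - T / d)\<^sup>2)"
    using r_le by (intro sum_mono mult_left_le_one_le r_nonneg) auto
  ultimately have r0: "u - 2 * t * (T / d) + (T / d)\<^sup>2 \<le> s - T\<^sup>2 / d"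
    unfolding sum_sq by simp
  have l_le: "\<bar>l i\<bar> \<le> op_norm Obs" for i
    using norm_mult_vector_le_op_norm[of Obs "e i"] by (simp add: l norm_cscale onb_norm[OF e])
  have T_le: "\<bar>T\<bar> \<le> d * op_norm Obs"
    unfolding T_def using sum_norm_le[of UNIV l "\<lambda>_. op_norm Obs"] l_le d(2) by simp
  have t_le: "\<bar>t\<bar> \<le> op_norm Obs"
  proof -
    have "\<bar>t\<bar> \<le> (\<Sum>i\<in>UNIV. r i * op_norm Obs)"
      unfolding t_def using l_le r_nonneg
      by (intro order.trans[OF sum_abs] sum_mono) (auto simp: abs_mult intro!: mult_mono)
    then show ?thesis by (simp add: r_sum flip: sum_distrib_right)
  qed
  let ?H = "haar_state :: (complex ^ ('q \<Rightarrow> bool)) measure"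
  define h1 where "h1 = (\<integral>\<zeta>. shadow_sum Obs \<rho> 1 \<zeta> \<partial>?H)"
  define h2 where "h2 = (\<integral>\<zeta>. shadow_sum Obs \<rho> 2 \<zeta> \<partial>?H)"
  have h1: "(d + 1) / d * h1 = T + t"
    using haar_second_moment[OF Obs e l, of \<rho>] d
    by (simp del: One_nat_def add: h1_def haar_shadow_sum qform_def power2_eq_square
       flip: r_def T_def t_def d_def) (simp add: r_sum)
  have h2: "(d + 1)\<^sup>2 / d * h2 = (d + 1) / (d + 2) * (T\<^sup>2 + 2 * t * T + s + 2 * u)"
    using haar_third_moment[OF Obs e l, of \<rho>] d
    by (simp add: h2_def haar_shadow_sum qform_def power2_eq_square[of d] power2_eq_square[of "d + 1"]
       flip: r_def T_def t_def d_def s_def u_def) (simp add: r_sum)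
  define s1 where "s1 = (\<integral>\<zeta>. shadow_sum Obs \<rho> 1 \<zeta> \<partial>S)"
  define s2 where "s2 = (\<integral>\<zeta>. shadow_sum Obs \<rho> 2 \<zeta> \<partial>S)"
  have m1: "shadow_moment Obs \<rho> S 1 = (d + 1) / d * s1" and m2: "shadow_moment Obs \<rho> S 2 = (d + 1)\<^sup>2 / d * s2"
    by (simp_all add: shadow_moment_def d_def s1_def s2_def)
  have "\<bar>s1 - h1\<bar> \<le> \<epsilon> * (d * op_norm Obs)" and s2: "\<bar>s2 - h2\<bar> \<le> \<epsilon> * (d * (op_norm Obs)\<^sup>2)"
    using design_shadow_sum_bound[OF Obs \<rho> S design, of 1] design_shadow_sum_bound[OF Obs \<rho> S design, of 2]
    by (simp_all add: s1_def s2_def h1_def h2_def d_def)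
  then have "(d + 1) / d * \<bar>s1 - h1\<bar> \<le> (d + 1) / d * (\<epsilon> * (d * op_norm Obs))"
    using d by (intro mult_left_mono) auto
  moreover have "(d + 1) / d * \<bar>s1 - h1\<bar> = \<bar>shadow_moment Obs \<rho> S 1 - (T + t)\<bar>"
  proof -
    have "(d + 1) / d * \<bar>s1 - h1\<bar> = \<bar>(d + 1) / d * (s1 - h1)\<bar>" using d by (simp add: abs_mult)
    then show ?thesis by (simp only: right_diff_distrib m1 h1)
  qed
  ultimately have mean: "\<bar>shadow_moment Obs \<rho> S 1 - (T + t)\<bar> \<le> (d + 1) * \<epsilon> * op_norm Obs"
    using d by simp
  then show "\<bar>shadow_moment Obs \<rho> S 1 - Re (trace Obs) - Re (trace (Obs ** \<rho>))\<bar> \<le> (d + 1) * \<epsilon> * op_norm Obs"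
    by (simp add: trace_Obs trace_Obs_\<rho> algebra_simps)
  have "(d + 1)\<^sup>2 / d * (s2 - h2) \<le> (d + 1)\<^sup>2 / d * (\<epsilon> * (d * (op_norm Obs)\<^sup>2))"
    using s2 d by (intro mult_left_mono) auto
  then have 2: "shadow_moment Obs \<rho> S 2 \<le> (d + 1) / (d + 2) * (T\<^sup>2 + 2 * t * T + s + 2 * u) + \<epsilon> * (op_norm Obs)\<^sup>2 * (d + 1)\<^sup>2"
    unfolding right_diff_distrib m2[symmetric] h2 using d by (simp add: mult_ac)
  define \<eta> where "\<eta> = shadow_moment Obs \<rho> S 1 - (T + t)"
  have "\<bar>T + t\<bar> \<le> (d + 1) * op_norm Obs" using T_le t_le by (simp add: algebra_simps)
  then have "\<bar>T + t\<bar> * \<bar>\<eta>\<bar> \<le> (d + 1) * op_norm Obs * ((d + 1) * \<epsilon> * op_norm Obs)"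
    using mean d op_norm_nonneg[of Obs] unfolding \<eta>_def by (intro mult_mono) auto
  then have "- ((T + t) * \<eta>) \<le> \<epsilon> * (op_norm Obs)\<^sup>2 * (d + 1)\<^sup>2"
    using abs_ge_minus_self[of "(T + t) * \<eta>"] by (simp add: abs_mult power2_eq_square mult_ac)
  moreover have "(shadow_moment Obs \<rho> S 1)\<^sup>2 = (T + t)\<^sup>2 + 2 * ((T + t) * \<eta>) + \<eta>\<^sup>2"
    by (simp add: \<eta>_def power2_eq_square algebra_simps)
  \<comment> \<open>The term in \<open>\<eta>\<close> squared is nonnegative and dropped. The linear
    term costs two of the three error units; the second moment accounts for the third.\<close>
  ultimately have 1: "(shadow_moment Obs \<rho> S 1)\<^sup>2 \<ge> (T + t)\<^sup>2 - 2 * (\<epsilon> * (op_norm Obs)\<^sup>2 * (d + 1)\<^sup>2)"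
    using zero_le_power2[of \<eta>] by linarith
  show "shadow_moment Obs \<rho> S 2 - (shadow_moment Obs \<rho> S 1)\<^sup>2
      \<le> 3 * Re (trace (traceless_part Obs ** traceless_part Obs)) + 3 * \<epsilon> * (op_norm Obs)\<^sup>2 * (d + 1)\<^sup>2"
    using haar_variance_algebra[OF d(1) r0 s0_nonneg] 1 2 unfolding trace_sq by linarith
qed

end

section \<open>Median of means\<close>

lemma card_sort_nth: "card {i. i < length xs \<and> P (sort xs ! i)} = card {i. i < length xs \<and> P (xs ! i)}"
proof -
  have *: "card {i. i < length ys \<and> P (ys ! i)} = size (filter_mset P (mset ys))" for ys
    by (simp add: length_filter_conv_card[symmetric] flip: mset_filter)
  show ?thesis using *[of "sort xs"] *[of xs] by simp
qed

text \<open>Turns an order statistic into a count; counts are finite sums of indicators and hence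
  measurable.\<close>

lemma sort_nth_le_iff:
  assumes "j < length xs"
  shows "sort xs ! j \<le> c \<longleftrightarrow> j < card {i. i < length xs \<and> xs ! i \<le> c}"
proof -
  let ?C = "{i. i < length xs \<and> sort xs ! i \<le> c}"
  have mono: "sort xs ! i \<le> sort xs ! i'" if "i \<le> i'" "i' < length xs" for i i'
    using that by (intro sorted_nth_mono) auto
  show ?thesis unfolding card_sort_nth[of xs "\<lambda>x. x \<le> c", symmetric]
  proof
    assume "sort xs ! j \<le> c"
    then have "{..j} \<subseteq> ?C" using mono[of _ j] assms by fastforce
    then show "j < card ?C" using card_mono[of ?C "{..j}"] by simp
  next
    assume "j < card ?C"
    then have "\<not> ?C \<subseteq> {..<j}" using card_mono[of "{..<j}" ?C] by auto
    then obtain i where "i \<in> ?C" "i \<notin> {..<j}" by blast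
    then show "sort xs ! j \<le> c" using mono[of j i] by auto
  qed
qed

lemma borel_measurable_median:
  fixes X :: "nat \<Rightarrow> 'a \<Rightarrow> real"
  assumes X: "\<And>k. k < K \<Longrightarrow> X k \<in> borel_measurable M" and "K > 0"
  shows "(\<lambda>\<omega>. median (map (\<lambda>k. X k \<omega>) [0..<K])) \<in> borel_measurable M"
proof -
  have nth: "(\<lambda>\<omega>. sort (map (\<lambda>k. X k \<omega>) [0..<K]) ! j) \<in> borel_measurable M" if "j < K" for j
    unfolding borel_measurable_iff_le
  proof
    fix c
    have "sort (map (\<lambda>k. X k \<omega>) [0..<K]) ! j \<le> c \<longleftrightarrow> real j < (\<Sum>k<K. indicator {..c} (X k \<omega>))" for \<omega>
    proof -
      have "{i. i < K \<and> map (\<lambda>k. X k \<omega>) [0..<K] ! i \<le> c} = {k. k < K \<and> X k \<omega> \<le> c}"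
        by auto
      then have "sort (map (\<lambda>k. X k \<omega>) [0..<K]) ! j \<le> c \<longleftrightarrow> j < card {k. k < K \<and> X k \<omega> \<le> c}"
        using sort_nth_le_iff[of j "map (\<lambda>k. X k \<omega>) [0..<K]" c] that by simp
      also have "\<dots> \<longleftrightarrow> real j < real (card {k. k < K \<and> X k \<omega> \<le> c})"
        by simp
      also have "real (card {k. k < K \<and> X k \<omega> \<le> c}) = (\<Sum>k<K. indicator {..c} (X k \<omega>))"
        by (simp add: indicator_def sum.If_cases Int_def)
      finally show ?thesis .
    qed
    moreover have "(\<lambda>\<omega>. indicator {..c} (X k \<omega>) :: real) \<in> borel_measurable M" if "k < K" for k
      by (rule measurable_compose[OF X[OF that]]) simp
    then have "{\<omega> \<in> space M. real j < (\<Sum>k<K. indicator {..c} (X k \<omega>))} \<in> sets M"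
      by (intro borel_measurable_less borel_measurable_const borel_measurable_sum) simp
    ultimately show "{\<omega> \<in> space M. sort (map (\<lambda>k. X k \<omega>) [0..<K]) ! j \<le> c} \<in> sets M"
      by (simp only:)
  qed
  show ?thesis
    unfolding median_def Let_def using \<open>K > 0\<close>
    by (cases "odd K") (auto intro!: borel_measurable_divide borel_measurable_add nth)
qed

text \<open>Position \<open>k div 2\<close> holds the median, or for even length the larger of the
  two averaged entries. It exceeds \<open>c\<close> in either case, and so does everything sorted
  after it.\<close>

lemma median_gt_half:
  assumes "xs \<noteq> []" "median xs > c"
  shows "length xs \<le> 2 * card {i. i < length xs \<and> xs ! i > c}"
proof -
  define s where "s = sort xs"
  define k where "k = length xs"
  have len: "length s = k" and srt: "sorted s" by (simp_all add: s_def k_def)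
  have k: "k > 0" using assms by (simp add: k_def)
  have gt: "s ! (k div 2) > c"
  proof (cases "odd k")
    case True
    then show ?thesis using assms by (simp add: median_def Let_def s_def k_def)
  next
    case False
    then have "s ! (k div 2 - 1) \<le> s ! (k div 2)"
      using k len srt by (intro sorted_nth_mono) auto
    moreover have "(s ! (k div 2 - 1) + s ! (k div 2)) / 2 > c"
      using False assms by (simp add: median_def Let_def s_def k_def)
    ultimately show ?thesis by simp
  qed
  have "{k div 2..<k} \<subseteq> {i. i < k \<and> s ! i > c}"
  proof
    fix i assume "i \<in> {k div 2..<k}"
    then have "s ! (k div 2) \<le> s ! i" "i < k" using srt len by (auto intro: sorted_nth_mono)
    then show "i \<in> {i. i < k \<and> s ! i > c}" using gt by simp
  qed
  then have "k - k div 2 \<le> card {i. i < k \<and> s ! i > c}"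
    using card_mono[of "{i. i < k \<and> s ! i > c}" "{k div 2..<k}"] by simp
  also have "\<dots> = card {i. i < k \<and> xs ! i > c}"
    unfolding s_def k_def by (rule card_sort_nth)
  finally show ?thesis
    by (simp add: k_def)
qed

lemma median_less_half:
  assumes "xs \<noteq> []" "median xs < c"
  shows "length xs \<le> 2 * card {i. i < length xs \<and> xs ! i < c}"
proof -
  define s where "s = sort xs"
  define k where "k = length xs"
  have len: "length s = k" and srt: "sorted s" by (simp_all add: s_def k_def)
  have k: "k > 0" using assms by (simp add: k_def)
  \<comment> \<open>The lower middle position: the middle for odd \<open>k\<close>, and
    \<open>k div 2 - 1\<close> for even \<open>k\<close>, where the smaller of the two averaged
    entries must lie below \<open>c\<close>.\<close>
  define j where "j = (k - 1) div 2"
  have lt: "s ! j < c"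
  proof (cases "odd k")
    case True
    then have "j = k div 2" unfolding j_def by presburger
    then show ?thesis using assms True by (simp add: median_def Let_def s_def k_def)
  next
    case False
    then have j: "j = k div 2 - 1" unfolding j_def using k by presburger
    have "s ! (k div 2 - 1) \<le> s ! (k div 2)"
      using k len srt by (intro sorted_nth_mono) auto
    moreover have "(s ! (k div 2 - 1) + s ! (k div 2)) / 2 < c"
      using False assms by (simp add: median_def Let_def s_def k_def)
    ultimately show ?thesis by (simp add: j)
  qed
  have "j < k" unfolding j_def using k by simp
  have "{..j} \<subseteq> {i. i < k \<and> s ! i < c}"
  proof
    fix i assume "i \<in> {..j}"
    then have "i \<le> j" by simp
    then have "s ! i \<le> s ! j" using srt len \<open>j < k\<close> by (intro sorted_nth_mono) auto
    then show "i \<in> {i. i < k \<and> s ! i < c}" using lt \<open>j < k\<close> \<open>i \<le> j\<close> by auto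
  qed
  then have "j + 1 \<le> card {i. i < k \<and> s ! i < c}"
    using card_mono[of "{i. i < k \<and> s ! i < c}" "{..j}"] by simp
  also have "\<dots> = card {i. i < k \<and> xs ! i < c}"
    unfolding s_def k_def by (rule card_sort_nth)
  finally have "j + 1 \<le> card {i. i < length xs \<and> xs ! i < c}"
    by (simp add: k_def)
  moreover have "k \<le> 2 * (j + 1)" unfolding j_def by presburger
  ultimately show ?thesis unfolding k_def by (meson le_trans mult_le_mono2)
qed

lemma median_deviation:
  fixes m \<gamma> :: real
  assumes "xs \<noteq> []" "\<bar>median xs - m\<bar> > \<gamma>"
  shows "length xs \<le> 2 * card {i. i < length xs \<and> \<bar>xs ! i - m\<bar> > \<gamma>}"
proof -
  have mono: "card {i. i < length xs \<and> P (xs ! i)} \<le> card {i. i < length xs \<and> \<bar>xs ! i - m\<bar> > \<gamma>}"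
    if "\<And>x. P x \<Longrightarrow> \<bar>x - m\<bar> > \<gamma>" for P
    using that by (intro card_mono) auto
  from assms(2) consider "median xs > m + \<gamma>" | "median xs < m - \<gamma>" by linarith
  then show ?thesis
  proof cases
    case 1
    show ?thesis using median_gt_half[OF assms(1) 1] mono[of "\<lambda>x. x > m + \<gamma>"] by linarith
  next
    case 2
    show ?thesis using median_less_half[OF assms(1) 2] mono[of "\<lambda>x. x < m - \<gamma>"] by linarith
  qed
qed

section \<open>Independent sums and concentration\<close>

lemma (in prob_space) variance_sum_indep:
  fixes X :: "'i \<Rightarrow> 'a \<Rightarrow> real"
  assumes "finite I" and ind: "indep_vars (\<lambda>_. borel) X I"
    and sq: "\<And>i. i \<in> I \<Longrightarrow> integrable M (\<lambda>x. (X i x)\<^sup>2)"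
    and mean: "\<And>i. i \<in> I \<Longrightarrow> expectation (X i) = 0"
  shows "integrable M (\<lambda>x. (\<Sum>i\<in>I. X i x)\<^sup>2)"
    and "expectation (\<lambda>x. (\<Sum>i\<in>I. X i x)\<^sup>2) = (\<Sum>i\<in>I. expectation (\<lambda>x. (X i x)\<^sup>2))"
proof -
  have [measurable]: "random_variable borel (X i)" if "i \<in> I" for i
    using ind that by (auto simp: indep_vars_def)
  have int: "integrable M (X i)" if "i \<in> I" for i
    using square_integrable_imp_integrable[OF _ sq[OF that]] that by simp
  have pair: "integrable M (\<lambda>x. X i x * X j x)" 
    "expectation (\<lambda>x. X i x * X j x) = (if i = j then expectation (\<lambda>x. (X i x)\<^sup>2) else 0)"
    if "i \<in> I" "j \<in> I" for i j
  proof -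
    \<comment> \<open>Pairwise independence is read off the rule for a product over the singleton
      \<open>{j}\<close>.\<close>
    have *: "indep_var borel (X i) borel (X j)" if "i \<noteq> j"
      using indep_vars_prod[of "{j}" i X] indep_vars_subset[OF ind, of "{i, j}"] \<open>i \<in> I\<close> \<open>j \<in> I\<close> that
      by simp
    show "integrable M (\<lambda>x. X i x * X j x)"
    proof (cases "i = j")
      case True
      then show ?thesis using sq[OF that(1)] by (simp add: power2_eq_square)
    next
      case False
      then show ?thesis using indep_var_integrable[OF *] int that by simp
    qed
    show "expectation (\<lambda>x. X i x * X j x) = (if i = j then expectation (\<lambda>x. (X i x)\<^sup>2) else 0)"
    proof (cases "i = j")
      case True
      then show ?thesis by (simp add: power2_eq_square)
    next
      case False
      then show ?thesis using indep_var_lebesgue_integral[OF *] int that mean by simp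
    qed
  qed
  show "integrable M (\<lambda>x. (\<Sum>i\<in>I. X i x)\<^sup>2)"
    unfolding power2_eq_square sum_product using pair by (intro Bochner_Integration.integrable_sum) auto
  have "expectation (\<lambda>x. (\<Sum>i\<in>I. X i x)\<^sup>2) = (\<Sum>i\<in>I. \<Sum>j\<in>I. expectation (\<lambda>x. X i x * X j x))"
    unfolding power2_eq_square sum_product using pair by (subst Bochner_Integration.integral_sum; simp)+
  also have "\<dots> = (\<Sum>i\<in>I. \<Sum>j\<in>I. if i = j then expectation (\<lambda>x. (X i x)\<^sup>2) else 0)"
    using pair by (intro sum.cong refl) auto
  finally show "expectation (\<lambda>x. (\<Sum>i\<in>I. X i x)\<^sup>2) = (\<Sum>i\<in>I. expectation (\<lambda>x. (X i x)\<^sup>2))"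
    using \<open>finite I\<close> by (simp add: sum.delta)
qed

text \<open>The joint law of all coordinates is the product measure itself, which is the criterion
  for independence in terms of distributions.\<close>

lemma indep_vars_PiM_coordinate:
  assumes "\<And>i. i \<in> I \<Longrightarrow> prob_space (D i)" "I \<noteq> {}"
  shows "prob_space.indep_vars (PiM I D) D (\<lambda>i \<omega>. \<omega> i) I"
proof -
  interpret prob_space "PiM I D" by (intro prob_space_PiM assms)
  have "distr (PiM I D) (PiM I D) (\<lambda>x. \<lambda>i\<in>I. x i) = distr (PiM I D) (PiM I D) (\<lambda>x. x)"
    by (intro distr_cong) (auto simp: space_PiM PiE_def extensional_restrict)
  also have "\<dots> = PiM I (\<lambda>i. distr (PiM I D) (D i) (\<lambda>\<omega>. \<omega> i))"
    by (simp add: distr_id, intro PiM_cong refl) (simp add: distr_PiM_component assms)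
  finally show ?thesis
    using assms(2) by (subst indep_vars_iff_distr_eq_PiM') auto
qed

lemma median_of_means_concentration:
  fixes D :: "real measure" and V \<gamma> \<delta> m :: real
  assumes D: "prob_space D" "sets D = sets borel"
    and sq: "integrable D (\<lambda>x. x\<^sup>2)"
    and m: "m = (\<integral>x. x \<partial>D)" and V: "(\<integral>x. x\<^sup>2 \<partial>D) - m\<^sup>2 \<le> V"
    and "0 < \<gamma>" "0 < \<delta>" "\<delta> < 1"
    and K: "real K \<ge> 2 * ln (2 / \<delta>)" and L: "L > 0" "real L \<ge> 34 / \<gamma>\<^sup>2 * V"
  shows "measure (PiM ({..<K} \<times> {..<L}) (\<lambda>_. D))
    {\<omega> \<in> space (PiM ({..<K} \<times> {..<L}) (\<lambda>_. D)). \<bar>median_of_means L K \<omega> - m\<bar> > \<gamma>} \<le> \<delta>"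
proof -
  define I where "I = {..<K} \<times> {..<L}"
  define P where "P = PiM I (\<lambda>_. D)"
  have "ln (2 / \<delta>) > 0" using assms by simp
  then have "K > 0" using K by (cases K) auto
  interpret D: prob_space D by fact
  have id_meas: "(\<lambda>x. x) \<in> borel_measurable D" using D(2) by (rule measurable_ident_sets)
  interpret P: prob_space P unfolding P_def by (intro prob_space_PiM D)
  have "I \<noteq> {}" using \<open>K > 0\<close> \<open>L > 0\<close> by (auto simp: I_def)
  have coord: "(\<lambda>\<omega>. \<omega> i) \<in> borel_measurable (PiM J (\<lambda>_. D))" if "i \<in> J" for i :: "nat \<times> nat" and J
    using measurable_component_singleton[OF that, of "\<lambda>_. D"]
    unfolding measurable_cong_sets[OF refl D(2), of "PiM J (\<lambda>_. D)"] .
  have meas[measurable]: "(\<lambda>\<omega>. \<omega> i) \<in> borel_measurable P" if "i \<in> I" for i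
    unfolding P_def using that by (rule coord)
  have ind: "P.indep_vars (\<lambda>_. D) (\<lambda>i \<omega>. \<omega> i) I"
    unfolding P_def using \<open>I \<noteq> {}\<close> D by (intro indep_vars_PiM_coordinate) auto
  have distr: "distr P D (\<lambda>\<omega>. \<omega> i) = D" if "i \<in> I" for i
    unfolding P_def using that D by (intro distr_PiM_component) auto
  have int: "integrable D (\<lambda>x. x)"
    using id_meas sq by (rule D.square_integrable_imp_integrable)
  have sqm: "integrable D (\<lambda>x. (x - m)\<^sup>2)"
    using sq int by (simp add: power2_diff)
  have var: "(\<integral>x. (x - m)\<^sup>2 \<partial>D) \<le> V"
    using V D.variance_eq[OF int sq] by (simp add: m)
  have sqP: "integrable P (\<lambda>\<omega>. (\<omega> i - m)\<^sup>2)" "P.expectation (\<lambda>\<omega>. (\<omega> i - m)\<^sup>2) \<le> V"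
    "P.expectation (\<lambda>\<omega>. \<omega> i - m) = 0"
    if "i \<in> I" for i
  proof -
    have *: "(\<lambda>\<omega>. \<omega> i) \<in> P \<rightarrow>\<^sub>M D" unfolding P_def using that by simp
    show "integrable P (\<lambda>\<omega>. (\<omega> i - m)\<^sup>2)"
      using integrable_distr[OF *, of "\<lambda>x. (x - m)\<^sup>2"] sqm distr[OF that] by simp
    show "P.expectation (\<lambda>\<omega>. (\<omega> i - m)\<^sup>2) \<le> V"
      using integral_distr[OF * borel_measurable_integrable[OF sqm]] var distr[OF that] by simp
    have "P.expectation (\<lambda>\<omega>. \<omega> i - m) = (\<integral>x. x - m \<partial>D)"
      using integral_distr[OF * borel_measurable_diff[OF id_meas borel_measurable_const], of m] distr[OF that] by simp
    then show "P.expectation (\<lambda>\<omega>. \<omega> i - m) = 0"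
      using int by (simp add: m D.prob_space)
  qed
  define B where "B k = {\<omega> \<in> space P. \<bar>(\<Sum>l<L. \<omega> (k, l)) / real L - m\<bar> > \<gamma>}" for k
  have B_sets: "B k \<in> P.events" if "k < K" for k
  proof -
    have "(k, l) \<in> I" if "l < L" for l using that \<open>k < K\<close> by (auto simp: I_def)
    then show ?thesis unfolding B_def by measurable
  qed
  \<comment> \<open>Chebyshev for row \<open>k\<close>: the centred sum has second moment at most
    \<open>L * V\<close>, compared with \<open>(L * \<gamma>)^2\<close>. The hypothesis on
    \<open>L\<close> makes the quotient at most 1/34.\<close>
  have B_prob: "P.prob (B k) \<le> 1 / 34" if k: "k < K" for k
  proof -
    define J where "J = {k} \<times> {..<L}"
    define X where "X i \<omega> = \<omega> i - m" for i and \<omega> :: "nat \<times> nat \<Rightarrow> real"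
    have J: "J \<subseteq> I" "finite J" "card J = L" using k by (auto simp: I_def J_def card_cartesian_product)
    have sum_J: "(\<Sum>i\<in>J. f i) = (\<Sum>l<L. f (k, l))" for f :: "nat \<times> nat \<Rightarrow> real"
      unfolding J_def using sum.cartesian_product[of "\<lambda>x y. f (x, y)" "{..<L}" "{k}"] by simp
    have indX: "P.indep_vars (\<lambda>_. borel) X J"
      unfolding X_def by (rule P.indep_vars_compose2[OF P.indep_vars_subset[OF ind J(1)], where Y="\<lambda>_ x. x - m"])
        (intro borel_measurable_diff id_meas borel_measurable_const)
    have XP: "integrable P (\<lambda>\<omega>. (X i \<omega>)\<^sup>2)" "P.expectation (\<lambda>\<omega>. (X i \<omega>)\<^sup>2) \<le> V" "P.expectation (X i) = 0"
      if "i \<in> J" for i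
      using sqP[of i] J that by (auto simp: X_def[abs_def])
    note var_sum = P.variance_sum_indep[OF J(2) indX XP(1,3)]
    have "B k \<subseteq> {\<omega> \<in> space P. (\<Sum>i\<in>J. X i \<omega>)\<^sup>2 \<ge> (real L * \<gamma>)\<^sup>2}"
    proof
      fix \<omega> assume "\<omega> \<in> B k"
      then have w: "\<omega> \<in> space P" "\<bar>(\<Sum>l<L. \<omega> (k, l)) / real L - m\<bar> > \<gamma>" by (auto simp: B_def)
      have "(\<Sum>i\<in>J. X i \<omega>) = real L * ((\<Sum>l<L. \<omega> (k, l)) / real L - m)"
        using \<open>L > 0\<close> by (simp add: X_def sum_J sum_subtractf J(3) field_simps)
      then have "\<bar>\<Sum>i\<in>J. X i \<omega>\<bar> \<ge> real L * \<gamma>"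
        using w \<open>L > 0\<close> by (simp add: abs_mult)
      then have "(real L * \<gamma>)\<^sup>2 \<le> \<bar>\<Sum>i\<in>J. X i \<omega>\<bar>\<^sup>2"
        using \<open>0 < \<gamma>\<close> by (intro power_mono) auto
      then show "\<omega> \<in> {\<omega> \<in> space P. (\<Sum>i\<in>J. X i \<omega>)\<^sup>2 \<ge> (real L * \<gamma>)\<^sup>2}" using w by simp
    qed
    then have "P.prob (B k) \<le> P.prob {\<omega> \<in> space P. (\<Sum>i\<in>J. X i \<omega>)\<^sup>2 \<ge> (real L * \<gamma>)\<^sup>2}"
      using var_sum(1) by (intro P.finite_measure_mono) auto
    also have "\<dots> \<le> P.expectation (\<lambda>\<omega>. (\<Sum>i\<in>J. X i \<omega>)\<^sup>2) / (real L * \<gamma>)\<^sup>2"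
      using var_sum(1) \<open>0 < \<gamma>\<close> \<open>L > 0\<close> by (intro integral_Markov_inequality_measure[where A="{}"]) auto
    also have "P.expectation (\<lambda>\<omega>. (\<Sum>i\<in>J. X i \<omega>)\<^sup>2) \<le> real L * V"
      using sum_mono[of J "\<lambda>i. P.expectation (\<lambda>\<omega>. (X i \<omega>)\<^sup>2)" "\<lambda>_. V"] XP(2) var_sum(2) J(3) by simp
    also have "real L * V / (real L * \<gamma>)\<^sup>2 = (34 / \<gamma>\<^sup>2 * V) / (34 * real L)"
      using \<open>L > 0\<close> \<open>0 < \<gamma>\<close> by (simp add: power2_eq_square field_simps)
    also have "\<dots> \<le> real L / (34 * real L)"
      using L by (intro divide_right_mono) auto
    finally show ?thesis using \<open>L > 0\<close> by (simp add: divide_right_mono)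
  qed
  \<comment> \<open>Distinct means read disjoint rows of the index set, so they inherit independence
    from the coordinates.\<close>
  have "P.indep_vars (\<lambda>k. PiM ({k} \<times> {..<L}) (\<lambda>_. D)) (\<lambda>k \<omega>. \<lambda>i\<in>{k} \<times> {..<L}. \<omega> i) {..<K}"
    using ind by (rule P.indep_vars_restrict) (auto simp: I_def disjoint_family_on_def)
  then have "P.indep_vars (\<lambda>_. borel)
      (\<lambda>k \<omega>. (\<Sum>l<L. (\<lambda>i\<in>{k} \<times> {..<L}. \<omega> i) (k, l)) / real L) {..<K}"
    by (rule P.indep_vars_compose2[where Y="\<lambda>k \<omega>. (\<Sum>l<L. \<omega> (k, l)) / real L"]) 
       (auto intro!: borel_measurable_divide borel_measurable_sum coord)
  then have "P.indep_vars (\<lambda>_. borel) (\<lambda>k \<omega>. (\<Sum>l<L. \<omega> (k, l)) / real L) {..<K}"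
    by (simp add: restrict_def)
  then have "P.indep_events B {..<K}"
    unfolding B_def by (rule P.indep_eventsI_indep_vars) auto
  then have B_inter: "P.prob (\<Inter>k\<in>T. B k) \<le> (1 / 34) ^ card T" if "T \<subseteq> {..<K}" "T \<noteq> {}" for T
  proof -
    have "P.prob (\<Inter>k\<in>T. B k) = (\<Prod>k\<in>T. P.prob (B k))"
      using \<open>P.indep_events B {..<K}\<close> that finite_subset[OF that(1)]
      unfolding P.indep_events_def by blast
    also have "\<dots> \<le> (\<Prod>k\<in>T. 1 / 34)"
      using that B_prob by (intro prod_mono) auto
    finally show ?thesis by simp
  qed
  \<comment> \<open>The possible sets of at least half of the means. A failing median forces all
    means of some set in \<open>F\<close> to fail, and a union bound over at most
    \<open>2 ^ K\<close> sets stands in for a Chernoff estimate.\<close>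
  define F where "F = {T. T \<subseteq> {..<K} \<and> K \<le> 2 * card T}"
  have finF: "finite F" unfolding F_def by simp
  have F_ne: "T \<noteq> {}" if "T \<in> F" for T using that \<open>K > 0\<close> by (auto simp: F_def)
  have "{\<omega> \<in> space P. \<bar>median_of_means L K \<omega> - m\<bar> > \<gamma>} \<subseteq> (\<Union>T\<in>F. \<Inter>k\<in>T. B k)"
  proof
    fix \<omega> assume "\<omega> \<in> {\<omega> \<in> space P. \<bar>median_of_means L K \<omega> - m\<bar> > \<gamma>}"
    then have w: "\<omega> \<in> space P" "\<bar>median_of_means L K \<omega> - m\<bar> > \<gamma>" by auto
    define xs where "xs = map (\<lambda>k. (\<Sum>l<L. \<omega> (k, l)) / real L) [0..<K]"
    define T where "T = {k. k < K \<and> \<bar>xs ! k - m\<bar> > \<gamma>}"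
    have "length xs \<le> 2 * card {i. i < length xs \<and> \<bar>xs ! i - m\<bar> > \<gamma>}"
      using w \<open>K > 0\<close> by (intro median_deviation) (auto simp: xs_def median_of_means_def)
    then have "T \<in> F" unfolding F_def T_def by (auto simp: xs_def)
    moreover have "\<omega> \<in> (\<Inter>k\<in>T. B k)"
      using w by (auto simp: T_def B_def xs_def)
    ultimately show "\<omega> \<in> (\<Union>T\<in>F. \<Inter>k\<in>T. B k)" by blast
  qed
  moreover have inter_sets: "(\<Inter>k\<in>T. B k) \<in> P.events" if "T \<in> F" for T
    using that F_ne[OF that] B_sets finite_subset[of T "{..<K}"] unfolding F_def
    by (intro sets.finite_INT) auto
  ultimately have "P.prob {\<omega> \<in> space P. \<bar>median_of_means L K \<omega> - m\<bar> > \<gamma>} \<le> P.prob (\<Union>T\<in>F. \<Inter>k\<in>T. B k)"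
    using finF by (intro P.finite_measure_mono) auto
  also have "\<dots> \<le> (\<Sum>T\<in>F. P.prob (\<Inter>k\<in>T. B k))"
    using finF inter_sets by (intro P.finite_measure_subadditive_finite) auto
  also have "\<dots> \<le> (\<Sum>T\<in>F. sqrt (1 / 34) ^ K)"
  proof (rule sum_mono)
    fix T assume T: "T \<in> F"
    have "P.prob (\<Inter>k\<in>T. B k) \<le> (1 / 34) ^ card T"
      using T F_ne by (intro B_inter) (auto simp: F_def)
    also have "\<dots> = sqrt (1 / 34) ^ (2 * card T)"
      by (simp add: power_mult)
    also have "\<dots> \<le> sqrt (1 / 34) ^ K"
      using T by (intro power_decreasing) (auto simp: F_def)
    finally show "P.prob (\<Inter>k\<in>T. B k) \<le> sqrt (1 / 34) ^ K" .
  qed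
  also have "\<dots> = real (card F) * sqrt (1 / 34) ^ K" by simp
  also have "\<dots> \<le> 2 ^ K * sqrt (1 / 34) ^ K"
  proof -
    have "card F \<le> card (Pow {..<K})" unfolding F_def by (intro card_mono) auto
    then have "real (card F) \<le> real (2 ^ K)" by (simp only: card_Pow finite_lessThan card_lessThan of_nat_le_iff)
    then show ?thesis by (intro mult_right_mono) auto
  qed
  also have "\<dots> = sqrt (2 / 17) ^ K"
  proof -
    have "2 * sqrt (1 / 34) = sqrt (2 / 17 :: real)"
      by (intro real_sqrt_unique[symmetric]) (auto simp: power_mult_distrib)
    then show ?thesis by (simp flip: power_mult_distrib)
  qed
  \<comment> \<open>From \<open>exp 1 <= 3\<close> follows
    \<open>2 / 17 <= 1 / 3 <= exp (- 1)\<close>. With the hypothesis on \<open>K\<close>, the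
    \<open>K\<close> factors \<open>exp (- 1 / 2)\<close> give at most
    \<open>\<delta> / 2\<close>.\<close>
  also have "\<dots> \<le> exp (- 1 / 2) ^ K"
  proof (intro power_mono real_le_lsqrt)
    have "2 / 17 \<le> exp (- 1 :: real)"
      using exp_le by (simp add: exp_minus field_simps)
    also have "\<dots> = (exp (- 1 / 2))\<^sup>2" by (simp flip: exp_double)
    finally show "2 / 17 \<le> (exp (- 1 / 2 :: real))\<^sup>2" .
  qed auto
  also have "\<dots> = exp (- (real K / 2))"
    by (simp flip: exp_of_nat_mult)
  also have "\<dots> \<le> exp (- ln (2 / \<delta>))"
    using K by simp
  also have "\<dots> = \<delta> / 2"
    using \<open>0 < \<delta>\<close> by (simp add: exp_minus)
  also have "\<dots> \<le> \<delta>" using \<open>0 < \<delta>\<close> by simp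
  finally show ?thesis by (simp add: P_def I_def)
qed

section \<open>The distribution of a single estimate\<close>

text \<open>Outside \<open>G\<close> the kernel leaves the space of sub-probability measures, so it is not measurable
  there; the push-forward in the definition of \<open>bind\<close> nevertheless only sees the part over \<open>G\<close>.\<close>

lemma bind_modify_kernel:
  assumes G: "G \<in> sets M" "AE x in M. x \<in> G" and sets_f: "\<And>x. sets (f x) = sets N"
    and bad: "\<And>x. x \<notin> G \<Longrightarrow> \<not> subprob_space (f x)"
    and f': "f' \<in> M \<rightarrow>\<^sub>M subprob_algebra N" and eq: "\<And>x. x \<in> G \<Longrightarrow> f' x = f x"
  shows "M \<bind> f = M \<bind> f'"
proof (cases "space M = {}")
  case False
  let ?K = "subprob_algebra N"
  \<comment> \<open>The definition of bind takes its target sigma-algebra from the kernel at an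
    arbitrarily chosen point; the choice is immaterial since all \<open>f x\<close> have the same
    sets.\<close>
  have emb: "subprob_algebra (f x) = ?K" for x
    by (rule subprob_algebra_cong) (rule sets_f)
  have "distr M ?K f = distr M ?K f'"
    unfolding distr_def
  proof (rule measure_of_eq[OF sets.space_closed])
    fix A assume "A \<in> sigma_sets (space ?K) (sets ?K)"
    then have A: "A \<in> sets ?K" by (simp add: sets.sigma_sets_eq)
    then have "A \<subseteq> space ?K" by (rule sets.sets_into_space)
    then have *: "f -` A \<inter> space M = (f' -` A \<inter> space M) \<inter> G"
      using bad eq sets.sets_into_space[OF G(1)] by (auto simp: space_subprob_algebra subset_iff) metis+
    have "f' -` A \<inter> space M \<in> sets M" using f' A by (rule measurable_sets)
    then show "emeasure M (f -` A \<inter> space M) = emeasure M (f' -` A \<inter> space M)"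
      unfolding * using G by (intro emeasure_eq_AE) auto
  qed
  then show ?thesis
    using bind_nonempty[OF False, of f] bind_nonempty''[OF f' False] by (simp add: emb)
qed (simp add: bind_empty)

context
  fixes Obs \<rho> :: "complex ^ ('q::finite \<Rightarrow> bool) ^ ('q \<Rightarrow> bool)" and S :: "(complex ^ ('q \<Rightarrow> bool)) measure"
  assumes Obs: "hermitian Obs" and \<rho>: "density_matrix \<rho>"
    and S: "prob_space S" "sets S = sets borel" "AE \<zeta> in S. norm \<zeta> = 1"
begin

definition outcome_kernel :: "complex ^ ('q \<Rightarrow> bool) \<Rightarrow> real measure" where
  "outcome_kernel \<zeta> = distr (density (count_space UNIV) (\<lambda>(z, x). ennreal (born_prob \<rho> \<zeta> z x)))
     borel (\<lambda>(z, x). shadow_estimate Obs \<zeta> x z)"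

text \<open>The cut is made at the ball and not at the sphere: the outcome kernel has mass
  \<open>norm \<zeta> ^ 2\<close>, so outside the ball, and only there, it fails to be a
  sub-probability measure, as \<open>bind_modify_kernel\<close> demands. The value
  \<open>return borel 0\<close> is an arbitrary measurable filler.\<close>

definition subprob_kernel :: "complex ^ ('q \<Rightarrow> bool) \<Rightarrow> real measure" where
  "subprob_kernel \<zeta> = (if \<zeta> \<in> cball 0 1 then outcome_kernel \<zeta> else return borel 0)"

lemma born_prob_qform: "born_prob \<rho> \<zeta> z x = qform \<rho> (shadow_vector \<zeta> x z) / 2 ^ CARD('q)"
  by (simp add: born_prob_eq qform_def)

lemma shadow_estimate_qform:
  "shadow_estimate Obs \<zeta> x z = (2 ^ CARD('q) + 1) * qform Obs (shadow_vector \<zeta> x z) - Re (trace Obs)"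
  by (simp add: shadow_estimate_eq qform_def)

lemma born_prob_nonneg: "0 \<le> born_prob \<rho> \<zeta> z x"
  using \<rho> by (simp add: born_prob_eq density_matrix_def psd_def)

lemma continuous_on_born_prob: "continuous_on X (\<lambda>\<zeta>. born_prob \<rho> \<zeta> z x)"
  unfolding born_prob_qform by (intro continuous_intros continuous_on_shadow_vector) simp

lemma continuous_on_shadow_estimate: "continuous_on X (\<lambda>\<zeta>. shadow_estimate Obs \<zeta> x z)"
  unfolding shadow_estimate_qform by (intro continuous_intros continuous_on_shadow_vector)

lemma sum_born_prob: "(\<Sum>(z, x)\<in>UNIV. born_prob \<rho> \<zeta> z x) = (norm \<zeta>)\<^sup>2"
  using shadow_sum_0[OF \<rho>, where \<zeta>=\<zeta>]
  by (simp add: shadow_sum_def born_prob_qform case_prod_beta flip: sum_divide_distrib)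

lemma nn_integral_outcome_kernel:
  assumes [measurable]: "g \<in> borel_measurable borel"
  shows "(\<integral>\<^sup>+y. g y \<partial>outcome_kernel \<zeta>) = (\<Sum>(z, x)\<in>UNIV. ennreal (born_prob \<rho> \<zeta> z x) * g (shadow_estimate Obs \<zeta> x z))"
  by (simp add: outcome_kernel_def nn_integral_distr nn_integral_density nn_integral_count_space_finite case_prod_beta)

lemma sets_outcome_kernel: "sets (outcome_kernel \<zeta>) = sets borel"
  by (simp add: outcome_kernel_def)

lemma emeasure_outcome_kernel:
  "A \<in> sets borel \<Longrightarrow> emeasure (outcome_kernel \<zeta>) A
     = (\<Sum>(z, x)\<in>UNIV. ennreal (born_prob \<rho> \<zeta> z x) * indicator A (shadow_estimate Obs \<zeta> x z))"
  using nn_integral_outcome_kernel[of "indicator A" \<zeta>] by (simp add: sets_outcome_kernel nn_integral_indicator)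

lemma emeasure_outcome_kernel_UNIV: "emeasure (outcome_kernel \<zeta>) UNIV = ennreal ((norm \<zeta>)\<^sup>2)"
  by (simp add: emeasure_outcome_kernel case_prod_beta sum_ennreal born_prob_nonneg flip: sum_born_prob)

lemma space_outcome_kernel: "space (outcome_kernel \<zeta>) = UNIV"
  by (simp add: outcome_kernel_def)

lemma subprob_outcome_kernel_iff: "subprob_space (outcome_kernel \<zeta>) \<longleftrightarrow> \<zeta> \<in> cball 0 1"
proof -
  have "ennreal ((norm \<zeta>)\<^sup>2) \<le> 1 \<longleftrightarrow> norm \<zeta> \<le> 1"
    using abs_square_le_1[of "norm \<zeta>"] by (simp flip: ennreal_1)
  then show ?thesis
    by (auto simp: emeasure_outcome_kernel_UNIV space_outcome_kernel dest: subprob_space.emeasure_space_le_1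
        intro!: subprob_spaceI)
qed

lemma prob_outcome_kernel: "norm \<zeta> = 1 \<Longrightarrow> prob_space (outcome_kernel \<zeta>)"
  by (intro prob_spaceI) (simp add: emeasure_outcome_kernel_UNIV space_outcome_kernel)

lemma subprob_kernel_measurable: "subprob_kernel \<in> S \<rightarrow>\<^sub>M subprob_algebra borel"
proof (rule measurable_subprob_algebra)
  fix A :: "real set" assume A: "A \<in> sets borel"
  have [measurable]: "(\<lambda>\<zeta>. born_prob \<rho> \<zeta> z x) \<in> borel_measurable borel"
    "(\<lambda>\<zeta>. shadow_estimate Obs \<zeta> x z) \<in> borel_measurable borel" for z x
    by (intro borel_measurable_continuous_onI continuous_on_born_prob continuous_on_shadow_estimate)+
  have "(\<lambda>\<zeta>. emeasure (subprob_kernel \<zeta>) A) = (\<lambda>\<zeta>. if norm \<zeta> \<le> 1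
    then \<Sum>p\<in>UNIV. ennreal (born_prob \<rho> \<zeta> (fst p) (snd p)) * indicator A (shadow_estimate Obs \<zeta> (snd p) (fst p))
    else indicator A 0)"
    using A by (auto simp: subprob_kernel_def emeasure_outcome_kernel case_prod_beta)
  also have "\<dots> \<in> borel_measurable borel"
    using A by measurable
  finally show "(\<lambda>\<zeta>. emeasure (subprob_kernel \<zeta>) A) \<in> borel_measurable S"
    by (simp add: measurable_cong_sets[OF S(2) refl])
next
  show "subprob_space (subprob_kernel \<zeta>)" for \<zeta>
    using subprob_outcome_kernel_iff[of \<zeta>] by (simp add: subprob_kernel_def prob_space_return prob_space_imp_subprob_space)
qed (simp add: subprob_kernel_def sets_outcome_kernel)

lemma estimate_distr_bind: "estimate_distr Obs \<rho> S = S \<bind> subprob_kernel"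
proof -
  have "AE \<zeta> in S. \<zeta> \<in> cball 0 1" using S(3) by eventually_elim simp
  then have "S \<bind> outcome_kernel = S \<bind> subprob_kernel"
    using subprob_outcome_kernel_iff
    by (intro bind_modify_kernel[where G="cball 0 1" and N=borel] subprob_kernel_measurable)
       (auto simp: S(2) sets_outcome_kernel subprob_kernel_def)
  then show ?thesis by (simp add: estimate_distr_def outcome_kernel_def[abs_def])
qed

lemma AE_subprob_kernel: "AE \<zeta> in S. norm \<zeta> = 1 \<and> subprob_kernel \<zeta> = outcome_kernel \<zeta> \<and> prob_space (subprob_kernel \<zeta>)"
  using S(3) by eventually_elim (simp add: subprob_kernel_def prob_outcome_kernel)

lemma sets_estimate_distr: "sets (estimate_distr Obs \<rho> S) = sets borel"
  unfolding estimate_distr_bind using prob_space.not_empty[OF S(1)]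
  by (intro sets_bind) (auto simp: sets_kernel[OF subprob_kernel_measurable])

lemma prob_space_estimate_distr: "prob_space (estimate_distr Obs \<rho> S)"
  unfolding estimate_distr_bind using AE_subprob_kernel
  by (intro prob_space.prob_space_bind[OF S(1) _ subprob_kernel_measurable]) (auto elim: eventually_mono)

text \<open>All estimates from unit vectors lie in one bounded interval, which provides the moments
  and the truncation used below.\<close>

definition estimate_bound :: real where
  "estimate_bound = (2 ^ CARD('q) + 1) * op_norm Obs + \<bar>Re (trace Obs)\<bar>"

lemma shadow_estimate_bounded:
  assumes "norm \<zeta> = 1"
  shows "\<bar>shadow_estimate Obs \<zeta> x z\<bar> \<le> estimate_bound"
proof -
  let ?w = "shadow_vector \<zeta> x z"
  have "\<bar>qform Obs ?w\<bar> \<le> norm ?w * norm (Obs *v ?w)"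
    unfolding qform_def using abs_Re_le_cmod vinner_Cauchy_Schwarz by (rule order.trans)
  also have "\<dots> \<le> op_norm Obs"
    using norm_mult_vector_le_op_norm[of Obs ?w] assms by (simp add: norm_shadow_vector)
  finally have "(2 ^ CARD('q) + 1) * \<bar>qform Obs ?w\<bar> \<le> (2 ^ CARD('q) + 1) * op_norm Obs"
    by (intro mult_left_mono) auto
  moreover have "\<bar>shadow_estimate Obs \<zeta> x z\<bar> \<le> \<bar>(2 ^ CARD('q) + 1) * qform Obs ?w\<bar> + \<bar>Re (trace Obs)\<bar>"
    unfolding shadow_estimate_qform by (rule abs_triangle_ineq4)
  ultimately show ?thesis by (simp add: estimate_bound_def abs_mult)
qed

lemma AE_outcome_kernel_bounded:
  assumes "norm \<zeta> = 1"
  shows "AE y in outcome_kernel \<zeta>. \<bar>y\<bar> \<le> estimate_bound"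
proof -
  have "emeasure (outcome_kernel \<zeta>) {y. \<not> \<bar>y\<bar> \<le> estimate_bound} = 0"
    using shadow_estimate_bounded[OF assms]
    by (subst emeasure_outcome_kernel) (auto simp: case_prod_beta)
  then show ?thesis
    by (subst AE_iff_measurable[OF _ refl]) (auto simp: sets_outcome_kernel space_outcome_kernel)
qed

lemma AE_estimate_bounded: "AE y in estimate_distr Obs \<rho> S. \<bar>y\<bar> \<le> estimate_bound"
proof -
  have "AE \<zeta> in S. AE y in subprob_kernel \<zeta>. \<bar>y\<bar> \<le> estimate_bound"
    using AE_subprob_kernel by eventually_elim (metis AE_outcome_kernel_bounded)
  then show ?thesis
    unfolding estimate_distr_bind by (subst AE_bind[OF subprob_kernel_measurable]) auto
qed

lemma integral_outcome_kernel:
  fixes g :: "real \<Rightarrow> real"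
  assumes [measurable]: "g \<in> borel_measurable borel"
  shows "(\<integral>y. g y \<partial>outcome_kernel \<zeta>) = (\<Sum>(z, x)\<in>UNIV. born_prob \<rho> \<zeta> z x * g (shadow_estimate Obs \<zeta> x z))"
  by (simp add: outcome_kernel_def integral_distr integral_density born_prob_nonneg
      lebesgue_integral_count_space_finite case_prod_unfold)

text \<open>The rule for integrals over a bind is applied with a global bound, which the identity
  and the square do not have. Clamping the argument to the range of the estimates gives a bounded
  \<open>h\<close> that agrees with \<open>g\<close> almost everywhere.\<close>

lemma integral_estimate_distr:
  fixes g :: "real \<Rightarrow> real"
  assumes g: "continuous_on UNIV g"
  shows "integrable (estimate_distr Obs \<rho> S) g"
    and "(\<integral>y. g y \<partial>estimate_distr Obs \<rho> S)
      = (\<integral>\<zeta>. (\<Sum>(z, x)\<in>UNIV. born_prob \<rho> \<zeta> z x * g (shadow_estimate Obs \<zeta> x z)) \<partial>S)"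
proof -
  let ?D = "estimate_distr Obs \<rho> S" and ?B = "estimate_bound"
  interpret D: prob_space ?D by (rule prob_space_estimate_distr)
  have B: "0 \<le> ?B" using op_norm_nonneg[of Obs] by (simp add: estimate_bound_def)
  define h where "h y = g (max (- ?B) (min ?B y))" for y
  have h_cont: "continuous_on UNIV h"
    unfolding h_def by (intro continuous_on_compose2[OF g] continuous_intros) auto
  then have h_meas: "h \<in> borel_measurable borel" by (rule borel_measurable_continuous_onI)
  have g_meas: "g \<in> borel_measurable ?D"
    using borel_measurable_continuous_onI[OF g] by (simp add: measurable_cong_sets[OF sets_estimate_distr refl])
  have h_meas': "h \<in> borel_measurable ?D"
    using h_meas by (simp add: measurable_cong_sets[OF sets_estimate_distr refl])
  have hg: "h y = g y" if "\<bar>y\<bar> \<le> ?B" for y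
  proof -
    have "max (- ?B) (min ?B y) = y" using that by (auto simp: max_def min_def)
    then show ?thesis by (simp add: h_def)
  qed
  have AE_hg: "AE y in ?D. h y = g y"
    using AE_estimate_bounded by eventually_elim (rule hg)
  have "compact (g ` {- ?B..?B})"
    by (intro compact_continuous_image continuous_on_subset[OF g]) auto
  then obtain C where "\<And>y. y \<in> {- ?B..?B} \<Longrightarrow> norm (g y) \<le> C"
    using compact_imp_bounded bounded_iff by (metis imageI)
  then have C: "\<bar>h y\<bar> \<le> C" for y
    using B by (auto simp: h_def)
  have "integrable ?D h"
    using C h_meas' by (intro D.integrable_const_bound[of _ C]) auto
  then show "integrable ?D g"
    using integrable_cong_AE[OF h_meas' g_meas AE_hg] by simp
  have "(\<integral>y. g y \<partial>?D) = (\<integral>y. h y \<partial>?D)"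
    using AE_hg by (intro integral_cong_AE g_meas h_meas') auto
  also have "\<dots> = (\<integral>\<zeta>. (\<integral>y. h y \<partial>subprob_kernel \<zeta>) \<partial>S)"
    unfolding estimate_distr_bind
  proof (rule integral_bind[where K=borel and B=C and B'=1])
    show "finite_measure S" using S(1) by (rule prob_space.finite_measure)
    show "AE \<zeta> in S. emeasure (subprob_kernel \<zeta>) (space (subprob_kernel \<zeta>)) \<le> ennreal 1"
      using AE_subprob_kernel by eventually_elim (metis ennreal_1 order_refl prob_space.emeasure_space_1)
  qed (use C h_meas subprob_kernel_measurable in auto)
  also have "\<dots> = (\<integral>\<zeta>. (\<Sum>(z, x)\<in>UNIV. born_prob \<rho> \<zeta> z x * g (shadow_estimate Obs \<zeta> x z)) \<partial>S)"
  proof (rule integral_cong_AE)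
    show "(\<lambda>\<zeta>. \<integral>y. h y \<partial>subprob_kernel \<zeta>) \<in> borel_measurable S"
      using subprob_kernel_measurable integral_measurable_subprob_algebra[OF h_meas] by (rule measurable_compose)
    show "(\<lambda>\<zeta>. \<Sum>(z, x)\<in>UNIV. born_prob \<rho> \<zeta> z x * g (shadow_estimate Obs \<zeta> x z)) \<in> borel_measurable S"
      unfolding case_prod_beta
      by (intro borel_measurable_integrable integrable_on_sphere[OF S] continuous_intros continuous_on_born_prob
          continuous_on_compose2[OF g] continuous_on_shadow_estimate) auto
    show "AE \<zeta> in S. (\<integral>y. h y \<partial>subprob_kernel \<zeta>) = (\<Sum>(z, x)\<in>UNIV. born_prob \<rho> \<zeta> z x * g (shadow_estimate Obs \<zeta> x z))"
      using AE_subprob_kernel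
    proof eventually_elim
      case (elim \<zeta>)
      then show ?case
        using shadow_estimate_bounded[of \<zeta>] by (auto simp: integral_outcome_kernel[OF h_meas] hg intro!: sum.cong)
    qed
  qed
  finally show "(\<integral>y. g y \<partial>?D) = (\<integral>\<zeta>. (\<Sum>(z, x)\<in>UNIV. born_prob \<rho> \<zeta> z x * g (shadow_estimate Obs \<zeta> x z)) \<partial>S)" .
qed

text \<open>Expand the powers of the shifted estimate. The total weight of the outcomes is kept as
  \<open>norm \<zeta> ^ 2\<close>, so that the pointwise identities hold for every
  \<open>\<zeta>\<close>; it becomes 1 only under the integral.\<close>

lemma estimate_moments:
  shows "(\<integral>y. y \<partial>estimate_distr Obs \<rho> S) = shadow_moment Obs \<rho> S 1 - Re (trace Obs)"
    and "(\<integral>y. y\<^sup>2 \<partial>estimate_distr Obs \<rho> S)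
      = shadow_moment Obs \<rho> S 2 - 2 * Re (trace Obs) * shadow_moment Obs \<rho> S 1 + (Re (trace Obs))\<^sup>2"
proof -
  let ?D = "2 ^ CARD('q) :: real" and ?T = "Re (trace Obs)"
  let ?b = "born_prob \<rho>" and ?est = "shadow_estimate Obs"
  have sum_int: "integrable S (shadow_sum Obs \<rho> k)" for k
    by (intro integrable_on_sphere[OF S] continuous_on_shadow_sum)
  have norm_int: "integrable S (\<lambda>\<zeta>. (norm \<zeta>)\<^sup>2)"
    by (intro integrable_on_sphere[OF S] continuous_intros)
  have "(\<integral>\<zeta>. (norm \<zeta>)\<^sup>2 \<partial>S) = (\<integral>\<zeta>. 1 \<partial>S)"
    using S(3) borel_measurable_integrable[OF norm_int] by (intro integral_cong_AE) auto
  then have norm_one: "(\<integral>\<zeta>. (norm \<zeta>)\<^sup>2 \<partial>S) = 1"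
    using prob_space.prob_space[OF S(1)] by simp
  have weighted: "(\<Sum>(z, x)\<in>UNIV. ?b \<zeta> z x * qform Obs (shadow_vector \<zeta> x z) ^ k) = shadow_sum Obs \<rho> k \<zeta> / ?D" for \<zeta> k
    by (simp add: shadow_sum_def born_prob_qform case_prod_beta sum_divide_distrib)
  have "(\<Sum>(z, x)\<in>UNIV. ?b \<zeta> z x * ?est \<zeta> x z)
     = (?D + 1) / ?D * shadow_sum Obs \<rho> 1 \<zeta> - ?T * (norm \<zeta>)\<^sup>2" for \<zeta>
  proof -
    have "?b \<zeta> z x * ?est \<zeta> x z = (?D + 1) * (?b \<zeta> z x * qform Obs (shadow_vector \<zeta> x z) ^ 1) - ?T * ?b \<zeta> z x" for z x
      by (simp add: shadow_estimate_qform algebra_simps)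
    then have "(\<Sum>(z, x)\<in>UNIV. ?b \<zeta> z x * ?est \<zeta> x z)
      = (?D + 1) * (\<Sum>(z, x)\<in>UNIV. ?b \<zeta> z x * qform Obs (shadow_vector \<zeta> x z) ^ 1) - ?T * (\<Sum>(z, x)\<in>UNIV. ?b \<zeta> z x)"
      by (simp only: case_prod_unfold sum_subtractf sum_distrib_left)
    then show ?thesis by (simp only: weighted sum_born_prob) simp
  qed
  then show "(\<integral>y. y \<partial>estimate_distr Obs \<rho> S) = shadow_moment Obs \<rho> S 1 - ?T"
    using integral_estimate_distr(2)[of "\<lambda>y. y"] sum_int norm_int norm_one
    by (simp add: shadow_moment_def continuous_on_id)
  have "(\<Sum>(z, x)\<in>UNIV. ?b \<zeta> z x * (?est \<zeta> x z)\<^sup>2)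
     = (?D + 1)\<^sup>2 / ?D * shadow_sum Obs \<rho> 2 \<zeta> - 2 * ?T * ((?D + 1) / ?D * shadow_sum Obs \<rho> 1 \<zeta>) + ?T\<^sup>2 * (norm \<zeta>)\<^sup>2" for \<zeta>
  proof -
    have "?b \<zeta> z x * (?est \<zeta> x z)\<^sup>2 = (?D + 1)\<^sup>2 * (?b \<zeta> z x * qform Obs (shadow_vector \<zeta> x z) ^ 2)
       - 2 * ?T * (?D + 1) * (?b \<zeta> z x * qform Obs (shadow_vector \<zeta> x z) ^ 1) + ?T\<^sup>2 * ?b \<zeta> z x" for z x
      by (simp add: shadow_estimate_qform power2_eq_square algebra_simps)
    then have "(\<Sum>(z, x)\<in>UNIV. ?b \<zeta> z x * (?est \<zeta> x z)\<^sup>2)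
      = (?D + 1)\<^sup>2 * (\<Sum>(z, x)\<in>UNIV. ?b \<zeta> z x * qform Obs (shadow_vector \<zeta> x z) ^ 2)
       - 2 * ?T * (?D + 1) * (\<Sum>(z, x)\<in>UNIV. ?b \<zeta> z x * qform Obs (shadow_vector \<zeta> x z) ^ 1) + ?T\<^sup>2 * (\<Sum>(z, x)\<in>UNIV. ?b \<zeta> z x)"
      by (simp only: case_prod_unfold sum_subtractf sum.distrib sum_distrib_left)
    then show ?thesis by (simp only: weighted sum_born_prob) simp
  qed
  then show "(\<integral>y. y\<^sup>2 \<partial>estimate_distr Obs \<rho> S)
      = shadow_moment Obs \<rho> S 2 - 2 * ?T * shadow_moment Obs \<rho> S 1 + ?T\<^sup>2"
    using integral_estimate_distr(2)[of "\<lambda>y. y\<^sup>2"] sum_int norm_int norm_one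
    by (simp add: shadow_moment_def continuous_intros)
qed

end

text \<open>Both sample sizes are rounded up to natural numbers. The \<open>max 1\<close> matters:
  for \<open>Obs = 0\<close> the formula alone would give \<open>L = 0\<close>, a mean over no
  estimates.\<close>

theorem theorem2:
  fixes Obs \<rho> :: "complex ^ ('q::finite \<Rightarrow> bool) ^ ('q \<Rightarrow> bool)"
    and S :: "(complex ^ ('q \<Rightarrow> bool)) measure"
    and \<gamma> \<delta> \<epsilon> :: real
  assumes "hermitian Obs"
    and "density_matrix \<rho>"
    and "0 < \<gamma>" "\<gamma> < 1" "0 < \<delta>" "\<delta> < 1"
    and "prob_space S" "sets S = sets borel" "AE \<zeta> in S. norm \<zeta> = 1"
    and "approx_state_3design \<epsilon> S"
  defines "K \<equiv> nat \<lceil>2 * ln (2 / \<delta>)\<rceil>"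
    and "L \<equiv> max 1 (nat \<lceil>34 / \<gamma>\<^sup>2 * (3 * Re (trace (traceless_part Obs ** traceless_part Obs))
               + 3 * \<epsilon> * (op_norm Obs)\<^sup>2 * (2 ^ CARD('q) + 1)\<^sup>2)\<rceil>)"
  shows "measure (PiM ({..<K} \<times> {..<L}) (\<lambda>_. estimate_distr Obs \<rho> S))
           {\<omega> \<in> space (PiM ({..<K} \<times> {..<L}) (\<lambda>_. estimate_distr Obs \<rho> S)).
              cmod (complex_of_real (median_of_means L K \<omega>) - trace (Obs ** \<rho>))
                \<le> \<gamma> + (2 ^ CARD('q) + 1) * \<epsilon> * op_norm Obs}
         \<ge> 1 - \<delta>"
proof -
  note Obs = assms(1) and \<rho> = assms(2) and S = assms(7-9) and design = assms(10)
  let ?d = "2 ^ CARD('q) :: real"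
  define V where "V = 3 * Re (trace (traceless_part Obs ** traceless_part Obs)) + 3 * \<epsilon> * (op_norm Obs)\<^sup>2 * (?d + 1)\<^sup>2"
  define D where "D = estimate_distr Obs \<rho> S"
  define P where "P = PiM ({..<K} \<times> {..<L}) (\<lambda>_. D)"
  define m where "m = (\<integral>x. x \<partial>D)"
  note bounds = shadow_moment_bounds[OF Obs \<rho> S design]
  note moments = estimate_moments[OF Obs \<rho> S]
  have D: "prob_space D" "sets D = sets borel"
    unfolding D_def using prob_space_estimate_distr[OF Obs \<rho> S] sets_estimate_distr[OF Obs \<rho> S] by auto
  interpret P: prob_space P unfolding P_def by (intro prob_space_PiM D)
  have "ln (2 / \<delta>) > 0" using assms(5,6) by simp
  then have K: "K > 0" "real K \<ge> 2 * ln (2 / \<delta>)" by (simp_all add: K_def)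
  have L: "L > 0" "real L \<ge> 34 / \<gamma>\<^sup>2 * V"
    unfolding L_def V_def[symmetric] by linarith+
  have V: "(\<integral>x. x\<^sup>2 \<partial>D) - m\<^sup>2 \<le> V"
    using bounds(3) unfolding m_def D_def moments V_def by (simp add: power2_eq_square algebra_simps)
  have bias: "\<bar>m - Re (trace (Obs ** \<rho>))\<bar> \<le> (?d + 1) * \<epsilon> * op_norm Obs"
    using bounds(2) unfolding m_def D_def moments .
  have "continuous_on UNIV (\<lambda>x::real. x\<^sup>2)" by (intro continuous_intros)
  then have bad: "P.prob {\<omega> \<in> space P. \<bar>median_of_means L K \<omega> - m\<bar> > \<gamma>} \<le> \<delta>"
    unfolding P_def
    using median_of_means_concentration[OF D _ m_def V assms(3,5,6) K(2) L]
      integral_estimate_distr(1)[OF Obs \<rho> S, of "\<lambda>x. x\<^sup>2"] by (simp add: D_def)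
  have coord: "(\<lambda>\<omega>. \<omega> i) \<in> borel_measurable P" if "i \<in> {..<K} \<times> {..<L}" for i
    using measurable_component_singleton[OF that, of "\<lambda>_. D"]
    unfolding P_def measurable_cong_sets[OF refl D(2), of "PiM ({..<K} \<times> {..<L}) (\<lambda>_. D)"] .
  have [measurable]: "median_of_means L K \<in> borel_measurable P"
    unfolding median_of_means_def using K(1)
    by (intro borel_measurable_median borel_measurable_divide borel_measurable_sum coord) auto
  let ?good = "{\<omega> \<in> space P. cmod (complex_of_real (median_of_means L K \<omega>) - trace (Obs ** \<rho>))
                \<le> \<gamma> + (?d + 1) * \<epsilon> * op_norm Obs}"
  have trace_real: "trace (Obs ** \<rho>) = complex_of_real (Re (trace (Obs ** \<rho>)))"
    using bounds(1) by (simp add: complex_eq_iff)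
  \<comment> \<open>Concentration holds around the true mean \<open>m\<close> of one estimate. The
    distance from \<open>m\<close> to the target is the bias of the design, the second summand of
    the tolerance.\<close>
  have "{\<omega> \<in> space P. \<bar>median_of_means L K \<omega> - m\<bar> \<le> \<gamma>} \<subseteq> ?good"
  proof safe
    fix \<omega> assume "\<bar>median_of_means L K \<omega> - m\<bar> \<le> \<gamma>"
    then have "\<bar>median_of_means L K \<omega> - Re (trace (Obs ** \<rho>))\<bar> \<le> \<gamma> + (?d + 1) * \<epsilon> * op_norm Obs"
      using bias by linarith
    then show "cmod (complex_of_real (median_of_means L K \<omega>) - trace (Obs ** \<rho>)) \<le> \<gamma> + (?d + 1) * \<epsilon> * op_norm Obs"
      by (subst trace_real) (simp only: norm_of_real flip: of_real_diff)
  qed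
  moreover have "?good \<in> P.events" by measurable
  ultimately have "P.prob {\<omega> \<in> space P. \<bar>median_of_means L K \<omega> - m\<bar> \<le> \<gamma>} \<le> P.prob ?good"
    by (intro P.finite_measure_mono)
  moreover have "P.prob {\<omega> \<in> space P. \<bar>median_of_means L K \<omega> - m\<bar> \<le> \<gamma>}
      = 1 - P.prob {\<omega> \<in> space P. \<bar>median_of_means L K \<omega> - m\<bar> > \<gamma>}"
    using P.prob_neg[of "\<lambda>\<omega>. \<bar>median_of_means L K \<omega> - m\<bar> > \<gamma>"] by (simp add: not_less)
  ultimately show ?thesis using bad unfolding P_def D_def by simp
qed

end
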